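(* For every $k\ge3$ and an appropriate choice of Archimedean order units (for $\mathrm{NCP}(k)^\delta$ and for $\mathcal S_{k,2}$), there is an isomorphism of operator systems (unital complete order isomorphism) $$\mathrm{NCP}(k)^\delta\cong_{\mathrm{OpSys}}\mathcal S_{k,2},$$ where $\mathcal S_{k,2}\subseteq\mathbb C^{k+2}$ is the operator system of all tuples $\zeta=(z_1,\dots,z_k,z_{k+1},z_{k+2})$ for which $z_1+\cdots+z_k=z_{k+1}+z_{k+2}$, and where the matrix order on $\mathcal S_{k,2}$ is induced by the matrix order on the abelian C$^*$-algebra $\mathbb C^{k+2}$.
   Context: $\mathrm{NCP}(k)=\mathrm{Span}\{1,w,w^2,\dots,w^{k-1},v\}\subseteq\mathrm C^*(\mathbb Z_k*\mathbb Z_2)$ (full group C$^*$-algebra of the free product), where $w,v$ are the canonical unitaries from the generators of $\mathbb Z_k$ and $\mathbb Z_2$. An operator system is a matrix-ordered $*$-vector space with an Archimedean (matrix) order unit. For a finite-dimensional operator system $\mathcal R$, the dual $\mathcal R^\delta$ is the dual vector space with matrix order in which $[f_{ij}]\in\mathrm M_q(\mathcal R^\delta)$ is positive iff the map $x\mapsto[f_{ij}(x)]$, $\mathcal R\to\mathrm M_q(\mathbb C)$, is completely positive; any faithful positive linear functional (for instance a faithful state) on $\mathcal R$ may be chosen as Archimedean order unit of $\mathcal R^\delta$. No choice is canonical. *)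

theory Defs
  imports
    Complex_Main
    "HOL-Algebra.Elementary_Groups"
    "Jordan_Normal_Form.Matrix"
    "Jordan_Normal_Form.VS_Connect"
begin

section \<open>The free product of two groups\<close>

text \<open>
  Words in the disjoint union of the two carriers, modulo the congruence that multiplies adjacent
  letters of the same factor and deletes identity letters.
\<close>

inductive_set free_product_rel ::
    "('a, 'm) monoid_scheme \<Rightarrow> ('b, 'n) monoid_scheme \<Rightarrow> (('a + 'b) list \<times> ('a + 'b) list) set"
  for G :: "('a, 'm) monoid_scheme" and H :: "('b, 'n) monoid_scheme" where
  refl: "u \<in> lists (carrier G <+> carrier H) \<Longrightarrow> (u, u) \<in> free_product_rel G H"
| sym: "(u, v) \<in> free_product_rel G H \<Longrightarrow> (v, u) \<in> free_product_rel G H"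
| trans: "(u, v) \<in> free_product_rel G H \<Longrightarrow> (v, x) \<in> free_product_rel G H
    \<Longrightarrow> (u, x) \<in> free_product_rel G H"
| mult_left: "\<lbrakk>u \<in> lists (carrier G <+> carrier H); v \<in> lists (carrier G <+> carrier H);
     g \<in> carrier G; g' \<in> carrier G\<rbrakk>
    \<Longrightarrow> (u @ [Inl g, Inl g'] @ v, u @ [Inl (g \<otimes>\<^bsub>G\<^esub> g')] @ v) \<in> free_product_rel G H"
| mult_right: "\<lbrakk>u \<in> lists (carrier G <+> carrier H); v \<in> lists (carrier G <+> carrier H);
     h \<in> carrier H; h' \<in> carrier H\<rbrakk>
    \<Longrightarrow> (u @ [Inr h, Inr h'] @ v, u @ [Inr (h \<otimes>\<^bsub>H\<^esub> h')] @ v) \<in> free_product_rel G H"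
| one_left: "\<lbrakk>u \<in> lists (carrier G <+> carrier H); v \<in> lists (carrier G <+> carrier H)\<rbrakk>
    \<Longrightarrow> (u @ [Inl \<one>\<^bsub>G\<^esub>] @ v, u @ v) \<in> free_product_rel G H"
| one_right: "\<lbrakk>u \<in> lists (carrier G <+> carrier H); v \<in> lists (carrier G <+> carrier H)\<rbrakk>
    \<Longrightarrow> (u @ [Inr \<one>\<^bsub>H\<^esub>] @ v, u @ v) \<in> free_product_rel G H"

definition free_product ::
    "('a, 'm) monoid_scheme \<Rightarrow> ('b, 'n) monoid_scheme \<Rightarrow> ('a + 'b) list set monoid" where
  "free_product G H = \<lparr>
     carrier = lists (carrier G <+> carrier H) // free_product_rel G H,
     monoid.mult = (\<lambda>X Y. \<Union>u\<in>X. \<Union>v\<in>Y. free_product_rel G H `` {u @ v}),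
     one = free_product_rel G H `` {[]}\<rparr>"

definition free_inl ::
    "('a, 'm) monoid_scheme \<Rightarrow> ('b, 'n) monoid_scheme \<Rightarrow> 'a \<Rightarrow> ('a + 'b) list set" where
  "free_inl G H g = free_product_rel G H `` {[Inl g]}"

definition free_inr ::
    "('a, 'm) monoid_scheme \<Rightarrow> ('b, 'n) monoid_scheme \<Rightarrow> 'b \<Rightarrow> ('a + 'b) list set" where
  "free_inr G H h = free_product_rel G H `` {[Inr h]}"


section \<open>Complex *-vector spaces and *-algebras\<close>

text \<open>
  The same record serves for *-vector spaces, where the fields \<open>mult\<close> and \<open>one\<close> inherited from
  \<^type>\<open>module_ext\<close> are irrelevant, and for unital *-algebras, where they are not.
\<close>

record 'a star_space = "(complex, 'a) module" +
  star :: "'a \<Rightarrow> 'a"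

definition mat_space :: "nat \<Rightarrow> ('a, 'm) star_space_scheme \<Rightarrow> 'a mat star_space" where
  "mat_space n A = \<lparr>
     carrier = {X \<in> carrier_mat n n. elements_mat X \<subseteq> carrier A},
     monoid.mult = (\<lambda>X Y. mat n n (\<lambda>(i, j). \<Oplus>\<^bsub>A\<^esub> l\<in>{..<n}. X $$ (i, l) \<otimes>\<^bsub>A\<^esub> Y $$ (l, j))),
     one = mat n n (\<lambda>(i, j). if i = j then \<one>\<^bsub>A\<^esub> else \<zero>\<^bsub>A\<^esub>),
     zero = mat n n (\<lambda>_. \<zero>\<^bsub>A\<^esub>),
     add = (\<lambda>X Y. mat n n (\<lambda>ij. X $$ ij \<oplus>\<^bsub>A\<^esub> Y $$ ij)),
     smult = (\<lambda>c X. mat n n (\<lambda>ij. c \<odot>\<^bsub>A\<^esub> X $$ ij)),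
     star = (\<lambda>X. mat n n (\<lambda>(i, j). star A (X $$ (j, i))))\<rparr>"

definition complex_alg :: "complex star_space" where
  "complex_alg = \<lparr>carrier = UNIV, monoid.mult = (*), one = 1, zero = 0, add = (+),
     smult = (*), star = cnj\<rparr>"

definition tuple_alg :: "nat \<Rightarrow> complex vec star_space" where
  "tuple_alg m = \<lparr>
     carrier = carrier_vec m,
     monoid.mult = (\<lambda>x y. vec m (\<lambda>i. x $ i * y $ i)),
     one = vec m (\<lambda>_. 1),
     zero = 0\<^sub>v m,
     add = (+),
     smult = (\<cdot>\<^sub>v),
     star = (\<lambda>x. vec m (\<lambda>i. cnj (x $ i)))\<rparr>"

text \<open>
  The positive elements of a C*-algebra; they are formed only in \<open>mat_space n A\<close> for C*-algebras
  \<open>A\<close>.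
\<close>

definition positive_elements :: "('a, 'm) star_space_scheme \<Rightarrow> 'a set" where
  "positive_elements A = {star A y \<otimes>\<^bsub>A\<^esub> y | y. y \<in> carrier A}"


section \<open>The full group C*-algebra\<close>

definition group_algebra :: "('g, 'm) monoid_scheme \<Rightarrow> ('g \<Rightarrow> complex) star_space" where
  "group_algebra G = \<lparr>
     carrier = {a. finite {g. a g \<noteq> 0} \<and> {g. a g \<noteq> 0} \<subseteq> carrier G},
     monoid.mult = (\<lambda>a b x. if x \<in> carrier G
        then \<Sum>g | g \<in> carrier G \<and> a g \<noteq> 0. a g * b (inv\<^bsub>G\<^esub> g \<otimes>\<^bsub>G\<^esub> x) else 0),
     one = (\<lambda>x. if x = \<one>\<^bsub>G\<^esub> then 1 else 0),
     zero = (\<lambda>_. 0),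
     add = (\<lambda>a b x. a x + b x),
     smult = (\<lambda>c a x. c * a x),
     star = (\<lambda>a x. if x \<in> carrier G then cnj (a (inv\<^bsub>G\<^esub> x)) else 0)\<rparr>"

definition cstar_seminorm :: "('a, 'm) star_space_scheme \<Rightarrow> ('a \<Rightarrow> real) \<Rightarrow> bool" where
  "cstar_seminorm A p \<longleftrightarrow>
     (\<forall>x\<in>carrier A. 0 \<le> p x) \<and>
     (\<forall>x\<in>carrier A. \<forall>y\<in>carrier A. p (x \<oplus>\<^bsub>A\<^esub> y) \<le> p x + p y) \<and>
     (\<forall>c. \<forall>x\<in>carrier A. p (c \<odot>\<^bsub>A\<^esub> x) = cmod c * p x) \<and>
     (\<forall>x\<in>carrier A. \<forall>y\<in>carrier A. p (x \<otimes>\<^bsub>A\<^esub> y) \<le> p x * p y) \<and>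
     (\<forall>x\<in>carrier A. p (star A x \<otimes>\<^bsub>A\<^esub> x) = (p x)\<^sup>2)"

text \<open>
  The C*-seminorms on a *-algebra are exactly the functions \<open>a \<mapsto> \<parallel>\<pi>(a)\<parallel>\<close> for *-homomorphisms
  \<open>\<pi>\<close> into C*-algebras, equivalently *-representations on Hilbert spaces.  For \<open>\<complex>[G]\<close> the unital ones
  among these are the unitary representations of \<open>G\<close>, so the supremum is the universal norm, the norm
  of the full group C*-algebra.  It is finite, because \<open>p (\<delta>\<^sub>g) \<le> 1\<close> for every C*-seminorm \<open>p\<close>.
\<close>

definition universal_norm :: "('a, 'm) star_space_scheme \<Rightarrow> 'a \<Rightarrow> real" where
  "universal_norm A x = (SUP p \<in> {p. cstar_seminorm A p}. p x)"

definition cauchy_seqs :: "('a, 'm) star_space_scheme \<Rightarrow> (nat \<Rightarrow> 'a) set" where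
  "cauchy_seqs A = {s. (\<forall>n. s n \<in> carrier A) \<and>
     (\<forall>\<epsilon>>0. \<exists>M. \<forall>m\<ge>M. \<forall>n\<ge>M. universal_norm A (s m \<ominus>\<^bsub>A\<^esub> s n) < \<epsilon>)}"

definition cauchy_rel :: "('a, 'm) star_space_scheme \<Rightarrow> ((nat \<Rightarrow> 'a) \<times> (nat \<Rightarrow> 'a)) set" where
  "cauchy_rel A = {(s, t). s \<in> cauchy_seqs A \<and> t \<in> cauchy_seqs A \<and>
     (\<lambda>n. universal_norm A (s n \<ominus>\<^bsub>A\<^esub> t n)) \<longlonglongrightarrow> 0}"

text \<open>The completion of a *-algebra in its universal norm, as Cauchy sequences modulo null sequences.\<close>

definition enveloping_cstar :: "('a, 'm) star_space_scheme \<Rightarrow> (nat \<Rightarrow> 'a) set star_space" where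
  "enveloping_cstar A = \<lparr>
     carrier = cauchy_seqs A // cauchy_rel A,
     monoid.mult = (\<lambda>X Y. \<Union>s\<in>X. \<Union>t\<in>Y. cauchy_rel A `` {\<lambda>n. s n \<otimes>\<^bsub>A\<^esub> t n}),
     one = cauchy_rel A `` {\<lambda>_. \<one>\<^bsub>A\<^esub>},
     zero = cauchy_rel A `` {\<lambda>_. \<zero>\<^bsub>A\<^esub>},
     add = (\<lambda>X Y. \<Union>s\<in>X. \<Union>t\<in>Y. cauchy_rel A `` {\<lambda>n. s n \<oplus>\<^bsub>A\<^esub> t n}),
     smult = (\<lambda>c X. \<Union>s\<in>X. cauchy_rel A `` {\<lambda>n. c \<odot>\<^bsub>A\<^esub> s n}),
     star = (\<lambda>X. \<Union>s\<in>X. cauchy_rel A `` {\<lambda>n. star A (s n)})\<rparr>"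

definition full_group_cstar ::
    "('g, 'm) monoid_scheme \<Rightarrow> (nat \<Rightarrow> 'g \<Rightarrow> complex) set star_space" where
  "full_group_cstar G = enveloping_cstar (group_algebra G)"

definition canonical_unitary ::
    "('g, 'm) monoid_scheme \<Rightarrow> 'g \<Rightarrow> (nat \<Rightarrow> 'g \<Rightarrow> complex) set" where
  "canonical_unitary G g = cauchy_rel (group_algebra G) `` {\<lambda>_ x. if x = g then 1 else 0}"


section \<open>Operator systems\<close>

text \<open>\<open>mcone V n\<close> is the cone of positive elements of \<open>M\<^sub>n(V)\<close>.\<close>

record 'a opsys = "'a star_space" +
  mcone :: "nat \<Rightarrow> 'a mat set"
  order_unit :: 'a

definition unit_mat :: "nat \<Rightarrow> 'a opsys \<Rightarrow> 'a mat" where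
  "unit_mat n V = mat n n (\<lambda>(i, j). if i = j then order_unit V else \<zero>\<^bsub>V\<^esub>)"

definition hermitian_mats :: "nat \<Rightarrow> ('a, 'm) star_space_scheme \<Rightarrow> 'a mat set" where
  "hermitian_mats n V = {X \<in> carrier (mat_space n V). star (mat_space n V) X = X}"

text \<open>\<open>compress V n m A X = A\<^sup>* X A\<close> for \<open>X \<in> M\<^sub>n(V)\<close> and an \<open>n \<times> m\<close> scalar matrix \<open>A\<close>.\<close>

definition compress ::
    "('a, 'm) star_space_scheme \<Rightarrow> nat \<Rightarrow> nat \<Rightarrow> complex mat \<Rightarrow> 'a mat \<Rightarrow> 'a mat" where
  "compress V n m A X = mat m m (\<lambda>(i, j).
     \<Oplus>\<^bsub>V\<^esub> p\<in>{..<n} \<times> {..<n}. (cnj (A $$ (fst p, i)) * A $$ (snd p, j)) \<odot>\<^bsub>V\<^esub> X $$ p)"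

locale star_vector_space = vectorspace "class_ring :: complex ring" V
  for V :: "('a, 'm) star_space_scheme" (structure) +
  assumes star_closed: "x \<in> carrier V \<Longrightarrow> star V x \<in> carrier V"
    and star_star: "x \<in> carrier V \<Longrightarrow> star V (star V x) = x"
    and star_add: "x \<in> carrier V \<Longrightarrow> y \<in> carrier V \<Longrightarrow> star V (x \<oplus> y) = star V x \<oplus> star V y"
    and star_smult: "x \<in> carrier V \<Longrightarrow> star V (c \<odot>\<^bsub>V\<^esub> x) = cnj c \<odot>\<^bsub>V\<^esub> star V x"

locale operator_system = star_vector_space V for V :: "'a opsys" (structure) +
  assumes mcone_hermitian: "mcone V n \<subseteq> hermitian_mats n V"
    and mcone_add: "X \<in> mcone V n \<Longrightarrow> Y \<in> mcone V n \<Longrightarrow> X \<oplus>\<^bsub>mat_space n V\<^esub> Y \<in> mcone V n"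
    and mcone_smult: "0 \<le> r \<Longrightarrow> X \<in> mcone V n
      \<Longrightarrow> complex_of_real r \<odot>\<^bsub>mat_space n V\<^esub> X \<in> mcone V n"
    and mcone_proper: "X \<in> mcone V n \<Longrightarrow> \<ominus>\<^bsub>mat_space n V\<^esub> X \<in> mcone V n \<Longrightarrow> X = \<zero>\<^bsub>mat_space n V\<^esub>"
    and mcone_compress: "X \<in> mcone V n \<Longrightarrow> A \<in> carrier_mat n m \<Longrightarrow> compress V n m A X \<in> mcone V m"
    and order_unit_closed: "order_unit V \<in> carrier V"
    and order_unit_star: "star V (order_unit V) = order_unit V"
    and order_unit_dominates: "X \<in> hermitian_mats n V
      \<Longrightarrow> \<exists>r>0. complex_of_real r \<odot>\<^bsub>mat_space n V\<^esub> unit_mat n V \<ominus>\<^bsub>mat_space n V\<^esub> X \<in> mcone V n"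
    and archimedean: "X \<in> carrier (mat_space n V)
      \<Longrightarrow> (\<And>\<epsilon>. \<epsilon> > 0 \<Longrightarrow>
             complex_of_real \<epsilon> \<odot>\<^bsub>mat_space n V\<^esub> unit_mat n V \<oplus>\<^bsub>mat_space n V\<^esub> X \<in> mcone V n)
      \<Longrightarrow> X \<in> mcone V n"

definition completely_positive :: "'a opsys \<Rightarrow> 'b opsys \<Rightarrow> ('a \<Rightarrow> 'b) \<Rightarrow> bool" where
  "completely_positive V W \<phi> \<longleftrightarrow>
     \<phi> \<in> LinearCombinations.module_hom (class_ring :: complex ring) V W \<and>
     (\<forall>n. \<forall>X\<in>mcone V n. map_mat \<phi> X \<in> mcone W n)"

definition unital_complete_order_iso :: "'a opsys \<Rightarrow> 'b opsys \<Rightarrow> ('a \<Rightarrow> 'b) \<Rightarrow> bool" where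
  "unital_complete_order_iso V W \<phi> \<longleftrightarrow>
     bij_betw \<phi> (carrier V) (carrier W) \<and>
     \<phi> (order_unit V) = order_unit W \<and>
     completely_positive V W \<phi> \<and>
     completely_positive W V (inv_into (carrier V) \<phi>)"

text \<open>
  The subspace \<open>S\<close> of the C*-algebra \<open>A\<close> with the matrix order induced from \<open>A\<close>, and with order
  unit \<open>e\<close>, which need not be the identity of \<open>A\<close>.
\<close>

definition subsystem :: "('a, 'm) star_space_scheme \<Rightarrow> 'a set \<Rightarrow> 'a \<Rightarrow> 'a opsys" where
  "subsystem A S e = \<lparr>carrier = S, monoid.mult = monoid.mult A, one = \<one>\<^bsub>A\<^esub>, zero = \<zero>\<^bsub>A\<^esub>,
     add = add A, smult = module.smult A, star = star A,
     mcone = (\<lambda>n. {X \<in> positive_elements (mat_space n A). elements_mat X \<subseteq> S}),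
     order_unit = e\<rparr>"

definition mat_system :: "nat \<Rightarrow> complex mat opsys" where
  "mat_system q =
     (let M = mat_space q complex_alg in subsystem M (carrier M) \<one>\<^bsub>M\<^esub>)"

text \<open>
  The dual of \<open>V\<close> with order unit \<open>\<delta>\<close>.  Functionals are taken to be \<^const>\<open>undefined\<close> outside the
  carrier, so that distinct elements of the dual differ on \<open>V\<close>.
\<close>

definition dual_system :: "'a opsys \<Rightarrow> ('a \<Rightarrow> complex) \<Rightarrow> ('a \<Rightarrow> complex) opsys" where
  "dual_system V \<delta> = (let
      D = LinearCombinations.module_hom (class_ring :: complex ring) V complex_alg \<inter> extensional (carrier V)
    in \<lparr>carrier = D,
     monoid.mult = undefined,
     one = undefined,
     zero = (\<lambda>x\<in>carrier V. 0),
     add = (\<lambda>f g. \<lambda>x\<in>carrier V. f x + g x),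
     smult = (\<lambda>c f. \<lambda>x\<in>carrier V. c * f x),
     star = (\<lambda>f. \<lambda>x\<in>carrier V. cnj (f (star V x))),
     mcone = (\<lambda>q. {F \<in> carrier_mat q q. elements_mat F \<subseteq> D \<and>
        completely_positive V (mat_system q) (\<lambda>x. map_mat (\<lambda>f. f x) F)}),
     order_unit = \<delta>\<rparr>)"

definition faithful_positive_functional :: "'a opsys \<Rightarrow> ('a \<Rightarrow> complex) \<Rightarrow> bool" where
  "faithful_positive_functional V \<delta> \<longleftrightarrow>
     \<delta> \<in> LinearCombinations.module_hom (class_ring :: complex ring) V complex_alg \<inter> extensional (carrier V) \<and>
     (\<forall>x\<in>carrier V. mat 1 1 (\<lambda>_. x) \<in> mcone V 1 \<longrightarrow>
        (\<exists>r\<ge>0. \<delta> x = complex_of_real r) \<and> (\<delta> x = 0 \<longrightarrow> x = \<zero>\<^bsub>V\<^esub>))"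


section \<open>The operator systems \<open>NCP(k)\<close> and \<open>S\<^sub>k\<^sub>,\<^sub>2\<close>\<close>

abbreviation free_prod_Zk_Z2 :: "nat \<Rightarrow> (int + int) list set monoid" where
  "free_prod_Zk_Z2 k \<equiv> free_product (integer_mod_group k) (integer_mod_group 2)"

abbreviation cstar_Zk_Z2 :: "nat \<Rightarrow> (nat \<Rightarrow> (int + int) list set \<Rightarrow> complex) set star_space" where
  "cstar_Zk_Z2 k \<equiv> full_group_cstar (free_prod_Zk_Z2 k)"

definition NCP_w :: "nat \<Rightarrow> (nat \<Rightarrow> (int + int) list set \<Rightarrow> complex) set" where
  "NCP_w k = canonical_unitary (free_prod_Zk_Z2 k)
     (free_inl (integer_mod_group k) (integer_mod_group 2) 1)"

definition NCP_v :: "nat \<Rightarrow> (nat \<Rightarrow> (int + int) list set \<Rightarrow> complex) set" where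
  "NCP_v k = canonical_unitary (free_prod_Zk_Z2 k)
     (free_inr (integer_mod_group k) (integer_mod_group 2) 1)"

definition NCP :: "nat \<Rightarrow> (nat \<Rightarrow> (int + int) list set \<Rightarrow> complex) set opsys" where
  "NCP k = subsystem (cstar_Zk_Z2 k)
     (LinearCombinations.module.span (class_ring :: complex ring) (cstar_Zk_Z2 k)
        ({NCP_w k [^]\<^bsub>cstar_Zk_Z2 k\<^esub> j | j::nat. j < k} \<union> {NCP_v k}))
     \<one>\<^bsub>cstar_Zk_Z2 k\<^esub>"

text \<open>The coordinates are indexed from \<open>0\<close>: \<open>z $ i\<close> is \<open>z\<^sub>i\<^sub>+\<^sub>1\<close>.\<close>

definition S_k2 :: "nat \<Rightarrow> complex vec \<Rightarrow> complex vec opsys" where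
  "S_k2 k e = subsystem (tuple_alg (k + 2))
     {z \<in> carrier_vec (k + 2). (\<Sum>i<k. z $ i) = z $ k + z $ (k + 1)} e"

end

theory Submission
  imports Defs "HOL-Analysis.L2_Norm"
begin

text \<open>
  Write \<open>w\<close> and \<open>v\<close> for the canonical unitaries.  Since \<open>w\<^sup>k = 1\<close> and \<open>v\<^sup>2 = 1\<close>, the space
  \<open>NCP(k)\<close> is spanned by the spectral projections \<open>p\<^sub>0, \<dots>, p\<^sub>k\<^sub>-\<^sub>1\<close> of \<open>w\<close> together with
  \<open>q\<^sub>\<plusminus> = (1 \<plusminus> v) / 2\<close>, and the linear relations among them are the multiples of
  \<open>p\<^sub>0 + \<dots> + p\<^sub>k\<^sub>-\<^sub>1 = q\<^sub>+ + q\<^sub>-\<close>, where both sides are \<open>1\<close>.  Evaluation at these \<open>k + 2\<close> projections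
  therefore maps the dual of \<open>NCP(k)\<close> bijectively onto the tuples of \<open>S\<^sub>k\<^sub>,\<^sub>2\<close>.  What has to be shown is
  that a matrix \<open>F = [f\<^sub>i\<^sub>j]\<close> of functionals is positive, that is \<open>x \<mapsto> [f\<^sub>i\<^sub>j(x)]\<close> is completely
  positive, exactly when the \<open>k + 2\<close> scalar matrices \<open>F(p\<^sub>l)\<close>, \<open>F(q\<^sub>\<plusminus>)\<close> are positive semidefinite
  (\<open>completely_positive_iff\<close>).

  One direction holds because projections are positive.  For the other, factor the given matrices as
  \<open>F(p\<^sub>l) = Y\<^sub>l\<^sup>* Y\<^sub>l\<close> and \<open>F(q\<^sub>\<plusminus>) = Y\<^sub>\<plusminus>\<^sup>* Y\<^sub>\<plusminus>\<close>, and let \<open>\<xi>\<^sub>j\<close> and \<open>\<eta>\<^sub>j\<close> be the vectors that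
  stack the \<open>j\<close>-th columns of the \<open>Y\<^sub>l\<close> and of the \<open>Y\<^sub>\<plusminus>\<close>.  Because
  \<open>F(p\<^sub>0) + \<dots> + F(p\<^sub>k\<^sub>-\<^sub>1) = F(1) = F(q\<^sub>+) + F(q\<^sub>-)\<close>, both families have the same Gram matrix, so a
  unitary \<open>U\<close> of a finite-dimensional space maps \<open>\<xi>\<^sub>j\<close> to \<open>\<eta>\<^sub>j\<close> (\<open>unitary_of_equal_gram\<close>, by
  Householder reflections).  Let \<open>w\<close> act diagonally on the stacked coordinates, and let \<open>v\<close> act as
  \<open>U\<^sup>* S U\<close> with a diagonal matrix \<open>S\<close> of signs.  The free product imposes no relation
  between \<open>w\<close> and \<open>v\<close>, so this is a unitary representation, and \<open>f\<^sub>i\<^sub>j(x) = \<langle>\<xi>\<^sub>i, x \<xi>\<^sub>j\<rangle>\<close> on \<open>NCP(k)\<close>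
  (\<open>dilation\<close>, \<open>psd_of_cone\<close>): the two positive-operator-valued measures \<open>F(p\<^sub>l)\<close> and \<open>F(q\<^sub>\<plusminus>)\<close>
  are dilated simultaneously to projection-valued ones.  Matrices of vector functionals of a
  representation are completely positive.

  To use this on the completion, it suffices that the operator norm of a finite-dimensional unitary
  representation is a C*-seminorm (\<open>cstar_seminorm_opnorm\<close>), hence at most the universal norm: matrix
  coefficients then extend to Cauchy sequences, and positivity on \<open>X = Y\<^sup>* Y\<close> is obtained by
  approximating the entries of \<open>Y\<close> by elements of the group algebra (\<open>coeff_positive\<close>).  The
  one-dimensional representations \<open>w \<mapsto> e\<^bsup>2 \<pi> i l / k\<^esup>, v \<mapsto> \<plusminus>1\<close> show that \<open>p\<^sub>0, \<dots>, p\<^sub>k\<^sub>-\<^sub>1, v\<close> are linearly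
  independent (\<open>E_eqD\<close>).

  Consequently both sides are operator systems in which a matrix is positive when each of its
  \<open>k + 2\<close> coordinate matrices is; the axioms for such systems are checked once
  (\<open>coordinate_system\<close>).  As order unit serves the tuple \<open>(1, \<dots>, 1, k/2, k/2)\<close>, which
  corresponds to \<open>k\<close> times the canonical trace (\<open>faithful_trace\<close>).
\<close>

section \<open>Positive semidefinite matrices\<close>

text \<open>
  The form is complex-valued, and its values are required to be real and nonnegative; Hermitian symmetry
  is a consequence (\<open>psd_hermitian\<close>).
\<close>

definition psd :: "'i set \<Rightarrow> ('i \<Rightarrow> 'i \<Rightarrow> complex) \<Rightarrow> bool" where
  "psd I M \<longleftrightarrow> (\<forall>c. \<exists>r\<ge>0. (\<Sum>i\<in>I. \<Sum>j\<in>I. cnj (c i) * M i j * c j) = complex_of_real r)"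

lemma psdI:
  assumes "\<And>c. \<exists>r\<ge>0. (\<Sum>i\<in>I. \<Sum>j\<in>I. cnj (c i) * M i j * c j) = complex_of_real r"
  shows "psd I M"
  using assms by (simp add: psd_def)

lemma psdD:
  assumes "psd I M"
  shows "\<exists>r\<ge>0. (\<Sum>i\<in>I. \<Sum>j\<in>I. cnj (c i) * M i j * c j) = complex_of_real r"
  using assms by (simp add: psd_def)

lemma psd_cong:
  assumes "\<And>i j. i \<in> I \<Longrightarrow> j \<in> I \<Longrightarrow> M i j = M' i j"
  shows "psd I M \<longleftrightarrow> psd I M'"
  using assms by (simp add: psd_def)

lemma gram_psd:
  assumes "\<And>i j. i \<in> I \<Longrightarrow> j \<in> I \<Longrightarrow> M i j = (\<Sum>l\<in>L. cnj (Y l i) * Y l j)"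
  shows "psd I M"
proof (rule psdI)
  fix c
  have "(\<Sum>i\<in>I. \<Sum>j\<in>I. cnj (c i) * M i j * c j)
      = (\<Sum>i\<in>I. \<Sum>j\<in>I. \<Sum>l\<in>L. cnj (Y l i * c i) * (Y l j * c j))"
    by (simp add: assms sum_distrib_left sum_distrib_right mult_ac)
  also have "\<dots> = (\<Sum>l\<in>L. \<Sum>i\<in>I. \<Sum>j\<in>I. cnj (Y l i * c i) * (Y l j * c j))"
    by (simp add: sum.swap[of _ _ L])
  also have "\<dots> = (\<Sum>l\<in>L. cnj (\<Sum>j\<in>I. Y l j * c j) * (\<Sum>j\<in>I. Y l j * c j))"
    by (simp add: sum_product)
  also have "\<dots> = complex_of_real (\<Sum>l\<in>L. (cmod (\<Sum>j\<in>I. Y l j * c j))\<^sup>2)"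
    by (simp only: of_real_sum complex_norm_square mult.commute)
  finally show "\<exists>r\<ge>0. (\<Sum>i\<in>I. \<Sum>j\<in>I. cnj (c i) * M i j * c j) = complex_of_real r"
    by (metis (no_types, lifting) sum_nonneg zero_le_power2)
qed

lemma sesqui_two_points:
  assumes "finite I" "i \<in> I" "j \<in> I" "i \<noteq> j"
  shows "(\<Sum>k\<in>I. \<Sum>l\<in>I. cnj (((\<lambda>_. 0)(i := a, j := b)) k) * M k l * ((\<lambda>_. 0)(i := a, j := b)) l)
    = cnj a * M i i * a + cnj a * M i j * b + cnj b * M j i * a + cnj b * M j j * (b::complex)"
proof -
  let ?c = "(\<lambda>_. 0)(i := a, j := b)"
  have "(\<Sum>k\<in>I. \<Sum>l\<in>I. cnj (?c k) * M k l * ?c l) = (\<Sum>k\<in>{i,j}. \<Sum>l\<in>I. cnj (?c k) * M k l * ?c l)"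
    using assms by (intro sum.mono_neutral_right) auto
  also have "\<dots> = (\<Sum>k\<in>{i,j}. \<Sum>l\<in>{i,j}. cnj (?c k) * M k l * ?c l)"
    using assms by (intro sum.cong HOL.refl sum.mono_neutral_right) auto
  also have "\<dots> = cnj a * M i i * a + cnj a * M i j * b + cnj b * M j i * a + cnj b * M j j * b"
    using assms by (simp add: add_ac)
  finally show ?thesis .
qed

lemma psd_diag:
  assumes "psd I M" "finite I" "i \<in> I"
  shows "\<exists>r\<ge>0. M i i = complex_of_real r"
proof -
  let ?c = "(\<lambda>_. 0)(i := 1 :: complex)"
  have "(\<Sum>k\<in>I. \<Sum>l\<in>I. cnj (?c k) * M k l * ?c l) = (\<Sum>k\<in>{i}. \<Sum>l\<in>I. cnj (?c k) * M k l * ?c l)"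
    using assms by (intro sum.mono_neutral_right) auto
  also have "\<dots> = (\<Sum>k\<in>{i}. \<Sum>l\<in>{i}. cnj (?c k) * M k l * ?c l)"
    using assms by (intro sum.cong HOL.refl sum.mono_neutral_right) auto
  finally show ?thesis
    using psdD[OF assms(1), of ?c] by auto
qed

lemma psd_two_points:
  assumes "psd I M" "finite I" "i \<in> I" "j \<in> I" "i \<noteq> j"
  shows "\<exists>r\<ge>0. cnj a * M i i * a + cnj a * M i j * b + cnj b * M j i * a + cnj b * M j j * b
    = complex_of_real r"
  using psdD[OF assms(1), of "(\<lambda>_. 0)(i := a, j := b)"]
  unfolding sesqui_two_points[OF assms(2-5)] .

lemma psd_hermitian:
  assumes "psd I M" "finite I" "i \<in> I" "j \<in> I"
  shows "M j i = cnj (M i j)"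
proof (cases "i = j")
  case True
  then show ?thesis using psd_diag[OF assms(1-3)] by auto
next
  case False
  note two = psd_two_points[OF assms False]
  obtain p q where pq: "M i i = complex_of_real p" "M j j = complex_of_real q"
    using psd_diag[OF assms(1,2)] assms(3,4) by metis
  have "Im (M i j + M j i) = 0"
    using two[of 1 1] unfolding pq by (auto simp: complex_eq_iff)
  moreover have "Re (M i j - M j i) = 0"
    using two[of 1 \<i>] unfolding pq by (auto simp: complex_eq_iff)
  ultimately show ?thesis by (auto simp: complex_eq_iff)
qed

text \<open>
  If \<open>M i i = 0\<close>, the form at \<open>- t M i j\<close> in position \<open>i\<close> and \<open>1\<close> in position \<open>j\<close> is affine in
  the real number \<open>t\<close> with slope \<open>- 2 \<bar>M i j\<bar>\<^sup>2\<close>; it stays nonnegative only if this slope is zero.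
\<close>

lemma psd_zero_diag:
  assumes "psd I M" "finite I" "i \<in> I" "j \<in> I" "M i i = 0"
  shows "M i j = 0"
proof (cases "i = j")
  case False
  note two = psd_two_points[OF assms(1-4) False]
  obtain q where q: "0 \<le> q" "M j j = complex_of_real q"
    using psd_diag[OF assms(1,2,4)] by metis
  have h: "M j i = cnj (M i j)" using psd_hermitian[OF assms(1-4)] .
  let ?m = "(cmod (M i j))\<^sup>2"
  have "2 * t * ?m \<le> q" for t :: real
  proof -
    have "cnj (- t * M i j) * M i i * (- t * M i j) + cnj (- t * M i j) * M i j * 1
      + cnj 1 * M j i * (- t * M i j) + cnj 1 * M j j * 1 = complex_of_real (q - 2 * t * ?m)"
      by (simp add: assms(5) q h complex_norm_square del: of_real_power)
    then show ?thesis using two[of "- t * M i j" 1] by (metis diff_ge_0_iff_ge of_real_eq_iff)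
  qed
  from this[of "(q + 1) / (2 * ?m)"] have "?m = 0"
    by (cases "?m = 0") (auto simp: field_simps)
  then show ?thesis by simp
qed (use assms in simp)

text \<open>
  Cholesky factorization.  Splitting off an index \<open>n\<close> leaves the Schur complement \<open>M'\<close>, which is again
  positive, because its form at \<open>c\<close> is the form of \<open>M\<close> at an extension of \<open>c\<close> to \<open>n\<close>.
\<close>

lemma psd_gram_factorization:
  assumes "finite I" "psd I M"
  shows "\<exists>Y. \<forall>i\<in>I. \<forall>j\<in>I. M i j = (\<Sum>l\<in>I. cnj (Y l i) * Y l j)"
  using assms
proof (induction I arbitrary: M rule: finite_induct)
  case (insert n I)
  let ?I = "insert n I"
  have fin: "finite ?I" using insert by simp
  note herm = psd_hermitian[OF insert.prems fin]
  obtain m where m: "0 \<le> m" "M n n = complex_of_real m"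
    using psd_diag[OF insert.prems fin, of n] by auto
  \<comment> \<open>If \<open>m = 0\<close>, the quotient is \<open>0\<close> by convention; the row of \<open>n\<close> then vanishes, so \<open>M' = M\<close> is right.\<close>
  define M' where "M' i j = M i j - M i n * M n j / m" for i j
  have psd': "psd I M'"
  proof (rule psdI)
    fix c :: "'a \<Rightarrow> complex"
    define s where "s = (\<Sum>j\<in>I. M n j * c j)"
    \<comment> \<open>The value at \<open>n\<close> minimizes the form of \<open>M\<close> among all extensions of \<open>c\<close>.\<close>
    define d where "d = c(n := - s / m)"
    define Q where "Q = (\<Sum>i\<in>I. \<Sum>j\<in>I. cnj (c i) * M i j * c j)"
    have d: "d i = c i" if "i \<in> I" for i using that insert by (auto simp: d_def)
    have s': "cnj s = (\<Sum>i\<in>I. cnj (c i) * M i n)"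
    proof -
      have "cnj (M n i * c i) = cnj (c i) * M i n" if "i \<in> I" for i
        using herm[of n i] that by simp
      from sum.cong[OF HOL.refl this] show ?thesis unfolding s_def cnj_sum .
    qed
    have "(\<Sum>i\<in>?I. \<Sum>j\<in>?I. cnj (d i) * M i j * d j)
        = cnj (d n) * m * d n + cnj (d n) * s + cnj s * d n + Q"
    proof -
      have 1: "(\<Sum>j\<in>I. cnj (d n) * M n j * d j) = cnj (d n) * s"
        by (simp add: s_def sum_distrib_left mult_ac d)
      have 2: "(\<Sum>i\<in>I. cnj (d i) * M i n * d n) = cnj s * d n"
        by (simp add: s' sum_distrib_right d)
      have 3: "(\<Sum>i\<in>I. \<Sum>j\<in>I. cnj (d i) * M i j * d j) = Q"
        by (simp add: Q_def d)
      show ?thesis using insert.hyps m by (simp add: sum.distrib 1 2 3)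
    qed
    also have "\<dots> = Q - cnj s * s / m"
      by (cases "m = 0") (auto simp: d_def field_simps)
    also have "\<dots> = (\<Sum>i\<in>I. \<Sum>j\<in>I. cnj (c i) * M' i j * c j)"
    proof -
      have "cnj s * s = (\<Sum>i\<in>I. \<Sum>j\<in>I. cnj (c i) * (M i n * M n j) * c j)"
        unfolding s' by (simp add: s_def sum_product mult.assoc)
      then have "cnj s * s / m = (\<Sum>i\<in>I. \<Sum>j\<in>I. cnj (c i) * (M i n * M n j / m) * c j)"
        by (simp add: sum_divide_distrib)
      then show ?thesis
        by (simp add: M'_def Q_def right_diff_distrib left_diff_distrib sum_subtractf)
    qed
    finally show "\<exists>r\<ge>0. (\<Sum>i\<in>I. \<Sum>j\<in>I. cnj (c i) * M' i j * c j) = complex_of_real r"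
      using psdD[OF insert.prems, of d] by (simp only:)
  qed
  from insert.IH[OF psd'] obtain Y
    where Y: "\<And>i j. i \<in> I \<Longrightarrow> j \<in> I \<Longrightarrow> M' i j = (\<Sum>l\<in>I. cnj (Y l i) * Y l j)" by blast
  define Z where "Z l i = (if l = n then M n i / sqrt m else if i = n then 0 else Y l i)" for l i
  have zero: "M n j = 0" "M j n = 0" if "m = 0" "j \<in> ?I" for j
    using psd_zero_diag[OF insert.prems fin, of n j] herm[of n j] that m by auto
  have "M i j = (\<Sum>l\<in>?I. cnj (Z l i) * Z l j)" if "i \<in> ?I" "j \<in> ?I" for i j
  proof -
    have 1: "cnj (Z n i) * Z n j = M i n * M n j / m"
    proof -
      have "complex_of_real (sqrt m) * complex_of_real (sqrt m) = complex_of_real m"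
        using m(1) by (simp flip: of_real_mult)
      then show ?thesis
        using herm[of n i] that(1) by (simp add: Z_def)
    qed
    have 2: "(\<Sum>l\<in>I. cnj (Z l i) * Z l j) = M i j - M i n * M n j / m"
    proof (cases "i = n \<or> j = n")
      case True
      then have "(\<Sum>l\<in>I. cnj (Z l i) * Z l j) = 0"
        using insert.hyps by (intro sum.neutral) (auto simp: Z_def)
      moreover have "M i j - M i n * M n j / m = 0"
      proof (cases "m = 0")
        case 0: True
        show ?thesis using True zero(1)[OF 0 that(2)] zero(2)[OF 0 that(1)] by auto
      next
        case False
        with True m(2) show ?thesis by auto
      qed
      ultimately show ?thesis by (simp only:)
    next
      case False
      then have "(\<Sum>l\<in>I. cnj (Z l i) * Z l j) = (\<Sum>l\<in>I. cnj (Y l i) * Y l j)"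
        using insert.hyps by (intro sum.cong) (auto simp: Z_def)
      also have "\<dots> = M' i j"
        by (rule Y[symmetric]) (use False that in auto)
      finally show ?thesis by (simp add: M'_def)
    qed
    show ?thesis
      unfolding sum.insert[OF insert.hyps(1,2)] 1 2 by simp
  qed
  then show ?case by (intro exI[of _ Z] ballI)
qed auto

section \<open>Unitary operators on finite-dimensional spaces\<close>

definition ip :: "'i set \<Rightarrow> ('i \<Rightarrow> complex) \<Rightarrow> ('i \<Rightarrow> complex) \<Rightarrow> complex" where
  "ip I f g = (\<Sum>i\<in>I. cnj (f i) * g i)"

definition nrm :: "'i set \<Rightarrow> ('i \<Rightarrow> complex) \<Rightarrow> real" where
  "nrm I f = L2_set (\<lambda>i. cmod (f i)) I"

lemma ip_cong: "(\<And>i. i \<in> I \<Longrightarrow> f i = f' i) \<Longrightarrow> (\<And>i. i \<in> I \<Longrightarrow> g i = g' i) \<Longrightarrow> ip I f g = ip I f' g'"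
  by (simp add: ip_def)

lemma ip_add_right: "ip I f (\<lambda>i. g i + h i) = ip I f g + ip I f h"
  by (simp add: ip_def distrib_left sum.distrib)

lemma ip_add_left: "ip I (\<lambda>i. g i + h i) f = ip I g f + ip I h f"
  by (simp add: ip_def distrib_right sum.distrib)

lemma ip_diff_right: "ip I f (\<lambda>i. g i - h i) = ip I f g - ip I f h"
  by (simp add: ip_def right_diff_distrib sum_subtractf)

lemma ip_diff_left: "ip I (\<lambda>i. g i - h i) f = ip I g f - ip I h f"
  by (simp add: ip_def left_diff_distrib sum_subtractf)

lemma ip_smult_right: "ip I f (\<lambda>i. c * g i) = c * ip I f g"
  by (simp add: ip_def sum_distrib_left mult_ac)

lemma ip_smult_left: "ip I (\<lambda>i. c * g i) f = cnj c * ip I g f"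
  by (simp add: ip_def sum_distrib_left mult_ac)

lemma ip_sum_right: "ip I f (\<lambda>i. \<Sum>j\<in>J. g j i) = (\<Sum>j\<in>J. ip I f (g j))"
  unfolding ip_def by (simp add: sum_distrib_left sum.swap[of _ J])

lemma ip_sum_left: "ip I (\<lambda>i. \<Sum>j\<in>J. g j i) f = (\<Sum>j\<in>J. ip I (g j) f)"
  unfolding ip_def by (simp add: sum_distrib_right sum.swap[of _ J])

lemma cnj_ip: "cnj (ip I f g) = ip I g f"
  by (simp add: ip_def mult.commute)

lemma ip_self: "ip I f f = complex_of_real ((nrm I f)\<^sup>2)"
proof -
  have "(nrm I f)\<^sup>2 = (\<Sum>i\<in>I. (cmod (f i))\<^sup>2)"
    unfolding nrm_def L2_set_def by (simp add: sum_nonneg)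
  then show ?thesis
    by (simp only: ip_def of_real_sum complex_norm_square mult.commute)
qed

lemma nrm_ge0: "0 \<le> nrm I f"
  by (simp add: nrm_def)

lemma cmod_ip_le: "cmod (ip I f g) \<le> nrm I f * nrm I g"
proof -
  have "cmod (ip I f g) \<le> (\<Sum>i\<in>I. \<bar>cmod (f i)\<bar> * \<bar>cmod (g i)\<bar>)"
    unfolding ip_def by (rule order_trans[OF norm_sum]) (simp add: norm_mult)
  also have "\<dots> \<le> nrm I f * nrm I g"
    unfolding nrm_def by (rule L2_set_mult_ineq)
  finally show ?thesis .
qed

lemma nrm_add: "nrm I (\<lambda>i. f i + g i) \<le> nrm I f + nrm I g"
  unfolding nrm_def
  by (rule order_trans[OF L2_set_mono L2_set_triangle_ineq]) (auto simp: norm_triangle_ineq)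

lemma nrm_smult: "nrm I (\<lambda>i. c * f i) = cmod c * nrm I f"
  unfolding nrm_def norm_mult by (rule L2_set_right_distrib[symmetric]) simp

lemma nrm_zero_iff: "finite I \<Longrightarrow> nrm I f = 0 \<longleftrightarrow> (\<forall>i\<in>I. f i = 0)"
  by (auto simp: nrm_def L2_set_eq_0_iff)

lemma nrm_eqI: "ip I f f = ip I g g \<Longrightarrow> nrm I f = nrm I g"
  unfolding ip_self of_real_eq_iff by (simp add: nrm_ge0 power2_eq_iff_nonneg)

definition lin_op :: "(('i \<Rightarrow> complex) \<Rightarrow> ('i \<Rightarrow> complex)) \<Rightarrow> bool" where
  "lin_op U \<longleftrightarrow> (\<forall>a b f g. U (\<lambda>i. a * f i + b * g i) = (\<lambda>i. a * U f i + b * U g i))"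

lemma lin_opD: "lin_op U \<Longrightarrow> U (\<lambda>i. a * f i + b * g i) = (\<lambda>i. a * U f i + b * U g i)"
  by (simp add: lin_op_def)

lemma lin_op_add: "lin_op U \<Longrightarrow> U (\<lambda>i. f i + g i) = (\<lambda>i. U f i + U g i)"
  using lin_opD[of U 1 f 1 g] by simp

lemma lin_op_smult: "lin_op U \<Longrightarrow> U (\<lambda>i. a * f i) = (\<lambda>i. a * U f i)"
  using lin_opD[of U a f 0 f] by simp

text \<open>
  The vectors are functions on the whole type, while the inner product sees only their restrictions to
  \<open>I\<close>.  The inverse is carried along as a second operator and is exact on the whole type, so that
  conjugates \<open>U\<^sup>* S U\<close> satisfy their relations without restriction to \<open>I\<close>.
\<close>

definition unitary_pair ::
    "'i set \<Rightarrow> (('i \<Rightarrow> complex) \<Rightarrow> ('i \<Rightarrow> complex)) \<Rightarrow> (('i \<Rightarrow> complex) \<Rightarrow> ('i \<Rightarrow> complex)) \<Rightarrow> bool" where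
  "unitary_pair I U U' \<longleftrightarrow> lin_op U \<and> lin_op U' \<and> (\<forall>f. U (U' f) = f) \<and> (\<forall>f. U' (U f) = f) \<and>
     (\<forall>f g. ip I (U f) g = ip I f (U' g))"

lemma unitary_pair_comp:
  assumes "unitary_pair I U U'" "unitary_pair I H H'"
  shows "unitary_pair I (\<lambda>f. H (U f)) (\<lambda>f. U' (H' f))"
  using assms by (simp add: unitary_pair_def lin_op_def)

text \<open>
  Let \<open>u = x - y\<close> and \<open>\<alpha> = \<langle>u, x\<rangle>\<close>.  The complex reflection \<open>z \<mapsto> z - (\<langle>u, z\<rangle> / \<alpha>) u\<close> sends \<open>x\<close> to \<open>y\<close> and
  fixes the vectors orthogonal to \<open>u\<close>.  When \<open>x\<close> and \<open>y\<close> have the same length,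
  \<open>\<langle>u, u\<rangle> = \<alpha> + cnj \<alpha>\<close>, and this makes it unitary, with \<open>cnj \<alpha>\<close> in place of \<open>\<alpha>\<close> in the inverse.
\<close>

lemma householder:
  assumes fin: "finite I" and eq: "ip I x x = ip I y y"
  shows "\<exists>H H'. unitary_pair I H H' \<and> (\<forall>i\<in>I. H x i = y i) \<and>
    (\<forall>z. ip I z x = ip I z y \<longrightarrow> H z = z)"
proof -
  define u where "u = (\<lambda>i. x i - y i)"
  define \<alpha> where "\<alpha> = ip I u x"
  have uu: "ip I u u = \<alpha> + cnj \<alpha>"
    by (simp add: u_def \<alpha>_def ip_diff_left ip_diff_right cnj_ip eq)
  show ?thesis
  proof (cases "\<alpha> = 0")
    case True
    then have "\<forall>i\<in>I. u i = 0"
      using uu nrm_zero_iff[OF fin, of u] by (simp add: ip_self)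
    then have "unitary_pair I (\<lambda>f. f) (\<lambda>f. f)" "\<forall>i\<in>I. x i = y i"
      by (simp_all add: unitary_pair_def lin_op_def u_def)
    then show ?thesis by (intro exI[of _ "\<lambda>f. f"]) simp
  next
    case False
    define H where "H \<beta> f = (\<lambda>i. f i - ip I u f / \<beta> * u i)" for \<beta> f
    have lin: "lin_op (H \<beta>)" for \<beta>
      unfolding lin_op_def H_def
      by (auto simp: ip_add_right ip_smult_right fun_eq_iff algebra_simps add_divide_distrib)
    have inv: "H \<beta> (H \<gamma> f) = f" if "\<beta> * \<gamma> = \<alpha> * cnj \<alpha>" "\<beta> + \<gamma> = \<alpha> + cnj \<alpha>"
      for \<beta> \<gamma> f
    proof -
      have nz: "\<beta> \<noteq> 0" "\<gamma> \<noteq> 0" using False that(1) by auto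
      have "ip I u (H \<gamma> f) = ip I u f - ip I u f / \<gamma> * (\<beta> + \<gamma>)"
        unfolding H_def ip_diff_right ip_smult_right using uu that(2) by simp
      also have "\<dots> = - (ip I u f / \<gamma> * \<beta>)"
        using nz by (simp add: field_simps)
      finally show ?thesis
        using nz by (simp add: H_def[of \<beta>]) (simp add: H_def)
    qed
    have adj: "ip I (H \<alpha> f) g = ip I f (H (cnj \<alpha>) g)" for f g
    proof -
      have "cnj (ip I u f / \<alpha>) = ip I f u / cnj \<alpha>" by (simp add: cnj_ip)
      then show ?thesis
        unfolding H_def ip_diff_left ip_diff_right ip_smult_left ip_smult_right by (simp only:) simp
    qed
    have "unitary_pair I (H \<alpha>) (H (cnj \<alpha>))"
      unfolding unitary_pair_def
      using lin adj inv[of \<alpha> "cnj \<alpha>"] inv[of "cnj \<alpha>" \<alpha>] by (simp add: mult.commute[of \<alpha>] add.commute[of \<alpha>])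
    moreover have "H \<alpha> x i = y i" for i
      using False by (simp add: H_def \<alpha>_def[symmetric]) (simp add: u_def)
    moreover have "H \<alpha> z = z" if "ip I z x = ip I z y" for z
    proof -
      have "ip I u z = cnj (ip I z u)" by (simp add: cnj_ip)
      also have "ip I z u = 0" using that by (simp add: u_def ip_diff_right)
      finally show ?thesis by (simp add: H_def)
    qed
    ultimately show ?thesis by blast
  qed
qed

lemma unitary_pair_isometry: "unitary_pair I U U' \<Longrightarrow> ip I (U f) (U g) = ip I f g"
  by (simp add: unitary_pair_def)

text \<open>
  The vectors are moved one at a time: the reflection that takes the current image of \<open>x q\<close> to \<open>y q\<close>
  fixes the vectors \<open>y a\<close> with \<open>a < q\<close>, since both have the same inner products with them.
\<close>

lemma unitary_of_equal_gram:
  assumes fin: "finite I"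
    and gram: "\<And>a b. a < q \<Longrightarrow> b < q \<Longrightarrow> ip I (x a) (x b) = ip I (y a) (y b)"
  shows "\<exists>U U'. unitary_pair I U U' \<and> (\<forall>a<(q::nat). \<forall>i\<in>I. U (x a) i = y a i)"
  using gram
proof (induction q)
  case 0
  have "unitary_pair I (\<lambda>f. f) (\<lambda>f. f)" by (simp add: unitary_pair_def lin_op_def)
  then show ?case by auto
next
  case (Suc q)
  then obtain U U' where U: "unitary_pair I U U'" and Ux: "\<And>a i. a < q \<Longrightarrow> i \<in> I \<Longrightarrow> U (x a) i = y a i"
    by (metis less_Suc_eq)
  note iso = unitary_pair_isometry[OF U]
  have "ip I (U (x q)) (U (x q)) = ip I (y q) (y q)"
    using iso Suc.prems by simp
  from householder[OF fin this] obtain H H' where H: "unitary_pair I H H'"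
    "\<And>i. i \<in> I \<Longrightarrow> H (U (x q)) i = y q i"
    "\<And>z. ip I z (U (x q)) = ip I z (y q) \<Longrightarrow> H z = z" by blast
  have "H (U (x a)) i = y a i" if "a < Suc q" "i \<in> I" for a i
  proof (cases "a = q")
    case False
    with that have a: "a < q" by simp
    have "ip I (U (x a)) (U (x q)) = ip I (y a) (y q)"
      using iso Suc.prems a by simp
    also have "\<dots> = ip I (U (x a)) (y q)"
      by (rule ip_cong) (simp_all add: Ux a)
    finally show ?thesis using H(3) Ux a that by simp
  qed (use H(2) that in simp)
  then show ?case
    using unitary_pair_comp[OF U H(1)] by blast
qed

section \<open>The free product and its actions\<close>

locale free_product_of_groups = G: group G + H: group H
  for G :: "('a, 'm) monoid_scheme" and H :: "('b, 'n) monoid_scheme"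
begin

abbreviation "words \<equiv> lists (carrier G <+> carrier H)"
abbreviation "R \<equiv> free_product_rel G H"
abbreviation "FP \<equiv> free_product G H"
abbreviation "cls u \<equiv> R `` {u}"

lemma rel_words: "(u, v) \<in> R \<Longrightarrow> u \<in> words \<and> v \<in> words"
  by (induction rule: free_product_rel.induct) auto

lemma equiv_rel: "equiv words R"
proof (rule equivI)
  show "R \<subseteq> words \<times> words" using rel_words by auto
  show "refl_on words R" by (rule refl_onI) (rule free_product_rel.refl)
  show "sym R" by (rule symI) (rule free_product_rel.sym)
  show "trans R" by (rule transI) (rule free_product_rel.trans)
qed

lemma rel_append_left:
  assumes "(u, v) \<in> R" "x \<in> words"
  shows "(x @ u, x @ v) \<in> R"
  using assms
proof (induction rule: free_product_rel.induct)
  case (sym u v)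
  then show ?case by (auto intro: free_product_rel.sym)
next
  case (trans u v w)
  then show ?case by (auto intro: free_product_rel.trans)
next
  case (mult_left u v g g')
  then show ?case using free_product_rel.mult_left[of "x @ u" G H v g g'] by simp
next
  case (mult_right u v g g')
  then show ?case using free_product_rel.mult_right[of "x @ u" G H v g g'] by simp
next
  case (one_left u v)
  then show ?case using free_product_rel.one_left[of "x @ u" G H v] by simp
next
  case (one_right u v)
  then show ?case using free_product_rel.one_right[of "x @ u" G H v] by simp
next
  case (refl u)
  then show ?case using free_product_rel.refl[of "x @ u" G H] by simp
qed

lemma rel_append_right:
  assumes "(u, v) \<in> R" "x \<in> words"
  shows "(u @ x, v @ x) \<in> R"
  using assms
proof (induction rule: free_product_rel.induct)
  case (sym u v)
  then show ?case by (auto intro: free_product_rel.sym)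
next
  case (trans u v w)
  then show ?case by (auto intro: free_product_rel.trans)
next
  case (mult_left u v g g')
  then show ?case using free_product_rel.mult_left[of u G H "v @ x" g g'] by simp
next
  case (mult_right u v g g')
  then show ?case using free_product_rel.mult_right[of u G H "v @ x" g g'] by simp
next
  case (one_left u v)
  then show ?case using free_product_rel.one_left[of u G H "v @ x"] by simp
next
  case (one_right u v)
  then show ?case using free_product_rel.one_right[of u G H "v @ x"] by simp
next
  case (refl u)
  then show ?case using free_product_rel.refl[of "u @ x" G H] by simp
qed

lemma cls_eq_iff: "u \<in> words \<Longrightarrow> v \<in> words \<Longrightarrow> cls u = cls v \<longleftrightarrow> (u, v) \<in> R"
  using eq_equiv_class_iff[OF equiv_rel] by blast

lemma carrierE:
  assumes "X \<in> carrier FP"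
  obtains u where "u \<in> words" "X = cls u"
  using assms unfolding free_product_def by (simp del: in_lists_conv_set) (erule quotientE, blast)

lemma cls_closed: "u \<in> words \<Longrightarrow> cls u \<in> carrier FP"
  by (simp add: free_product_def quotientI)

lemma mult_cls:
  assumes "u \<in> words" "v \<in> words"
  shows "cls u \<otimes>\<^bsub>FP\<^esub> cls v = cls (u @ v)"
proof -
  have "congruent2 R R (\<lambda>u v. cls (u @ v))"
  proof (rule congruent2I[OF equiv_rel equiv_rel])
    fix y z w assume "w \<in> words" "(y, z) \<in> R"
    then show "cls (y @ w) = cls (z @ w)"
      using cls_eq_iff[of "y @ w" "z @ w"] rel_append_right rel_words by auto
  next
    fix y z w assume "w \<in> words" "(y, z) \<in> R"
    then show "cls (w @ y) = cls (w @ z)"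
      using cls_eq_iff[of "w @ y" "w @ z"] rel_append_left rel_words by auto
  qed
  from UN_equiv_class2[OF equiv_rel equiv_rel this assms] show ?thesis
    by (simp add: free_product_def)
qed

lemma one_cls: "\<one>\<^bsub>FP\<^esub> = cls []"
  by (simp add: free_product_def)

fun inv_letter :: "'a + 'b \<Rightarrow> 'a + 'b" where
  "inv_letter (Inl g) = Inl (inv\<^bsub>G\<^esub> g)"
| "inv_letter (Inr h) = Inr (inv\<^bsub>H\<^esub> h)"

lemma inv_letter_rel:
  assumes "x \<in> carrier G <+> carrier H"
  shows "([inv_letter x, x], []) \<in> R"
  using assms
proof (cases x)
  case (Inl g)
  with assms have g: "g \<in> carrier G" by auto
  have "([Inl (inv\<^bsub>G\<^esub> g), Inl g], [Inl \<one>\<^bsub>G\<^esub>]) \<in> R"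
    using free_product_rel.mult_left[of "[]" G H "[]" "inv\<^bsub>G\<^esub> g" g] g by simp
  then show ?thesis
    using free_product_rel.one_left[of "[]" G H "[]"] free_product_rel.trans Inl by fastforce
next
  case (Inr g)
  with assms have g: "g \<in> carrier H" by auto
  have "([Inr (inv\<^bsub>H\<^esub> g), Inr g], [Inr \<one>\<^bsub>H\<^esub>]) \<in> R"
    using free_product_rel.mult_right[of "[]" G H "[]" "inv\<^bsub>H\<^esub> g" g] g by simp
  then show ?thesis
    using free_product_rel.one_right[of "[]" G H "[]"] free_product_rel.trans Inr by fastforce
qed

lemma inv_letter_closed: "x \<in> carrier G <+> carrier H \<Longrightarrow> inv_letter x \<in> carrier G <+> carrier H"
  by auto

lemma left_inverse_word:
  assumes "u \<in> words"
  shows "rev (map inv_letter u) \<in> words \<and> (rev (map inv_letter u) @ u, []) \<in> R"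
  using assms
proof (induction u rule: list.induct)
  case (Cons x u)
  then have x: "x \<in> carrier G <+> carrier H" and u: "u \<in> words" by auto
  let ?v = "rev (map inv_letter u)"
  have v: "?v \<in> words" "(?v @ u, []) \<in> R" using Cons.IH[OF u] by auto
  have "([inv_letter x, x] @ u, [] @ u) \<in> R"
    by (rule rel_append_right[OF inv_letter_rel[OF x] u])
  from rel_append_left[OF this v(1)]
  have "(?v @ [inv_letter x, x] @ u, ?v @ u) \<in> R" by simp
  from free_product_rel.trans[OF this v(2)] show ?case
    using v(1) inv_letter_closed[OF x] by simp
qed (auto intro: free_product_rel.refl)

lemma group_free_product: "group FP"
proof (rule groupI)
  show "\<And>X Y. X \<in> carrier FP \<Longrightarrow> Y \<in> carrier FP \<Longrightarrow> X \<otimes>\<^bsub>FP\<^esub> Y \<in> carrier FP"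
    by (elim carrierE) (simp add: mult_cls cls_closed)
  show "\<one>\<^bsub>FP\<^esub> \<in> carrier FP" by (simp add: one_cls cls_closed)
  show "\<And>X Y Z. X \<in> carrier FP \<Longrightarrow> Y \<in> carrier FP \<Longrightarrow> Z \<in> carrier FP \<Longrightarrow>
     X \<otimes>\<^bsub>FP\<^esub> Y \<otimes>\<^bsub>FP\<^esub> Z = X \<otimes>\<^bsub>FP\<^esub> (Y \<otimes>\<^bsub>FP\<^esub> Z)"
    by (elim carrierE) (simp add: mult_cls)
  show "\<And>X. X \<in> carrier FP \<Longrightarrow> \<one>\<^bsub>FP\<^esub> \<otimes>\<^bsub>FP\<^esub> X = X"
    by (elim carrierE) (simp add: mult_cls one_cls)
  show "\<exists>Y\<in>carrier FP. Y \<otimes>\<^bsub>FP\<^esub> X = \<one>\<^bsub>FP\<^esub>" if "X \<in> carrier FP" for X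
    using that
  proof (elim carrierE)
    fix u assume u: "u \<in> words" "X = cls u"
    from left_inverse_word[OF u(1)] show ?thesis
      using u by (intro bexI[of _ "cls (rev (map inv_letter u))"])
        (auto simp: mult_cls one_cls cls_closed cls_eq_iff simp del: rev_map)
  qed
qed

lemma free_inl_closed: "g \<in> carrier G \<Longrightarrow> free_inl G H g \<in> carrier FP"
  by (simp add: free_inl_def cls_closed InlI)

lemma free_inr_closed: "h \<in> carrier H \<Longrightarrow> free_inr G H h \<in> carrier FP"
  by (simp add: free_inr_def cls_closed InrI)

lemma free_inl_mult:
  "g \<in> carrier G \<Longrightarrow> g' \<in> carrier G \<Longrightarrow>
    free_inl G H g \<otimes>\<^bsub>FP\<^esub> free_inl G H g' = free_inl G H (g \<otimes>\<^bsub>G\<^esub> g')"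
  using free_product_rel.mult_left[of "[]" G H "[]" g g']
  by (simp add: free_inl_def mult_cls InlI cls_eq_iff)

lemma free_inr_mult:
  "g \<in> carrier H \<Longrightarrow> g' \<in> carrier H \<Longrightarrow>
    free_inr G H g \<otimes>\<^bsub>FP\<^esub> free_inr G H g' = free_inr G H (g \<otimes>\<^bsub>H\<^esub> g')"
  using free_product_rel.mult_right[of "[]" G H "[]" g g']
  by (simp add: free_inr_def mult_cls InrI cls_eq_iff)

lemma free_inl_one: "free_inl G H \<one>\<^bsub>G\<^esub> = \<one>\<^bsub>FP\<^esub>"
  using free_product_rel.one_left[of "[]" G H "[]"]
  by (simp add: free_inl_def one_cls InlI cls_eq_iff)

lemma free_inr_one: "free_inr G H \<one>\<^bsub>H\<^esub> = \<one>\<^bsub>FP\<^esub>"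
  using free_product_rel.one_right[of "[]" G H "[]"]
  by (simp add: free_inr_def one_cls InrI cls_eq_iff)

end

text \<open>
  The universal property of the free product in the form needed for representations: an action of
  each factor on a type extends to words, and related words act in the same way.
\<close>

locale free_product_action = free_product_of_groups G H
  for G :: "('a, 'm) monoid_scheme" and H :: "('b, 'n) monoid_scheme" +
  fixes \<alpha> :: "'a \<Rightarrow> 'x \<Rightarrow> 'x" and \<beta> :: "'b \<Rightarrow> 'x \<Rightarrow> 'x"
  assumes alpha_mult: "g \<in> carrier G \<Longrightarrow> g' \<in> carrier G \<Longrightarrow> \<alpha> (g \<otimes>\<^bsub>G\<^esub> g') x = \<alpha> g (\<alpha> g' x)"
    and alpha_one: "\<alpha> \<one>\<^bsub>G\<^esub> x = x"
    and beta_mult: "h \<in> carrier H \<Longrightarrow> h' \<in> carrier H \<Longrightarrow> \<beta> (h \<otimes>\<^bsub>H\<^esub> h') x = \<beta> h (\<beta> h' x)"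
    and beta_one: "\<beta> \<one>\<^bsub>H\<^esub> x = x"
begin

definition word_act :: "('a + 'b) list \<Rightarrow> 'x \<Rightarrow> 'x" where
  "word_act u = foldr (case_sum \<alpha> \<beta>) u"

lemma word_act_simps [simp]:
  "word_act [] x = x"
  "word_act (Inl g # u) x = \<alpha> g (word_act u x)"
  "word_act (Inr h # u) x = \<beta> h (word_act u x)"
  "word_act (u @ v) x = word_act u (word_act v x)"
  by (simp_all add: word_act_def)

lemma word_act_rel: "(u, v) \<in> R \<Longrightarrow> word_act u x = word_act v x"
proof (induction arbitrary: x rule: free_product_rel.induct)
qed (simp_all add: alpha_mult alpha_one beta_mult beta_one)

definition act :: "('a + 'b) list set \<Rightarrow> 'x \<Rightarrow> 'x" where
  "act X = word_act (SOME u. u \<in> X)"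

lemma act_cls:
  assumes "u \<in> words"
  shows "act (cls u) = word_act u"
proof -
  have "(SOME v. v \<in> cls u) \<in> cls u"
    using equiv_class_self[OF equiv_rel assms] by (rule someI)
  then show ?thesis using word_act_rel by (auto simp: act_def fun_eq_iff)
qed

lemma act_mult: "X \<in> carrier FP \<Longrightarrow> Y \<in> carrier FP \<Longrightarrow> act (X \<otimes>\<^bsub>FP\<^esub> Y) x = act X (act Y x)"
  by (elim carrierE) (simp add: mult_cls act_cls)

lemma act_one: "act \<one>\<^bsub>FP\<^esub> x = x"
  by (simp add: one_cls act_cls)

lemma act_free_inl: "g \<in> carrier G \<Longrightarrow> act (free_inl G H g) x = \<alpha> g x"
  by (simp add: free_inl_def act_cls InlI)

lemma act_free_inr: "h \<in> carrier H \<Longrightarrow> act (free_inr G H h) x = \<beta> h x"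
  by (simp add: free_inr_def act_cls InrI)

lemma act_induct:
  assumes "X \<in> carrier FP"
    and "P (\<lambda>x. x)"
    and "\<And>g f. g \<in> carrier G \<Longrightarrow> P f \<Longrightarrow> P (\<lambda>x. \<alpha> g (f x))"
    and "\<And>h f. h \<in> carrier H \<Longrightarrow> P f \<Longrightarrow> P (\<lambda>x. \<beta> h (f x))"
  shows "P (act X)"
  using assms(1)
proof (elim carrierE)
  fix u assume "u \<in> words" "X = cls u"
  moreover have "P (word_act u)" if "u \<in> words" for u
    using that
  proof (induction u)
    case Nil
    then show ?case using assms(2) by (simp add: word_act_def id_def)
  next
    case (Cons l u)
    then show ?case
      using assms(3,4)[of _ "word_act u"] by (cases l) (auto simp: word_act_def comp_def)
  qed
  ultimately show ?thesis by (simp add: act_cls)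
qed

end

section \<open>The group algebra and its universal norm\<close>

definition delta :: "'g \<Rightarrow> 'g \<Rightarrow> complex" where
  "delta g x = (if x = g then 1 else 0)"

lemma group_algebra_simps:
  "add (group_algebra G) = (\<lambda>a b x. a x + b x)"
  "zero (group_algebra G) = (\<lambda>_. 0)"
  "module.smult (group_algebra G) = (\<lambda>c a x. c * a x)"
  "monoid.one (group_algebra G) = delta \<one>\<^bsub>G\<^esub>"
  by (simp_all add: group_algebra_def delta_def fun_eq_iff)

context group
begin

abbreviation "\<A> \<equiv> group_algebra G"

lemma ga_carrier: "a \<in> carrier \<A> \<longleftrightarrow> finite {g. a g \<noteq> 0} \<and> {g. a g \<noteq> 0} \<subseteq> carrier G"
  by (simp add: group_algebra_def)

lemma ga_zero_closed: "(\<lambda>_. 0) \<in> carrier \<A>"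
  by (simp add: ga_carrier)

lemma ga_add_closed: "a \<in> carrier \<A> \<Longrightarrow> b \<in> carrier \<A> \<Longrightarrow> (\<lambda>x. a x + b x) \<in> carrier \<A>"
  unfolding ga_carrier
  by (rule conjI, rule finite_subset[of _ "{g. a g \<noteq> 0} \<union> {g. b g \<noteq> 0}"])
    (auto, metis (mono_tags) add_0 mem_Collect_eq subsetD)

lemma ga_smult_closed: "a \<in> carrier \<A> \<Longrightarrow> (\<lambda>x. c * a x) \<in> carrier \<A>"
  unfolding ga_carrier by (auto intro: finite_subset[of _ "{g. a g \<noteq> 0}"])

lemma ga_diff_closed: "a \<in> carrier \<A> \<Longrightarrow> b \<in> carrier \<A> \<Longrightarrow> (\<lambda>x. a x - b x) \<in> carrier \<A>"
  using ga_add_closed[OF _ ga_smult_closed[of b "-1"]] by simp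

lemma ga_sum_closed:
  assumes "\<And>j. j \<in> J \<Longrightarrow> a j \<in> carrier \<A>"
  shows "(\<lambda>x. \<Sum>j\<in>J. a j x) \<in> carrier \<A>"
  using assms
  by (induction J rule: infinite_finite_induct) (auto intro: ga_zero_closed ga_add_closed)

lemma delta_closed: "g \<in> carrier G \<Longrightarrow> delta g \<in> carrier \<A>"
  by (auto simp: ga_carrier delta_def)

text \<open>
  Identities that are linear in an element of the group algebra reduce to group elements by this
  rule.
\<close>

lemma ga_induct [consumes 1, case_names zero add_delta]:
  assumes "a \<in> carrier \<A>" and "P (\<lambda>_. 0)"
    and step: "\<And>a g c. a \<in> carrier \<A> \<Longrightarrow> g \<in> carrier G \<Longrightarrow> P a \<Longrightarrow> P (\<lambda>x. a x + c * delta g x)"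
  shows "P a"
proof -
  have "P a" if "finite S" "S \<subseteq> carrier G" "{g. a g \<noteq> 0} \<subseteq> S" for S a
    using that
  proof (induction S arbitrary: a rule: finite_induct)
    case empty
    then have "a = (\<lambda>_. 0)" by auto
    then show ?case using assms(2) by simp
  next
    case (insert g S)
    have sub: "{x. (a(g := 0)) x \<noteq> 0} \<subseteq> S" using insert.prems by auto
    then have "a(g := 0) \<in> carrier \<A>"
      unfolding ga_carrier using insert by (auto intro: finite_subset)
    from step[OF this _ insert.IH[OF _ sub], of g "a g"]
    have "P (\<lambda>x. (a(g := 0)) x + a g * delta g x)" using insert.prems by auto
    moreover have "(\<lambda>x. (a(g := 0)) x + a g * delta g x) = a" by (auto simp: delta_def)
    ultimately show ?case by simp
  qed
  from this[of "{g. a g \<noteq> 0}" a] show ?thesis using assms(1) by (simp add: ga_carrier)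
qed

lemma ga_mult_alt:
  assumes "finite S" "S \<subseteq> carrier G" "{g. a g \<noteq> 0} \<subseteq> S"
  shows "(a \<otimes>\<^bsub>\<A>\<^esub> b) x = (if x \<in> carrier G then \<Sum>g\<in>S. a g * b (inv g \<otimes> x) else 0)"
proof -
  have "(\<Sum>g | g \<in> carrier G \<and> a g \<noteq> 0. a g * b (inv g \<otimes> x)) = (\<Sum>g\<in>S. a g * b (inv g \<otimes> x))"
    using assms by (intro sum.mono_neutral_left) auto
  then show ?thesis by (simp add: group_algebra_def)
qed

lemma ga_mult_add_left:
  assumes "a \<in> carrier \<A>" "a' \<in> carrier \<A>"
  shows "(\<lambda>x. a x + a' x) \<otimes>\<^bsub>\<A>\<^esub> b = (\<lambda>x. (a \<otimes>\<^bsub>\<A>\<^esub> b) x + (a' \<otimes>\<^bsub>\<A>\<^esub> b) x)"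
proof
  fix x
  define S where "S = {g. a g \<noteq> 0} \<union> {g. a' g \<noteq> 0}"
  have S: "finite S" "S \<subseteq> carrier G" using assms by (auto simp: ga_carrier S_def)
  have sub: "{g. a g \<noteq> 0} \<subseteq> S" "{g. a' g \<noteq> 0} \<subseteq> S" "{g. a g + a' g \<noteq> 0} \<subseteq> S"
    by (auto simp: S_def)
  show "((\<lambda>x. a x + a' x) \<otimes>\<^bsub>\<A>\<^esub> b) x = (a \<otimes>\<^bsub>\<A>\<^esub> b) x + (a' \<otimes>\<^bsub>\<A>\<^esub> b) x"
    unfolding ga_mult_alt[OF S sub(1)] ga_mult_alt[OF S sub(2)] ga_mult_alt[OF S sub(3)]
    by (simp add: distrib_right sum.distrib)
qed

lemma ga_mult_smult_left:
  assumes "a \<in> carrier \<A>"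
  shows "(\<lambda>x. c * a x) \<otimes>\<^bsub>\<A>\<^esub> b = (\<lambda>x. c * (a \<otimes>\<^bsub>\<A>\<^esub> b) x)"
proof
  fix x
  define S where "S = {g. a g \<noteq> 0}"
  have S: "finite S" "S \<subseteq> carrier G" using assms by (auto simp: ga_carrier S_def)
  have sub: "{g. a g \<noteq> 0} \<subseteq> S" "{g. c * a g \<noteq> 0} \<subseteq> S"
    by (auto simp: S_def)
  show "((\<lambda>x. c * a x) \<otimes>\<^bsub>\<A>\<^esub> b) x = c * (a \<otimes>\<^bsub>\<A>\<^esub> b) x"
    unfolding ga_mult_alt[OF S sub(1)] ga_mult_alt[OF S sub(2)]
    by (simp add: sum_distrib_left mult.assoc)
qed

lemma ga_mult_add_right:
  "a \<otimes>\<^bsub>\<A>\<^esub> (\<lambda>x. b x + b' x) = (\<lambda>x. (a \<otimes>\<^bsub>\<A>\<^esub> b) x + (a \<otimes>\<^bsub>\<A>\<^esub> b') x)"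
  by (auto simp: group_algebra_def distrib_left sum.distrib fun_eq_iff)

lemma ga_mult_smult_right:
  "a \<otimes>\<^bsub>\<A>\<^esub> (\<lambda>x. c * b x) = (\<lambda>x. c * (a \<otimes>\<^bsub>\<A>\<^esub> b) x)"
  by (auto simp: group_algebra_def sum_distrib_left mult_ac fun_eq_iff)

lemma ga_mult_zero: "(\<lambda>_. 0) \<otimes>\<^bsub>\<A>\<^esub> b = (\<lambda>_. 0)" "a \<otimes>\<^bsub>\<A>\<^esub> (\<lambda>_. 0) = (\<lambda>_. 0)"
  by (auto simp: group_algebra_def fun_eq_iff)

lemma delta_mult:
  assumes "g \<in> carrier G" "h \<in> carrier G"
  shows "delta g \<otimes>\<^bsub>\<A>\<^esub> delta h = delta (g \<otimes> h)"
proof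
  fix x
  have iff: "inv g \<otimes> x = h \<longleftrightarrow> x = g \<otimes> h" if "x \<in> carrier G"
    using assms that inv_solve_left[of h g x] by auto
  have "{k. delta g k \<noteq> 0} \<subseteq> {g}" by (auto simp: delta_def)
  from ga_mult_alt[OF _ _ this, of "delta h" x] show "(delta g \<otimes>\<^bsub>\<A>\<^esub> delta h) x = delta (g \<otimes> h) x"
    using assms iff by (auto simp: delta_def[of "g \<otimes> h"] delta_def[of h] delta_def[of g g])
qed

lemma ga_mult_closed:
  assumes "a \<in> carrier \<A>" "b \<in> carrier \<A>"
  shows "a \<otimes>\<^bsub>\<A>\<^esub> b \<in> carrier \<A>"
  using assms(1)
proof (induction a rule: ga_induct)
  case zero
  then show ?case by (simp add: ga_mult_zero ga_zero_closed)
next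
  case (add_delta a g c)
  have "delta g \<otimes>\<^bsub>\<A>\<^esub> b \<in> carrier \<A>"
    using assms(2)
  proof (induction b rule: ga_induct)
    case zero
    then show ?case by (simp add: ga_mult_zero ga_zero_closed)
  next
    case (add_delta b h d)
    then show ?case
      using \<open>g \<in> carrier G\<close>
      by (simp add: ga_mult_add_right ga_mult_smult_right delta_mult ga_add_closed ga_smult_closed
          delta_closed)
  qed
  with add_delta show ?case
    by (simp add: ga_mult_add_left ga_mult_smult_left ga_add_closed ga_smult_closed delta_closed)
qed

lemma ga_mult_diff:
  assumes "a \<in> carrier \<A>" "a' \<in> carrier \<A>"
  shows "(\<lambda>x. a x - a' x) \<otimes>\<^bsub>\<A>\<^esub> b = (\<lambda>x. (a \<otimes>\<^bsub>\<A>\<^esub> b) x - (a' \<otimes>\<^bsub>\<A>\<^esub> b) x)"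
    and "c \<otimes>\<^bsub>\<A>\<^esub> (\<lambda>x. a x - a' x) = (\<lambda>x. (c \<otimes>\<^bsub>\<A>\<^esub> a) x - (c \<otimes>\<^bsub>\<A>\<^esub> a') x)"
  using ga_mult_add_left[OF assms(1) ga_smult_closed[OF assms(2), of "-1"], of b]
    ga_mult_smult_left[OF assms(2), of "-1" b]
    ga_mult_add_right[of c a "\<lambda>x. - 1 * a' x"] ga_mult_smult_right[of c "-1" a'] by simp_all

lemma ga_star_add: "star \<A> (\<lambda>x. a x + b x) = (\<lambda>x. star \<A> a x + star \<A> b x)"
  by (auto simp: group_algebra_def fun_eq_iff)

lemma ga_star_diff: "star \<A> (\<lambda>x. a x - b x) = (\<lambda>x. star \<A> a x - star \<A> b x)"
  by (auto simp: group_algebra_def fun_eq_iff)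

lemma ga_star_smult: "star \<A> (\<lambda>x. c * a x) = (\<lambda>x. cnj c * star \<A> a x)"
  by (auto simp: group_algebra_def fun_eq_iff)

lemma ga_star_zero: "star \<A> (\<lambda>_. 0) = (\<lambda>_. 0)"
  by (auto simp: group_algebra_def fun_eq_iff)

lemma ga_star_sum: "star \<A> (\<lambda>x. \<Sum>j\<in>J. a j x) = (\<lambda>x. \<Sum>j\<in>J. star \<A> (a j) x)"
  by (auto simp: group_algebra_def fun_eq_iff)

lemma ga_star_star: "a \<in> carrier \<A> \<Longrightarrow> star \<A> (star \<A> a) = a"
  unfolding ga_carrier by (auto simp: group_algebra_def fun_eq_iff)

lemma star_delta:
  assumes "g \<in> carrier G"
  shows "star \<A> (delta g) = delta (inv g)"
proof
  fix x
  have "x \<in> carrier G \<Longrightarrow> inv x = g \<longleftrightarrow> x = inv g" using assms by auto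
  then show "star \<A> (delta g) x = delta (inv g) x"
    using assms by (auto simp: group_algebra_def delta_def)
qed

lemma ga_star_closed:
  assumes "a \<in> carrier \<A>"
  shows "star \<A> a \<in> carrier \<A>"
  using assms
proof (induction a rule: ga_induct)
  case (add_delta a g c)
  then show ?case
    by (simp add: ga_star_add ga_star_smult star_delta ga_add_closed ga_smult_closed delta_closed)
qed (simp add: ga_star_zero ga_zero_closed)

lemma ga_abelian_group: "abelian_group \<A>"
proof (rule abelian_groupI)
  fix x assume "x \<in> carrier \<A>"
  then show "\<exists>y\<in>carrier \<A>. y \<oplus>\<^bsub>\<A>\<^esub> x = \<zero>\<^bsub>\<A>\<^esub>"
    using ga_smult_closed[of x "-1"]
    by (intro bexI[of _ "\<lambda>g. - 1 * x g"]) (auto simp: group_algebra_simps)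
qed (auto simp: group_algebra_simps ga_add_closed ga_zero_closed add_ac)

lemma ga_minus:
  assumes "a \<in> carrier \<A>" "b \<in> carrier \<A>"
  shows "a \<ominus>\<^bsub>\<A>\<^esub> b = (\<lambda>x. a x - b x)"
proof -
  interpret A: abelian_group \<A> by (rule ga_abelian_group)
  have "\<ominus>\<^bsub>\<A>\<^esub> b = (\<lambda>x. - b x)"
    using assms ga_smult_closed[of b "-1"]
    by (intro A.minus_equality) (auto simp: group_algebra_simps)
  then show ?thesis by (simp add: A.minus_eq group_algebra_simps)
qed

subsection \<open>C*-seminorms\<close>

lemma cstar_seminormD:
  assumes "cstar_seminorm \<A> p" "x \<in> carrier \<A>" "y \<in> carrier \<A>"
  shows "0 \<le> p x"
    and "p (\<lambda>g. x g + y g) \<le> p x + p y"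
    and "p (\<lambda>g. c * x g) = cmod c * p x"
    and "p (x \<otimes>\<^bsub>\<A>\<^esub> y) \<le> p x * p y"
    and "p (star \<A> x \<otimes>\<^bsub>\<A>\<^esub> x) = (p x)\<^sup>2"
  using assms by (simp_all add: cstar_seminorm_def group_algebra_simps)

text \<open>
  The identities \<open>p(1) = p(1\<^sup>* 1) = p(1)\<^sup>2\<close> leave only the values 0 and 1 for \<open>p(1) = p(g\<^sup>* g) = p(g)\<^sup>2\<close>.
\<close>

lemma cstar_seminorm_delta:
  assumes p: "cstar_seminorm \<A> p" and g: "g \<in> carrier G"
  shows "p (delta g) \<le> 1"
proof -
  note one = delta_closed[OF one_closed] and dg = delta_closed[OF g]
  define r q where "r = p (delta \<one>)" and "q = p (delta g)"
  have "r = r\<^sup>2"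
    using cstar_seminormD(5)[OF p one one] by (simp add: star_delta delta_mult r_def)
  then have "r \<le> 1" by (cases "r = 0") (auto simp: power2_eq_square)
  moreover have "r = q\<^sup>2"
    using cstar_seminormD(5)[OF p dg dg] g by (simp add: star_delta delta_mult r_def q_def)
  ultimately have "q\<^sup>2 \<le> 1\<^sup>2" by simp
  then have "q \<le> 1" by (rule power2_le_imp_le) simp
  then show ?thesis by (simp only: q_def)
qed

text \<open>
  The bound \<open>\<Sum>g. \<bar>a g\<bar>\<close> is independent of the seminorm, so the supremum defining the universal norm is
  finite.
\<close>

lemma cstar_seminorm_bounded:
  assumes "a \<in> carrier \<A>"
  shows "\<exists>B. \<forall>p. cstar_seminorm \<A> p \<longrightarrow> p a \<le> B"
  using assms
proof (induction a rule: ga_induct)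
  case zero
  have "p (\<lambda>_. 0) = 0" if "cstar_seminorm \<A> p" for p
    using cstar_seminormD(3)[OF that ga_zero_closed ga_zero_closed, of 0] by simp
  then show ?case by (intro exI[of _ 0] allI impI eq_refl)
next
  case (add_delta a g c)
  then obtain B where B: "\<And>p. cstar_seminorm \<A> p \<Longrightarrow> p a \<le> B" by blast
  note dg = delta_closed[OF \<open>g \<in> carrier G\<close>]
  have "p (\<lambda>x. a x + c * delta g x) \<le> B + cmod c" if p: "cstar_seminorm \<A> p" for p
  proof -
    have "p (\<lambda>x. a x + c * delta g x) \<le> p a + p (\<lambda>x. c * delta g x)"
      by (rule cstar_seminormD[OF p]) (simp_all add: add_delta ga_smult_closed dg)
    also have "p (\<lambda>x. c * delta g x) = cmod c * p (delta g)"
      by (rule cstar_seminormD[OF p dg dg])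
    also have "cmod c * p (delta g) \<le> cmod c * 1"
      by (intro mult_left_mono cstar_seminorm_delta p add_delta) simp
    finally show ?thesis using B[OF p] by simp
  qed
  then show ?case by blast
qed

abbreviation "\<N> \<equiv> universal_norm \<A>"

lemma cstar_seminorm_zero: "cstar_seminorm \<A> (\<lambda>_. 0)"
  by (simp add: cstar_seminorm_def)

lemma universal_norm_upper:
  assumes "cstar_seminorm \<A> p" "a \<in> carrier \<A>"
  shows "p a \<le> \<N> a"
  unfolding universal_norm_def
  using assms cstar_seminorm_bounded[OF assms(2)]
  by (intro cSUP_upper) (auto simp: bdd_above_def)

lemma universal_norm_least:
  assumes "\<And>p. cstar_seminorm \<A> p \<Longrightarrow> p a \<le> c"
  shows "\<N> a \<le> c"
  unfolding universal_norm_def using assms cstar_seminorm_zero by (intro cSUP_least) auto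

lemma universal_norm_ge0: "a \<in> carrier \<A> \<Longrightarrow> 0 \<le> \<N> a"
  using universal_norm_upper[OF cstar_seminorm_zero] by simp

lemma universal_norm_add:
  assumes "a \<in> carrier \<A>" "b \<in> carrier \<A>"
  shows "\<N> (\<lambda>x. a x + b x) \<le> \<N> a + \<N> b"
proof (rule universal_norm_least)
  fix p assume p: "cstar_seminorm \<A> p"
  show "p (\<lambda>x. a x + b x) \<le> \<N> a + \<N> b"
    using cstar_seminormD(2)[OF p assms] universal_norm_upper[OF p] assms
    by (meson add_mono order_trans)
qed

lemma universal_norm_smult_le:
  assumes "a \<in> carrier \<A>"
  shows "\<N> (\<lambda>x. c * a x) \<le> cmod c * \<N> a"
proof (rule universal_norm_least)
  fix p assume p: "cstar_seminorm \<A> p"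
  show "p (\<lambda>x. c * a x) \<le> cmod c * \<N> a"
    using cstar_seminormD(3)[OF p assms assms] universal_norm_upper[OF p assms]
    by (simp add: mult_left_mono)
qed

lemma universal_norm_zero: "\<N> (\<lambda>_. 0) = 0"
  using universal_norm_smult_le[OF ga_zero_closed, of 0] universal_norm_ge0[OF ga_zero_closed]
  by simp

lemma universal_norm_minus:
  assumes "a \<in> carrier \<A>" "b \<in> carrier \<A>"
  shows "\<N> (\<lambda>x. a x - b x) = \<N> (\<lambda>x. b x - a x)"
  using universal_norm_smult_le[OF ga_diff_closed[OF assms], of "-1"]
    universal_norm_smult_le[OF ga_diff_closed[OF assms(2,1)], of "-1"] by simp

lemma universal_norm_diff_triangle:
  assumes "a \<in> carrier \<A>" "b \<in> carrier \<A>" "c \<in> carrier \<A>"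
  shows "\<N> (\<lambda>x. a x - c x) \<le> \<N> (\<lambda>x. a x - b x) + \<N> (\<lambda>x. b x - c x)"
  using universal_norm_add[of "\<lambda>x. a x - b x" "\<lambda>x. b x - c x"] assms by (simp add: ga_diff_closed)

lemma universal_norm_mult:
  assumes "a \<in> carrier \<A>" "b \<in> carrier \<A>"
  shows "\<N> (a \<otimes>\<^bsub>\<A>\<^esub> b) \<le> \<N> a * \<N> b"
proof (rule universal_norm_least)
  fix p assume p: "cstar_seminorm \<A> p"
  have "p a * p b \<le> \<N> a * \<N> b"
    using assms by (intro mult_mono universal_norm_upper[OF p] universal_norm_ge0
        cstar_seminormD(1)[OF p]) auto
  then show "p (a \<otimes>\<^bsub>\<A>\<^esub> b) \<le> \<N> a * \<N> b"
    using cstar_seminormD(4)[OF p assms] by simp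
qed

lemma cstar_seminorm_star_le:
  assumes p: "cstar_seminorm \<A> p" and a: "a \<in> carrier \<A>"
  shows "p a \<le> p (star \<A> a)"
proof (cases "p a = 0")
  case True
  then show ?thesis using cstar_seminormD(1)[OF p ga_star_closed[OF a] a] by simp
next
  case False
  have "(p a)\<^sup>2 \<le> p (star \<A> a) * p a"
    using cstar_seminormD(4)[OF p ga_star_closed[OF a] a] cstar_seminormD(5)[OF p a a] by simp
  then show ?thesis
    using False cstar_seminormD(1)[OF p a a] by (simp add: power2_eq_square)
qed

lemma universal_norm_star_le:
  assumes a: "a \<in> carrier \<A>"
  shows "\<N> (star \<A> a) \<le> \<N> a"
proof (rule universal_norm_least)
  fix p assume p: "cstar_seminorm \<A> p"
  show "p (star \<A> a) \<le> \<N> a"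
    using cstar_seminorm_star_le[OF p ga_star_closed[OF a]] universal_norm_upper[OF p a]
    by (simp add: ga_star_star a)
qed

end

subsection \<open>Finite-dimensional unitary representations\<close>

text \<open>
  A unitary representation on \<open>\<complex>\<^sup>I\<close>, again by operators on functions on the whole index type.
\<close>

locale unitary_rep = group G for G :: "('g, 'm) monoid_scheme" (structure) +
  fixes I :: "'i set" and \<pi> :: "'g \<Rightarrow> ('i \<Rightarrow> complex) \<Rightarrow> ('i \<Rightarrow> complex)"
  assumes fin: "finite I"
    and lin: "g \<in> carrier G \<Longrightarrow> lin_op (\<pi> g)"
    and rep_mult: "g \<in> carrier G \<Longrightarrow> h \<in> carrier G \<Longrightarrow> \<pi> (g \<otimes> h) f = \<pi> g (\<pi> h f)"
    and rep_one: "\<pi> \<one> f = f"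
    and isometry: "g \<in> carrier G \<Longrightarrow> ip I (\<pi> g f) (\<pi> g f') = ip I f f'"
begin

definition rep :: "('g \<Rightarrow> complex) \<Rightarrow> ('i \<Rightarrow> complex) \<Rightarrow> ('i \<Rightarrow> complex)" where
  "rep a f = (\<lambda>i. \<Sum>g | a g \<noteq> 0. a g * \<pi> g f i)"

lemma rep_alt:
  assumes "finite S" "{g. a g \<noteq> 0} \<subseteq> S"
  shows "rep a f = (\<lambda>i. \<Sum>g\<in>S. a g * \<pi> g f i)"
  unfolding rep_def using assms by (intro ext sum.mono_neutral_left) auto

lemma rep_zero: "rep (\<lambda>_. 0) f = (\<lambda>_. 0)"
  by (simp add: rep_def)

lemma rep_delta: "rep (delta g) f = \<pi> g f"
  using rep_alt[of "{g}" "delta g" f] by (auto simp: delta_def)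

lemma rep_add:
  assumes "a \<in> carrier \<A>" "b \<in> carrier \<A>"
  shows "rep (\<lambda>x. a x + b x) f = (\<lambda>i. rep a f i + rep b f i)"
proof -
  define S where "S = {g. a g \<noteq> 0} \<union> {g. b g \<noteq> 0}"
  have S: "finite S" using assms by (auto simp: ga_carrier S_def)
  have sub: "{g. a g \<noteq> 0} \<subseteq> S" "{g. b g \<noteq> 0} \<subseteq> S" "{g. a g + b g \<noteq> 0} \<subseteq> S"
    by (auto simp: S_def)
  show ?thesis
    unfolding rep_alt[OF S sub(1)] rep_alt[OF S sub(2)] rep_alt[OF S sub(3)]
    by (simp add: distrib_right sum.distrib)
qed

lemma rep_smult:
  assumes "a \<in> carrier \<A>"
  shows "rep (\<lambda>x. c * a x) f = (\<lambda>i. c * rep a f i)"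
proof -
  define S where "S = {g. a g \<noteq> 0}"
  have S: "finite S" using assms by (auto simp: ga_carrier S_def)
  have sub: "{g. a g \<noteq> 0} \<subseteq> S" "{g. c * a g \<noteq> 0} \<subseteq> S"
    by (auto simp: S_def)
  show ?thesis
    unfolding rep_alt[OF S sub(1)] rep_alt[OF S sub(2)]
    by (simp add: mult.assoc sum_distrib_left)
qed

lemma rep_diff:
  assumes "a \<in> carrier \<A>" "b \<in> carrier \<A>"
  shows "rep (\<lambda>x. a x - b x) f = (\<lambda>i. rep a f i - rep b f i)"
  using rep_add[OF assms(1) ga_smult_closed[OF assms(2)], of "-1" f] rep_smult[OF assms(2), of "-1" f]
  by simp

lemma rep_sum:
  assumes "\<And>j. j \<in> J \<Longrightarrow> a j \<in> carrier \<A>"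
  shows "rep (\<lambda>x. \<Sum>j\<in>J. a j x) f = (\<lambda>i. \<Sum>j\<in>J. rep (a j) f i)"
  using assms
  by (induction J rule: infinite_finite_induct) (simp_all add: rep_zero rep_add ga_sum_closed)

lemma lin_rep:
  assumes "a \<in> carrier \<A>"
  shows "lin_op (rep a)"
proof -
  have "\<pi> g (\<lambda>i. c * f i + d * h i) = (\<lambda>i. c * \<pi> g f i + d * \<pi> g h i)"
    if "a g \<noteq> 0" for g c d f h
    using lin that assms by (auto simp: ga_carrier lin_op_def)
  then show ?thesis
    unfolding lin_op_def rep_def
    by (auto simp: distrib_left sum.distrib sum_distrib_left mult.left_commute fun_eq_iff)
qed

lemma rep_mult_alg:
  assumes "a \<in> carrier \<A>" "b \<in> carrier \<A>"
  shows "rep (a \<otimes>\<^bsub>\<A>\<^esub> b) f = rep a (rep b f)"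
  using assms(1)
proof (induction a rule: ga_induct)
  case zero
  then show ?case by (simp add: ga_mult_zero rep_zero)
next
  case (add_delta a g c)
  note g = \<open>g \<in> carrier G\<close>
  note cl = ga_mult_closed ga_smult_closed delta_closed add_delta.hyps assms(2)
  have "rep (delta g \<otimes>\<^bsub>\<A>\<^esub> b) f = \<pi> g (rep b f)"
    using assms(2)
  proof (induction b rule: ga_induct)
    case zero
    show ?case using lin_op_smult[OF lin[OF g], of 0] by (simp add: ga_mult_zero rep_zero)
  next
    case (add_delta b h d)
    then show ?case
      using g by (simp add: ga_mult_add_right ga_mult_smult_right delta_mult rep_add rep_smult
          rep_delta rep_mult ga_smult_closed ga_mult_closed delta_closed lin_op_add[OF lin[OF g]]
          lin_op_smult[OF lin[OF g]])
  qed
  then show ?case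
    using add_delta
    by (simp add: ga_mult_add_left ga_mult_smult_left rep_add rep_smult rep_delta cl)
qed

lemma adjoint_group: "g \<in> carrier G \<Longrightarrow> ip I (\<pi> g f) h = ip I f (\<pi> (inv g) h)"
  using isometry[of g f "\<pi> (inv g) h"] rep_mult[of g "inv g" h] rep_one by simp

lemma rep_adjoint:
  assumes "a \<in> carrier \<A>"
  shows "ip I (rep a f) h = ip I f (rep (star \<A> a) h)"
  using assms
proof (induction a rule: ga_induct)
  case zero
  then show ?case by (simp add: ga_star_zero rep_zero ip_def)
next
  case (add_delta a g c)
  then show ?case
    by (simp add: ga_star_add ga_star_smult star_delta rep_add rep_smult rep_delta ga_star_closed
        ga_smult_closed delta_closed ip_add_left ip_add_right ip_smult_left ip_smult_right
        adjoint_group)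
qed

lemma rep_bounded:
  assumes "a \<in> carrier \<A>"
  shows "\<exists>B. \<forall>f. nrm I (rep a f) \<le> B * nrm I f"
  using assms
proof (induction a rule: ga_induct)
  case zero
  have "nrm I (\<lambda>_. 0) = 0" using nrm_smult[of I 0 "\<lambda>_. 0"] by simp
  then show ?case by (intro exI[of _ 0]) (simp add: rep_zero)
next
  case (add_delta a g c)
  then obtain B where B: "\<And>f. nrm I (rep a f) \<le> B * nrm I f" by blast
  have "nrm I (rep (\<lambda>x. a x + c * delta g x) f) \<le> (B + cmod c) * nrm I f" for f
  proof -
    have "nrm I (\<pi> g f) = nrm I f" using isometry add_delta by (intro nrm_eqI) auto
    moreover have "rep (\<lambda>x. a x + c * delta g x) f = (\<lambda>i. rep a f i + c * \<pi> g f i)"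
      using add_delta by (simp add: rep_add rep_smult rep_delta ga_smult_closed delta_closed)
    ultimately show ?thesis
      using nrm_add[of I "rep a f" "\<lambda>i. c * \<pi> g f i"] B[of f]
      by (simp add: nrm_smult distrib_right)
  qed
  then show ?case by blast
qed

definition opnorm :: "('g \<Rightarrow> complex) \<Rightarrow> real" where
  "opnorm a = (SUP f \<in> {f. nrm I f \<le> 1}. nrm I (rep a f))"

lemma nrm_zero: "nrm I (\<lambda>_. 0) = 0"
  using nrm_smult[of I 0 "\<lambda>_. 0"] by simp

lemma opnorm_upper_ball:
  assumes a: "a \<in> carrier \<A>" and f: "nrm I f \<le> 1"
  shows "nrm I (rep a f) \<le> opnorm a"
proof -
  obtain B where B: "\<And>f. nrm I (rep a f) \<le> B * nrm I f" using rep_bounded[OF a] by blast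
  have "nrm I (rep a f) \<le> \<bar>B\<bar>" if "nrm I f \<le> 1" for f
  proof -
    have "B * nrm I f \<le> \<bar>B\<bar> * 1" using that nrm_ge0[of I f] by (intro mult_mono) auto
    then show ?thesis using B[of f] by simp
  qed
  then show ?thesis
    unfolding opnorm_def using f by (intro cSUP_upper) (auto simp: bdd_above_def)
qed

lemma opnorm_least: "(\<And>f. nrm I f \<le> 1 \<Longrightarrow> nrm I (rep a f) \<le> c) \<Longrightarrow> opnorm a \<le> c"
  unfolding opnorm_def using nrm_zero by (intro cSUP_least) (auto intro: exI[of _ "\<lambda>_. 0"])

lemma opnorm_ge0: "a \<in> carrier \<A> \<Longrightarrow> 0 \<le> opnorm a"
  by (rule order_trans[OF nrm_ge0 opnorm_upper_ball[of a "\<lambda>_. 0"]]) (simp_all add: nrm_zero)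

lemma opnorm_upper:
  assumes a: "a \<in> carrier \<A>"
  shows "nrm I (rep a f) \<le> opnorm a * nrm I f"
proof (cases "nrm I f = 0")
  case True
  obtain B where "nrm I (rep a f) \<le> B * nrm I f" using rep_bounded[OF a] by blast
  with True show ?thesis by simp
next
  case False
  define c where "c = complex_of_real (1 / nrm I f)"
  have pos: "0 < nrm I f" using False nrm_ge0[of I f] by simp
  then have c: "cmod c = 1 / nrm I f" by (simp add: c_def norm_divide)
  have "nrm I (rep a (\<lambda>i. c * f i)) \<le> opnorm a"
    using pos by (intro opnorm_upper_ball[OF a]) (simp add: nrm_smult c)
  also have "rep a (\<lambda>i. c * f i) = (\<lambda>i. c * rep a f i)"
    by (rule lin_op_smult[OF lin_rep[OF a]])
  finally have "nrm I (rep a f) / nrm I f \<le> opnorm a"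
    by (simp only: nrm_smult c) simp
  then show ?thesis using pos by (simp only: pos_divide_le_eq)
qed

lemma opnorm_smult_le:
  assumes "a \<in> carrier \<A>"
  shows "opnorm (\<lambda>x. c * a x) \<le> cmod c * opnorm a"
proof (rule opnorm_least)
  fix f assume "nrm I f \<le> 1"
  from opnorm_upper_ball[OF assms this] show "nrm I (rep (\<lambda>x. c * a x) f) \<le> cmod c * opnorm a"
    unfolding rep_smult[OF assms] nrm_smult by (intro mult_left_mono) simp_all
qed

lemma opnorm_mult:
  assumes a: "a \<in> carrier \<A>" and b: "b \<in> carrier \<A>"
  shows "opnorm (a \<otimes>\<^bsub>\<A>\<^esub> b) \<le> opnorm a * opnorm b"
proof (rule opnorm_least)
  fix f assume f: "nrm I f \<le> 1"
  have "nrm I (rep a (rep b f)) \<le> opnorm a * nrm I (rep b f)" by (rule opnorm_upper[OF a])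
  also have "\<dots> \<le> opnorm a * opnorm b"
    by (intro mult_left_mono opnorm_upper_ball b f opnorm_ge0 a)
  finally show "nrm I (rep (a \<otimes>\<^bsub>\<A>\<^esub> b) f) \<le> opnorm a * opnorm b"
    by (simp add: rep_mult_alg a b)
qed

text \<open>
  The reason is \<open>\<parallel>a f\<parallel>\<^sup>2 = \<langle>f, a\<^sup>* a f\<rangle>\<close> with the Cauchy-Schwarz inequality.
\<close>

lemma opnorm_square_le:
  assumes a: "a \<in> carrier \<A>"
  shows "(opnorm a)\<^sup>2 \<le> opnorm (star \<A> a \<otimes>\<^bsub>\<A>\<^esub> a)"
proof -
  let ?b = "star \<A> a \<otimes>\<^bsub>\<A>\<^esub> a"
  have b: "?b \<in> carrier \<A>" by (simp add: ga_mult_closed ga_star_closed a)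
  have "opnorm a \<le> sqrt (opnorm ?b)"
  proof (rule opnorm_least)
    fix f assume f: "nrm I f \<le> 1"
    have "ip I (rep a f) (rep a f) = ip I f (rep ?b f)"
      by (simp add: rep_adjoint rep_mult_alg a ga_star_closed)
    then have "ip I f (rep ?b f) = complex_of_real ((nrm I (rep a f))\<^sup>2)"
      by (simp only: ip_self)
    then have "(nrm I (rep a f))\<^sup>2 = cmod (ip I f (rep ?b f))"
      by (simp only: norm_of_real abs_power2)
    also have "\<dots> \<le> nrm I f * nrm I (rep ?b f)" by (rule cmod_ip_le)
    also have "\<dots> \<le> 1 * opnorm ?b"
      by (intro mult_mono opnorm_upper_ball b f nrm_ge0) simp
    finally show "nrm I (rep a f) \<le> sqrt (opnorm ?b)"
      by (simp add: real_le_rsqrt)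
  qed
  then have "(opnorm a)\<^sup>2 \<le> (sqrt (opnorm ?b))\<^sup>2"
    by (intro power_mono opnorm_ge0 a)
  then show ?thesis using opnorm_ge0[OF b] by simp
qed

lemma opnorm_star_le:
  assumes a: "a \<in> carrier \<A>"
  shows "opnorm a \<le> opnorm (star \<A> a)"
proof (cases "opnorm a = 0")
  case True
  then show ?thesis using opnorm_ge0[OF ga_star_closed[OF a]] by simp
next
  case False
  have "(opnorm a)\<^sup>2 \<le> opnorm (star \<A> a) * opnorm a"
    using opnorm_square_le[OF a] opnorm_mult[OF ga_star_closed[OF a] a] by simp
  then show ?thesis
    using False opnorm_ge0[OF a] by (simp add: power2_eq_square)
qed


text \<open>
  The operator norm takes part in the supremum that defines the universal norm.  Through the next
  lemma this makes the matrix coefficients continuous.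
\<close>

lemma cstar_seminorm_opnorm: "cstar_seminorm \<A> opnorm"
  unfolding cstar_seminorm_def group_algebra_simps
proof (intro conjI ballI allI)
  fix x y assume x: "x \<in> carrier \<A>" and y: "y \<in> carrier \<A>"
  show "opnorm (\<lambda>g. x g + y g) \<le> opnorm x + opnorm y"
  proof (rule opnorm_least)
    fix f assume f: "nrm I f \<le> 1"
    show "nrm I (rep (\<lambda>g. x g + y g) f) \<le> opnorm x + opnorm y"
      unfolding rep_add[OF x y]
      by (rule order_trans[OF nrm_add]) (intro add_mono opnorm_upper_ball x y f)
  qed
  show "opnorm (x \<otimes>\<^bsub>\<A>\<^esub> y) \<le> opnorm x * opnorm y" by (rule opnorm_mult[OF x y])
next
  fix c x assume x: "x \<in> carrier \<A>"
  show "0 \<le> opnorm x" by (rule opnorm_ge0[OF x])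
  show "opnorm (\<lambda>g. c * x g) = cmod c * opnorm x"
  proof (cases "c = 0")
    case True
    then show ?thesis
      using opnorm_smult_le[OF x, of 0] opnorm_ge0[OF ga_zero_closed]
      by (simp only: mult_zero_left norm_zero)
  next
    case False
    have "(\<lambda>g. inverse c * (c * x g)) = x"
      using False by (simp add: mult.assoc[symmetric])
    then have "opnorm x \<le> cmod (inverse c) * opnorm (\<lambda>g. c * x g)"
      using opnorm_smult_le[OF ga_smult_closed[OF x], of "inverse c" c] by (simp only:)
    then have "opnorm x \<le> opnorm (\<lambda>g. c * x g) / cmod c"
      by (simp only: norm_inverse divide_inverse mult.commute)
    then have "cmod c * opnorm x \<le> opnorm (\<lambda>g. c * x g)"
      using False by (simp only: pos_le_divide_eq zero_less_norm_iff not_False_eq_True mult.commute)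
    then show ?thesis using opnorm_smult_le[OF x, of c] by simp
  qed
  have "opnorm (star \<A> x) = opnorm x"
    using opnorm_star_le[OF x] opnorm_star_le[OF ga_star_closed[OF x]] by (simp add: ga_star_star x)
  then show "opnorm (star \<A> x \<otimes>\<^bsub>\<A>\<^esub> x) = (opnorm x)\<^sup>2"
    using opnorm_mult[OF ga_star_closed[OF x] x] opnorm_square_le[OF x]
    by (simp only: power2_eq_square)
qed

lemma rep_coefficient_le:
  assumes a: "a \<in> carrier \<A>"
  shows "cmod (ip I f (rep a h)) \<le> nrm I f * (\<N> a * nrm I h)"
proof -
  have "nrm I (rep a h) \<le> opnorm a * nrm I h" by (rule opnorm_upper[OF a])
  also have "\<dots> \<le> \<N> a * nrm I h"
    by (intro mult_right_mono universal_norm_upper[OF cstar_seminorm_opnorm a] nrm_ge0)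
  finally have "nrm I f * nrm I (rep a h) \<le> nrm I f * (\<N> a * nrm I h)"
    by (intro mult_left_mono nrm_ge0)
  then show ?thesis using cmod_ip_le[of I f "rep a h"] by simp
qed

end

section \<open>The completed group algebra\<close>

context group
begin

abbreviation "CS \<equiv> cauchy_seqs \<A>"
abbreviation "CR \<equiv> cauchy_rel \<A>"
abbreviation "lim_cls s \<equiv> CR `` {s}"
abbreviation "\<C> \<equiv> full_group_cstar G"

lemma cauchy_closed: "s \<in> CS \<Longrightarrow> s n \<in> carrier \<A>"
  by (simp add: cauchy_seqs_def)

lemma cauchyI:
  assumes "\<And>n. s n \<in> carrier \<A>"
    and "\<And>\<epsilon>. \<epsilon> > 0 \<Longrightarrow> \<exists>M. \<forall>m\<ge>M. \<forall>n\<ge>M. \<N> (\<lambda>x. s m x - s n x) < \<epsilon>"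
  shows "s \<in> CS"
  using assms by (simp add: cauchy_seqs_def ga_minus)

lemma cauchyD:
  assumes "s \<in> CS" "\<epsilon> > 0"
  shows "\<exists>M. \<forall>m\<ge>M. \<forall>n\<ge>M. \<N> (\<lambda>x. s m x - s n x) < \<epsilon>"
proof -
  have "\<exists>M. \<forall>m\<ge>M. \<forall>n\<ge>M. \<N> (s m \<ominus>\<^bsub>\<A>\<^esub> s n) < \<epsilon>"
    using assms by (simp add: cauchy_seqs_def)
  then show ?thesis by (simp add: ga_minus cauchy_closed assms(1))
qed

lemma cauchy_rel_iff:
  "(s, t) \<in> CR \<longleftrightarrow> s \<in> CS \<and> t \<in> CS \<and> (\<lambda>n. \<N> (\<lambda>x. s n x - t n x)) \<longlonglongrightarrow> 0"
  by (auto simp: cauchy_rel_def ga_minus cauchy_closed)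

lemma const_cauchy: "a \<in> carrier \<A> \<Longrightarrow> (\<lambda>_. a) \<in> CS"
  by (rule cauchyI) (auto simp: universal_norm_zero)

lemma null_seq_bound:
  assumes "\<And>n. s n \<in> carrier \<A>" "\<And>n. \<N> (s n) \<le> e n" "e \<longlonglongrightarrow> 0"
  shows "(\<lambda>n. \<N> (s n)) \<longlonglongrightarrow> 0"
  by (rule tendsto_sandwich[OF _ _ tendsto_const assms(3)])
    (simp_all add: universal_norm_ge0 assms)

lemma equiv_cauchy: "equiv CS CR"
proof (rule equivI)
  show "CR \<subseteq> CS \<times> CS" by (auto simp: cauchy_rel_iff)
  show "refl_on CS CR" by (rule refl_onI) (simp add: cauchy_rel_iff universal_norm_zero)
  show "sym CR"
  proof (rule symI)
    fix s t assume "(s, t) \<in> CR"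
    then show "(t, s) \<in> CR"
      using universal_norm_minus[OF cauchy_closed cauchy_closed, of s t]
      by (simp add: cauchy_rel_iff)
  qed
  show "trans CR"
  proof (rule transI)
    fix s t u assume st: "(s, t) \<in> CR" and tu: "(t, u) \<in> CR"
    then have cl: "s n \<in> carrier \<A>" "t n \<in> carrier \<A>" "u n \<in> carrier \<A>" for n
      by (auto simp: cauchy_rel_iff cauchy_closed)
    have "(\<lambda>n. \<N> (\<lambda>x. s n x - t n x) + \<N> (\<lambda>x. t n x - u n x)) \<longlonglongrightarrow> 0 + 0"
      using st tu by (intro tendsto_add) (auto simp: cauchy_rel_iff)
    then have "(\<lambda>n. \<N> (\<lambda>x. s n x - u n x)) \<longlonglongrightarrow> 0"
      by (intro null_seq_bound[OF _ universal_norm_diff_triangle[OF cl]]) (auto intro: ga_diff_closed cl)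
    then show "(s, u) \<in> CR" using st tu by (simp add: cauchy_rel_iff)
  qed
qed

lemma cauchy_add:
  assumes s: "s \<in> CS" and t: "t \<in> CS"
  shows "(\<lambda>n x. s n x + t n x) \<in> CS"
proof (rule cauchyI)
  note cl = cauchy_closed[OF s] cauchy_closed[OF t]
  show "\<And>n. (\<lambda>x. s n x + t n x) \<in> carrier \<A>" by (simp add: ga_add_closed cl)
  fix \<epsilon> :: real assume "\<epsilon> > 0"
  then have "\<epsilon> / 2 > 0" by simp
  from cauchyD[OF s this] cauchyD[OF t this] obtain M M'
    where M: "\<And>m n. m \<ge> M \<Longrightarrow> n \<ge> M \<Longrightarrow> \<N> (\<lambda>x. s m x - s n x) < \<epsilon> / 2"
      and M': "\<And>m n. m \<ge> M' \<Longrightarrow> n \<ge> M' \<Longrightarrow> \<N> (\<lambda>x. t m x - t n x) < \<epsilon> / 2" by blast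
  have "\<N> (\<lambda>x. (s m x + t m x) - (s n x + t n x)) < \<epsilon>"
    if "m \<ge> max M M'" "n \<ge> max M M'" for m n
  proof -
    have "\<N> (\<lambda>x. (s m x - s n x) + (t m x - t n x))
        \<le> \<N> (\<lambda>x. s m x - s n x) + \<N> (\<lambda>x. t m x - t n x)"
      by (intro universal_norm_add ga_diff_closed cl)
    moreover have "(\<lambda>x. (s m x + t m x) - (s n x + t n x)) = (\<lambda>x. (s m x - s n x) + (t m x - t n x))"
      by auto
    ultimately show ?thesis using M[of m n] M'[of m n] that by simp
  qed
  then show "\<exists>M. \<forall>m\<ge>M. \<forall>n\<ge>M. \<N> (\<lambda>x. (s m x + t m x) - (s n x + t n x)) < \<epsilon>" by blast
qed

lemma rel_add:
  assumes "(s, s') \<in> CR" "(t, t') \<in> CR"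
  shows "((\<lambda>n x. s n x + t n x), (\<lambda>n x. s' n x + t' n x)) \<in> CR"
proof -
  have CS: "s \<in> CS" "s' \<in> CS" "t \<in> CS" "t' \<in> CS" using assms by (auto simp: cauchy_rel_iff)
  note cl = CS[THEN cauchy_closed]
  have "(\<lambda>n. \<N> (\<lambda>x. s n x - s' n x) + \<N> (\<lambda>x. t n x - t' n x)) \<longlonglongrightarrow> 0 + 0"
    using assms by (intro tendsto_add) (auto simp: cauchy_rel_iff)
  then have "(\<lambda>n. \<N> (\<lambda>x. (s n x - s' n x) + (t n x - t' n x))) \<longlonglongrightarrow> 0"
    by (intro null_seq_bound[OF _ universal_norm_add]) (auto intro!: ga_add_closed ga_diff_closed cl)
  moreover have "(\<lambda>x. (s n x + t n x) - (s' n x + t' n x)) = (\<lambda>x. (s n x - s' n x) + (t n x - t' n x))" for n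
    by auto
  ultimately show ?thesis using CS by (simp add: cauchy_rel_iff cauchy_add)
qed

lemma cauchy_smult:
  assumes s: "s \<in> CS"
  shows "(\<lambda>n x. c * s n x) \<in> CS"
proof (rule cauchyI)
  note cl = cauchy_closed[OF s]
  show "\<And>n. (\<lambda>x. c * s n x) \<in> carrier \<A>" by (simp add: ga_smult_closed cl)
  fix \<epsilon> :: real assume "\<epsilon> > 0"
  then have "\<epsilon> / (cmod c + 1) > 0" by (simp add: add_nonneg_pos)
  from cauchyD[OF s this] obtain M
    where M: "\<And>m n. m \<ge> M \<Longrightarrow> n \<ge> M \<Longrightarrow> \<N> (\<lambda>x. s m x - s n x) < \<epsilon> / (cmod c + 1)" by blast
  have "\<N> (\<lambda>x. c * s m x - c * s n x) < \<epsilon>" if "m \<ge> M" "n \<ge> M" for m n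
  proof -
    have d: "(\<lambda>x. s m x - s n x) \<in> carrier \<A>" by (intro ga_diff_closed cl)
    have "\<N> (\<lambda>x. c * (s m x - s n x)) \<le> cmod c * \<N> (\<lambda>x. s m x - s n x)"
      by (rule universal_norm_smult_le[OF d])
    also have "\<dots> \<le> (cmod c + 1) * \<N> (\<lambda>x. s m x - s n x)"
      by (intro mult_right_mono universal_norm_ge0 d) simp
    also have "\<dots> < (cmod c + 1) * (\<epsilon> / (cmod c + 1))"
      by (intro mult_strict_left_mono M that) (simp add: add_nonneg_pos)
    also have "\<dots> = \<epsilon>"
      using norm_ge_zero[of c] by (simp add: add_nonneg_eq_0_iff)
    finally show ?thesis by (simp add: right_diff_distrib)
  qed
  then show "\<exists>M. \<forall>m\<ge>M. \<forall>n\<ge>M. \<N> (\<lambda>x. c * s m x - c * s n x) < \<epsilon>" by blast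
qed

lemma rel_smult:
  assumes "(s, s') \<in> CR"
  shows "((\<lambda>n x. c * s n x), (\<lambda>n x. c * s' n x)) \<in> CR"
proof -
  have CS: "s \<in> CS" "s' \<in> CS" using assms by (auto simp: cauchy_rel_iff)
  note cl = CS[THEN cauchy_closed]
  have "(\<lambda>n. cmod c * \<N> (\<lambda>x. s n x - s' n x)) \<longlonglongrightarrow> cmod c * 0"
    using assms by (intro tendsto_mult tendsto_const) (auto simp: cauchy_rel_iff)
  then have "(\<lambda>n. \<N> (\<lambda>x. c * (s n x - s' n x))) \<longlonglongrightarrow> 0"
    by (intro null_seq_bound[OF _ universal_norm_smult_le])
      (auto intro!: ga_smult_closed ga_diff_closed cl)
  then show ?thesis using CS by (simp add: cauchy_rel_iff cauchy_smult right_diff_distrib)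
qed

lemma cauchy_star:
  assumes s: "s \<in> CS"
  shows "(\<lambda>n. star \<A> (s n)) \<in> CS"
proof (rule cauchyI)
  note cl = cauchy_closed[OF s]
  show "\<And>n. star \<A> (s n) \<in> carrier \<A>" by (simp add: ga_star_closed cl)
  fix \<epsilon> :: real assume "\<epsilon> > 0"
  from cauchyD[OF s this] obtain M
    where M: "\<And>m n. m \<ge> M \<Longrightarrow> n \<ge> M \<Longrightarrow> \<N> (\<lambda>x. s m x - s n x) < \<epsilon>" by blast
  have "\<N> (\<lambda>x. star \<A> (s m) x - star \<A> (s n) x) < \<epsilon>" if "m \<ge> M" "n \<ge> M" for m n
    using universal_norm_star_le[OF ga_diff_closed[OF cl cl], of m n] M[OF that]
    by (simp add: ga_star_diff)
  then show "\<exists>M. \<forall>m\<ge>M. \<forall>n\<ge>M. \<N> (\<lambda>x. star \<A> (s m) x - star \<A> (s n) x) < \<epsilon>" by blast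
qed

lemma rel_star:
  assumes "(s, s') \<in> CR"
  shows "((\<lambda>n. star \<A> (s n)), (\<lambda>n. star \<A> (s' n))) \<in> CR"
proof -
  have CS: "s \<in> CS" "s' \<in> CS" using assms by (auto simp: cauchy_rel_iff)
  note cl = CS[THEN cauchy_closed]
  have "(\<lambda>n. \<N> (star \<A> (\<lambda>x. s n x - s' n x))) \<longlonglongrightarrow> 0"
    using assms by (intro null_seq_bound[OF _ universal_norm_star_le])
      (auto intro!: ga_star_closed ga_diff_closed cl simp: cauchy_rel_iff)
  then show ?thesis using CS by (simp add: cauchy_rel_iff cauchy_star ga_star_diff)
qed

text \<open>
  Products of Cauchy sequences are estimated through
  \<open>a b - a' b' = a (b - b') + (a - a') b'\<close>, for which the factors have to stay bounded.
\<close>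

lemma cauchy_eventually_bounded:
  assumes s: "s \<in> CS"
  shows "\<exists>B>0. \<exists>M. \<forall>n\<ge>M. \<N> (s n) \<le> B"
proof -
  note cl = cauchy_closed[OF s]
  obtain M where M: "\<And>m n. m \<ge> M \<Longrightarrow> n \<ge> M \<Longrightarrow> \<N> (\<lambda>x. s m x - s n x) < 1"
    using cauchyD[OF s, of 1] by auto
  have "\<N> (s n) \<le> \<N> (s M) + 1" if "n \<ge> M" for n
  proof -
    have "\<N> (\<lambda>x. (s n x - s M x) + s M x) \<le> \<N> (\<lambda>x. s n x - s M x) + \<N> (s M)"
      by (intro universal_norm_add ga_diff_closed cl)
    then show ?thesis using M[OF that, of M] by simp
  qed
  moreover have "\<N> (s M) + 1 > 0" using universal_norm_ge0[OF cl, of M] by simp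
  ultimately show ?thesis by blast
qed

lemma universal_norm_mult_diff:
  assumes cl: "a \<in> carrier \<A>" "a' \<in> carrier \<A>" "b \<in> carrier \<A>" "b' \<in> carrier \<A>"
  shows "\<N> (\<lambda>x. (a \<otimes>\<^bsub>\<A>\<^esub> b) x - (a' \<otimes>\<^bsub>\<A>\<^esub> b') x)
    \<le> \<N> a * \<N> (\<lambda>x. b x - b' x) + \<N> (\<lambda>x. a x - a' x) * \<N> b'"
proof -
  have eq: "(\<lambda>x. (a \<otimes>\<^bsub>\<A>\<^esub> b) x - (a' \<otimes>\<^bsub>\<A>\<^esub> b') x)
      = (\<lambda>x. (a \<otimes>\<^bsub>\<A>\<^esub> (\<lambda>x. b x - b' x)) x + ((\<lambda>x. a x - a' x) \<otimes>\<^bsub>\<A>\<^esub> b') x)"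
    by (simp add: ga_mult_diff cl)
  have "\<N> (\<lambda>x. (a \<otimes>\<^bsub>\<A>\<^esub> (\<lambda>x. b x - b' x)) x + ((\<lambda>x. a x - a' x) \<otimes>\<^bsub>\<A>\<^esub> b') x)
      \<le> \<N> (a \<otimes>\<^bsub>\<A>\<^esub> (\<lambda>x. b x - b' x)) + \<N> ((\<lambda>x. a x - a' x) \<otimes>\<^bsub>\<A>\<^esub> b')"
    by (intro universal_norm_add ga_mult_closed ga_diff_closed cl)
  also have "\<dots> \<le> \<N> a * \<N> (\<lambda>x. b x - b' x) + \<N> (\<lambda>x. a x - a' x) * \<N> b'"
    by (intro add_mono universal_norm_mult ga_diff_closed cl)
  finally show ?thesis unfolding eq .
qed

lemma cauchy_mult:
  assumes s: "s \<in> CS" and t: "t \<in> CS"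
  shows "(\<lambda>n. s n \<otimes>\<^bsub>\<A>\<^esub> t n) \<in> CS"
proof (rule cauchyI)
  note cl = cauchy_closed[OF s] cauchy_closed[OF t]
  show "\<And>n. s n \<otimes>\<^bsub>\<A>\<^esub> t n \<in> carrier \<A>" by (simp add: ga_mult_closed cl)
  fix \<epsilon> :: real assume \<epsilon>: "\<epsilon> > 0"
  obtain B M where B: "B > 0" "\<And>n. n \<ge> M \<Longrightarrow> \<N> (s n) \<le> B"
    using cauchy_eventually_bounded[OF s] by blast
  obtain B' M' where B': "B' > 0" "\<And>n. n \<ge> M' \<Longrightarrow> \<N> (t n) \<le> B'"
    using cauchy_eventually_bounded[OF t] by blast
  have "\<epsilon> / (2 * B') > 0" "\<epsilon> / (2 * B) > 0" using \<epsilon> B B' by auto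
  from cauchyD[OF s this(1)] cauchyD[OF t this(2)] obtain K K'
    where K: "\<And>m n. m \<ge> K \<Longrightarrow> n \<ge> K \<Longrightarrow> \<N> (\<lambda>x. s m x - s n x) < \<epsilon> / (2 * B')"
      and K': "\<And>m n. m \<ge> K' \<Longrightarrow> n \<ge> K' \<Longrightarrow> \<N> (\<lambda>x. t m x - t n x) < \<epsilon> / (2 * B)" by blast
  define L where "L = max (max M M') (max K K')"
  have "\<N> (\<lambda>x. (s m \<otimes>\<^bsub>\<A>\<^esub> t m) x - (s n \<otimes>\<^bsub>\<A>\<^esub> t n) x) < \<epsilon>" if "m \<ge> L" "n \<ge> L" for m n
  proof -
    have ge: "m \<ge> M" "m \<ge> K" "m \<ge> K'" "n \<ge> M'" "n \<ge> K" "n \<ge> K'" using that by (auto simp: L_def)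
    have 1: "\<N> (s m) * \<N> (\<lambda>x. t m x - t n x) \<le> B * \<N> (\<lambda>x. t m x - t n x)"
      by (intro mult_right_mono B ge universal_norm_ge0 ga_diff_closed cl)
    have 2: "B * \<N> (\<lambda>x. t m x - t n x) < B * (\<epsilon> / (2 * B))"
      by (intro mult_strict_left_mono K' ge B)
    have 3: "\<N> (\<lambda>x. s m x - s n x) * \<N> (t n) \<le> \<N> (\<lambda>x. s m x - s n x) * B'"
      by (intro mult_left_mono B' ge universal_norm_ge0 ga_diff_closed cl)
    have 4: "\<N> (\<lambda>x. s m x - s n x) * B' < (\<epsilon> / (2 * B')) * B'"
      by (intro mult_strict_right_mono K ge B')
    have 5: "B * (\<epsilon> / (2 * B)) = \<epsilon> / 2" "(\<epsilon> / (2 * B')) * B' = \<epsilon> / 2" using B B' by auto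
    show ?thesis
      using universal_norm_mult_diff[of "s m" "s n" "t m" "t n"] 1 2 3 4 5 cl
      by (smt (verit) field_sum_of_halves)
  qed
  then show "\<exists>M. \<forall>m\<ge>M. \<forall>n\<ge>M. \<N> (\<lambda>x. (s m \<otimes>\<^bsub>\<A>\<^esub> t m) x - (s n \<otimes>\<^bsub>\<A>\<^esub> t n) x) < \<epsilon>" by blast
qed

lemma rel_mult:
  assumes "(s, s') \<in> CR" "(t, t') \<in> CR"
  shows "((\<lambda>n. s n \<otimes>\<^bsub>\<A>\<^esub> t n), (\<lambda>n. s' n \<otimes>\<^bsub>\<A>\<^esub> t' n)) \<in> CR"
proof -
  have CS: "s \<in> CS" "s' \<in> CS" "t \<in> CS" "t' \<in> CS" using assms by (auto simp: cauchy_rel_iff)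
  note cl = CS[THEN cauchy_closed]
  obtain B M where B: "B > 0" "\<And>n. n \<ge> M \<Longrightarrow> \<N> (s n) \<le> B"
    using cauchy_eventually_bounded[OF CS(1)] by blast
  obtain B' M' where B': "B' > 0" "\<And>n. n \<ge> M' \<Longrightarrow> \<N> (t' n) \<le> B'"
    using cauchy_eventually_bounded[OF CS(4)] by blast
  let ?e = "\<lambda>n. B * \<N> (\<lambda>x. t n x - t' n x) + \<N> (\<lambda>x. s n x - s' n x) * B'"
  have lim: "?e \<longlonglongrightarrow> B * 0 + 0 * B'"
    using assms by (intro tendsto_add tendsto_mult tendsto_const) (auto simp: cauchy_rel_iff)
  have ev: "\<N> (\<lambda>x. (s n \<otimes>\<^bsub>\<A>\<^esub> t n) x - (s' n \<otimes>\<^bsub>\<A>\<^esub> t' n) x) \<le> ?e n" if "n \<ge> max M M'" for n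
  proof -
    have "\<N> (s n) * \<N> (\<lambda>x. t n x - t' n x) \<le> B * \<N> (\<lambda>x. t n x - t' n x)"
      using that by (intro mult_right_mono B universal_norm_ge0 ga_diff_closed cl) simp
    moreover have "\<N> (\<lambda>x. s n x - s' n x) * \<N> (t' n) \<le> \<N> (\<lambda>x. s n x - s' n x) * B'"
      using that by (intro mult_left_mono B' universal_norm_ge0 ga_diff_closed cl) simp
    ultimately show ?thesis
      using universal_norm_mult_diff[of "s n" "s' n" "t n" "t' n"] cl by fastforce
  qed
  have "(\<lambda>n. \<N> (\<lambda>x. (s n \<otimes>\<^bsub>\<A>\<^esub> t n) x - (s' n \<otimes>\<^bsub>\<A>\<^esub> t' n) x)) \<longlonglongrightarrow> 0"
  proof (rule tendsto_sandwich[OF _ _ tendsto_const])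
    show "\<forall>\<^sub>F n in sequentially. 0 \<le> \<N> (\<lambda>x. (s n \<otimes>\<^bsub>\<A>\<^esub> t n) x - (s' n \<otimes>\<^bsub>\<A>\<^esub> t' n) x)"
      by (intro always_eventually allI universal_norm_ge0 ga_diff_closed ga_mult_closed cl)
    show "\<forall>\<^sub>F n in sequentially. \<N> (\<lambda>x. (s n \<otimes>\<^bsub>\<A>\<^esub> t n) x - (s' n \<otimes>\<^bsub>\<A>\<^esub> t' n) x) \<le> ?e n"
      using ev eventually_sequentially by blast
    show "?e \<longlonglongrightarrow> 0" using lim by simp
  qed
  then show ?thesis using CS by (simp add: cauchy_rel_iff cauchy_mult)
qed

lemma cstar_carrierE:
  assumes "X \<in> carrier \<C>"
  obtains s where "s \<in> CS" "X = lim_cls s"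
  using assms unfolding full_group_cstar_def enveloping_cstar_def by (auto elim: quotientE)

lemma lim_cls_closed: "s \<in> CS \<Longrightarrow> lim_cls s \<in> carrier \<C>"
  by (simp add: full_group_cstar_def enveloping_cstar_def quotientI)

lemma cstar_add:
  assumes "s \<in> CS" "t \<in> CS"
  shows "lim_cls s \<oplus>\<^bsub>\<C>\<^esub> lim_cls t = lim_cls (\<lambda>n x. s n x + t n x)"
proof -
  have "congruent2 CR CR (\<lambda>s t. lim_cls (\<lambda>n x. s n x + t n x))"
    unfolding congruent2_def
    by (auto intro!: equiv_class_eq[OF equiv_cauchy] rel_add)
  from UN_equiv_class2[OF equiv_cauchy equiv_cauchy this assms] show ?thesis
    by (simp add: full_group_cstar_def enveloping_cstar_def group_algebra_simps)
qed

lemma cstar_mult: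
  assumes "s \<in> CS" "t \<in> CS"
  shows "lim_cls s \<otimes>\<^bsub>\<C>\<^esub> lim_cls t = lim_cls (\<lambda>n. s n \<otimes>\<^bsub>\<A>\<^esub> t n)"
proof -
  have "congruent2 CR CR (\<lambda>s t. lim_cls (\<lambda>n. s n \<otimes>\<^bsub>\<A>\<^esub> t n))"
    unfolding congruent2_def
    by (auto intro!: equiv_class_eq[OF equiv_cauchy] rel_mult)
  from UN_equiv_class2[OF equiv_cauchy equiv_cauchy this assms] show ?thesis
    by (simp add: full_group_cstar_def enveloping_cstar_def)
qed

lemma cstar_smult:
  assumes "s \<in> CS"
  shows "c \<odot>\<^bsub>\<C>\<^esub> lim_cls s = lim_cls (\<lambda>n x. c * s n x)"
proof -
  have "congruent CR (\<lambda>s. lim_cls (\<lambda>n x. c * s n x))"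
    unfolding congruent_def
    by (auto intro!: equiv_class_eq[OF equiv_cauchy] rel_smult)
  from UN_equiv_class[OF equiv_cauchy this assms] show ?thesis
    by (simp add: full_group_cstar_def enveloping_cstar_def group_algebra_simps)
qed

lemma cstar_star:
  assumes "s \<in> CS"
  shows "star \<C> (lim_cls s) = lim_cls (\<lambda>n. star \<A> (s n))"
proof -
  have "congruent CR (\<lambda>s. lim_cls (\<lambda>n. star \<A> (s n)))"
    unfolding congruent_def
    by (auto intro!: equiv_class_eq[OF equiv_cauchy] rel_star)
  from UN_equiv_class[OF equiv_cauchy this assms] show ?thesis
    by (simp add: full_group_cstar_def enveloping_cstar_def)
qed

lemma cstar_zero: "\<zero>\<^bsub>\<C>\<^esub> = lim_cls (\<lambda>_ _. 0)"
  by (simp add: full_group_cstar_def enveloping_cstar_def group_algebra_simps)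

lemma cstar_one: "\<one>\<^bsub>\<C>\<^esub> = lim_cls (\<lambda>_. delta \<one>)"
  by (simp add: full_group_cstar_def enveloping_cstar_def group_algebra_simps)

lemma canonical_unitary_delta: "canonical_unitary G g = lim_cls (\<lambda>_. delta g)"
  by (simp add: canonical_unitary_def delta_def[abs_def])

lemma cstar_module: "Module.module (class_ring :: complex ring) \<C>"
proof (rule module_criteria)
  show "cring (class_ring :: complex ring)" by (rule class_cring.is_cring)
  show "\<zero>\<^bsub>\<C>\<^esub> \<in> carrier \<C>"
    by (simp add: cstar_zero lim_cls_closed const_cauchy ga_zero_closed)
  show "\<forall>v\<in>carrier \<C>. \<exists>w\<in>carrier \<C>. v \<oplus>\<^bsub>\<C>\<^esub> w = \<zero>\<^bsub>\<C>\<^esub>"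
  proof
    fix v assume "v \<in> carrier \<C>"
    then obtain s where s: "s \<in> CS" "v = lim_cls s" by (rule cstar_carrierE)
    then show "\<exists>w\<in>carrier \<C>. v \<oplus>\<^bsub>\<C>\<^esub> w = \<zero>\<^bsub>\<C>\<^esub>"
      by (intro bexI[of _ "lim_cls (\<lambda>n x. - 1 * s n x)"] lim_cls_closed cauchy_smult)
        (simp_all add: cstar_add[OF s(1) cauchy_smult[OF s(1), of "- 1", simplified]] cstar_zero)
  qed
qed (auto elim!: cstar_carrierE simp: cstar_add cstar_smult cstar_zero lim_cls_closed cauchy_add
    cauchy_smult const_cauchy ga_zero_closed algebra_simps)

lemma cstar_finsum:
  assumes "\<And>j. j \<in> J \<Longrightarrow> s j \<in> CS" "finite J"
  shows "(\<lambda>n x. \<Sum>j\<in>J. s j n x) \<in> CS"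
    "finsum \<C> (\<lambda>j. lim_cls (s j)) J = lim_cls (\<lambda>n x. \<Sum>j\<in>J. s j n x)"
proof -
  interpret M: Module.module "class_ring :: complex ring" \<C> by (rule cstar_module)
  have "(\<lambda>n x. \<Sum>j\<in>J. s j n x) \<in> CS \<and>
    finsum \<C> (\<lambda>j. lim_cls (s j)) J = lim_cls (\<lambda>n x. \<Sum>j\<in>J. s j n x)"
    using assms(2,1)
  proof (induction J rule: finite_induct)
    case empty
    then show ?case by (simp add: cstar_zero const_cauchy ga_zero_closed)
  next
    case (insert j J)
    then show ?case
      by (simp add: M.M.finsum_insert Pi_def lim_cls_closed cstar_add cauchy_add)
  qed
  then show "(\<lambda>n x. \<Sum>j\<in>J. s j n x) \<in> CS"
    "finsum \<C> (\<lambda>j. lim_cls (s j)) J = lim_cls (\<lambda>n x. \<Sum>j\<in>J. s j n x)" by auto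
qed

end

lemma elements_mat_subset_iff:
  assumes "X \<in> carrier_mat n n"
  shows "elements_mat X \<subseteq> S \<longleftrightarrow> (\<forall>i<n. \<forall>j<n. X $$ (i, j) \<in> S)"
  using assms unfolding elements_mat_def by fastforce

lemma mat_space_carrier:
  "X \<in> carrier (mat_space n A) \<longleftrightarrow> X \<in> carrier_mat n n \<and> (\<forall>i<n. \<forall>j<n. X $$ (i, j) \<in> carrier A)"
  using elements_mat_subset_iff[of X n "carrier A"] by (auto simp: mat_space_def)

lemma foldSetD_cong_on:
  "(S, x) \<in> foldSetD D f e \<Longrightarrow> \<forall>y\<in>S. f y = g y \<Longrightarrow> (S, x) \<in> foldSetD D g e"
proof (induction rule: foldSetD.induct)
  case emptyI
  then show ?case by (simp add: foldSetD.emptyI)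
next
  case (insertI x A y)
  then show ?case using foldSetD.insertI[of x A g y D e] by simp
qed

text \<open>
  This holds over an arbitrary structure, because \<open>foldSetD\<close> sees only the summands with index in
  \<open>S\<close>.
\<close>

lemma finsum_cong_on:
  assumes "\<And>x. x \<in> S \<Longrightarrow> f x = g x"
  shows "finsum A f S = finsum A g S"
proof -
  have "(S, x) \<in> foldSetD (carrier A) (\<lambda>y. add A (f y)) \<zero>\<^bsub>A\<^esub>
    \<longleftrightarrow> (S, x) \<in> foldSetD (carrier A) (\<lambda>y. add A (g y)) \<zero>\<^bsub>A\<^esub>" for x
    using foldSetD_cong_on[of S x _ "\<lambda>y. add A (f y)" _ "\<lambda>y. add A (g y)"]
      foldSetD_cong_on[of S x _ "\<lambda>y. add A (g y)" _ "\<lambda>y. add A (f y)"] assms by auto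
  then show ?thesis by (simp add: finsum_def finprod_def comp_def foldD_def)
qed

lemma positive_elements_mat_space:
  "X \<in> positive_elements (mat_space n A) \<longleftrightarrow> (\<exists>Y\<in>carrier (mat_space n A). X = mat n n (\<lambda>(i, j).
     finsum A (\<lambda>l. star A (Y $$ (l, i)) \<otimes>\<^bsub>A\<^esub> Y $$ (l, j)) {..<n}))"
  (is "_ \<longleftrightarrow> (\<exists>Y\<in>_. X = ?R Y)")
proof -
  have "star (mat_space n A) Y \<otimes>\<^bsub>mat_space n A\<^esub> Y = ?R Y" for Y
    by (rule eq_matI) (auto simp: mat_space_def intro!: finsum_cong_on)
  then show ?thesis unfolding positive_elements_def by auto
qed

lemma nonneg_limit:
  assumes "(\<lambda>n. complex_of_real (r n)) \<longlonglongrightarrow> z" "\<And>n. 0 \<le> r n"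
  shows "\<exists>r\<ge>0. z = complex_of_real r"
proof -
  have "r \<longlonglongrightarrow> Re z" using tendsto_Re[OF assms(1)] by simp
  then have "0 \<le> Re z" by (rule LIMSEQ_le_const) (simp add: assms)
  moreover have "(\<lambda>n. 0 :: real) \<longlonglongrightarrow> Im z" using tendsto_Im[OF assms(1)] by simp
  then have "Im z = 0" using LIMSEQ_unique tendsto_const by blast
  ultimately show ?thesis by (intro exI[of _ "Re z"]) (simp add: complex_eq_iff)
qed

context unitary_rep
begin

text \<open>
  The continuous extension of \<open>a \<mapsto> \<langle>f, a h\<rangle>\<close> to the completion; by \<open>coeff_lim\<close> the representing
  sequence can be any.
\<close>

definition coeff :: "('i \<Rightarrow> complex) \<Rightarrow> ('i \<Rightarrow> complex) \<Rightarrow> (nat \<Rightarrow> 'g \<Rightarrow> complex) set \<Rightarrow> complex" where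
  "coeff f h X = lim (\<lambda>n. ip I f (rep ((SOME s. s \<in> X) n) h))"

lemma coeff_diff_le:
  assumes "a \<in> carrier \<A>" "b \<in> carrier \<A>"
  shows "cmod (ip I f (rep a h) - ip I f (rep b h)) \<le> nrm I f * nrm I h * \<N> (\<lambda>x. a x - b x)"
  using rep_coefficient_le[OF ga_diff_closed[OF assms], of f h]
  by (simp add: rep_diff assms ip_diff_right mult_ac)

lemma coeff_convergent:
  assumes s: "s \<in> CS"
  shows "convergent (\<lambda>n. ip I f (rep (s n) h))"
proof (rule Cauchy_convergent)
  note cl = cauchy_closed[OF s]
  define K where "K = nrm I f * nrm I h + 1"
  have K: "K > 0" using nrm_ge0[of I f] nrm_ge0[of I h] by (simp add: K_def add_nonneg_pos)
  show "Cauchy (\<lambda>n. ip I f (rep (s n) h))"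
  proof (rule CauchyI)
    fix e :: real assume "0 < e"
    then have "e / K > 0" using K by simp
    from cauchyD[OF s this] obtain M
      where M: "\<And>m n. m \<ge> M \<Longrightarrow> n \<ge> M \<Longrightarrow> \<N> (\<lambda>x. s m x - s n x) < e / K" by blast
    have "cmod (ip I f (rep (s m) h) - ip I f (rep (s n) h)) < e" if "m \<ge> M" "n \<ge> M" for m n
    proof -
      have "cmod (ip I f (rep (s m) h) - ip I f (rep (s n) h))
          \<le> nrm I f * nrm I h * \<N> (\<lambda>x. s m x - s n x)"
        by (rule coeff_diff_le[OF cl cl])
      also have "\<dots> \<le> K * \<N> (\<lambda>x. s m x - s n x)"
        by (intro mult_right_mono universal_norm_ge0 ga_diff_closed cl) (simp add: K_def)
      also have "\<dots> < K * (e / K)"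
        by (intro mult_strict_left_mono M that K)
      also have "\<dots> = e" using K by simp
      finally show ?thesis .
    qed
    then show "\<exists>M. \<forall>m\<ge>M. \<forall>n\<ge>M. cmod (ip I f (rep (s m) h) - ip I f (rep (s n) h)) < e" by blast
  qed
qed

lemma coeff_lim:
  assumes s: "s \<in> CS"
  shows "(\<lambda>n. ip I f (rep (s n) h)) \<longlonglongrightarrow> coeff f h (lim_cls s)"
proof -
  define t where "t = (SOME t. t \<in> lim_cls s)"
  have "t \<in> lim_cls s"
    unfolding t_def
    by (rule someI[of "\<lambda>t. t \<in> lim_cls s"]) (rule equiv_class_self[OF equiv_cauchy s])
  then have st: "(s, t) \<in> CR" by (simp only: Image_singleton_iff)
  then have t: "t \<in> CS" by (simp only: cauchy_rel_iff)
  note cl = cauchy_closed[OF s] cauchy_closed[OF t]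
  have 1: "(\<lambda>n. ip I f (rep (t n) h)) \<longlonglongrightarrow> coeff f h (lim_cls s)"
    unfolding coeff_def t_def[symmetric]
    using coeff_convergent[OF t, of f h] by (simp only: convergent_LIMSEQ_iff)
  have lim: "(\<lambda>n. nrm I f * nrm I h * \<N> (\<lambda>x. s n x - t n x)) \<longlonglongrightarrow> nrm I f * nrm I h * 0"
    using st by (intro tendsto_mult tendsto_const) (simp only: cauchy_rel_iff)
  have "(\<lambda>n. cmod (ip I f (rep (s n) h) - ip I f (rep (t n) h))) \<longlonglongrightarrow> 0"
  proof (rule tendsto_sandwich[OF _ _ tendsto_const])
    show "\<forall>\<^sub>F n in sequentially. cmod (ip I f (rep (s n) h) - ip I f (rep (t n) h))
        \<le> nrm I f * nrm I h * \<N> (\<lambda>x. s n x - t n x)"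
      by (intro always_eventually allI coeff_diff_le cl)
    show "(\<lambda>n. nrm I f * nrm I h * \<N> (\<lambda>x. s n x - t n x)) \<longlonglongrightarrow> 0"
      using lim by (simp only: mult_zero_right)
  qed (intro always_eventually allI norm_ge_zero)
  then have "(\<lambda>n. ip I f (rep (s n) h) - ip I f (rep (t n) h)) \<longlonglongrightarrow> 0"
    by (rule tendsto_norm_zero_cancel)
  from tendsto_add[OF this 1] show ?thesis by (simp only: diff_add_cancel add_0)
qed

lemma coeff_const:
  assumes "a \<in> carrier \<A>"
  shows "coeff f h (lim_cls (\<lambda>_. a)) = ip I f (rep a h)"
  using coeff_lim[OF const_cauchy[OF assms], of f h] by (simp add: LIMSEQ_const_iff)

text \<open>
  If \<open>X = Y\<^sup>* Y\<close> and \<open>s l a\<close> is a Cauchy sequence for the entry \<open>Y\<^sub>l\<^sub>a\<close>, the sum is the limit of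
  \<open>\<Sum>l. \<parallel>\<Sum>a. s l a m (h a)\<parallel>\<^sup>2\<close> for \<open>m \<rightarrow> \<infinity>\<close>.
\<close>

lemma coeff_positive:
  assumes "X \<in> positive_elements (mat_space n \<C>)"
  shows "\<exists>r\<ge>0. (\<Sum>a<n. \<Sum>b<n. coeff (h a) (h b) (X $$ (a, b))) = complex_of_real r"
proof -
  obtain Y where Y: "Y \<in> carrier (mat_space n \<C>)" and X: "X = mat n n (\<lambda>(i, j).
     finsum \<C> (\<lambda>l. star \<C> (Y $$ (l, i)) \<otimes>\<^bsub>\<C>\<^esub> Y $$ (l, j)) {..<n})"
    using assms unfolding positive_elements_mat_space by blast
  have "\<exists>s. s \<in> CS \<and> Y $$ (l, a) = lim_cls s" if "l < n" "a < n" for l a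
    using Y that unfolding mat_space_carrier by (metis cstar_carrierE)
  then obtain s where s: "\<And>l a. l < n \<Longrightarrow> a < n \<Longrightarrow> s l a \<in> CS"
    "\<And>l a. l < n \<Longrightarrow> a < n \<Longrightarrow> Y $$ (l, a) = lim_cls (s l a)" by metis
  define t where "t a b l m = star \<A> (s l a m) \<otimes>\<^bsub>\<A>\<^esub> s l b m" for a b l m
  have t: "t a b l \<in> CS" if "l < n" "a < n" "b < n" for a b l
    using that by (simp add: t_def[abs_def] cauchy_mult cauchy_star s)
  have Xab: "X $$ (a, b) = lim_cls (\<lambda>m x. \<Sum>l<n. t a b l m x)" if "a < n" "b < n" for a b
  proof -
    interpret M: Module.module "class_ring :: complex ring" \<C> by (rule cstar_module)
    have "X $$ (a, b) = finsum \<C> (\<lambda>l. star \<C> (Y $$ (l, a)) \<otimes>\<^bsub>\<C>\<^esub> Y $$ (l, b)) {..<n}"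
      using that by (simp add: X)
    also have "\<dots> = finsum \<C> (\<lambda>l. lim_cls (t a b l)) {..<n}"
      using that by (intro M.M.finsum_cong')
        (auto simp: s cstar_star cstar_mult cauchy_star t_def[abs_def] lim_cls_closed cauchy_mult)
    also have "\<dots> = lim_cls (\<lambda>m x. \<Sum>l<n. t a b l m x)"
      using that by (intro cstar_finsum t) auto
    finally show ?thesis .
  qed
  let ?F = "\<lambda>m. \<Sum>a<n. \<Sum>b<n. ip I (h a) (rep (\<lambda>x. \<Sum>l<n. t a b l m x) (h b))"
  have lim: "?F \<longlonglongrightarrow> (\<Sum>a<n. \<Sum>b<n. coeff (h a) (h b) (X $$ (a, b)))"
    by (intro tendsto_sum) (auto simp: Xab intro!: coeff_lim cstar_finsum t)
  have F: "?F m = complex_of_real (\<Sum>l<n. (nrm I (\<lambda>i. \<Sum>a<n. rep (s l a m) (h a) i))\<^sup>2)" for m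
  proof -
    have "ip I (h a) (rep (\<lambda>x. \<Sum>l<n. t a b l m x) (h b))
        = (\<Sum>l<n. ip I (rep (s l a m) (h a)) (rep (s l b m) (h b)))" if "a < n" "b < n" for a b
    proof -
      have 1: "ip I (h a) (rep (t a b l m) (h b)) = ip I (rep (s l a m) (h a)) (rep (s l b m) (h b))"
        if "l \<in> {..<n}" for l
      proof -
        have cl: "s l a m \<in> carrier \<A>" "s l b m \<in> carrier \<A>"
          using that \<open>a < n\<close> \<open>b < n\<close> by (auto intro: cauchy_closed s)
        show ?thesis
          unfolding t_def rep_mult_alg[OF ga_star_closed[OF cl(1)] cl(2)] rep_adjoint[OF cl(1)] ..
      qed
      have 2: "rep (\<lambda>x. \<Sum>l<n. t a b l m x) (h b) = (\<lambda>i. \<Sum>l<n. rep (t a b l m) (h b) i)"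
        by (rule rep_sum, rule cauchy_closed[OF t]) (use that in auto)
      show ?thesis unfolding 2 ip_sum_right by (rule sum.cong[OF HOL.refl]) (rule 1)
    qed
    then have "?F m = (\<Sum>a<n. \<Sum>b<n. \<Sum>l<n. ip I (rep (s l a m) (h a)) (rep (s l b m) (h b)))"
      by (intro sum.cong HOL.refl) (simp only: lessThan_iff)
    also have "\<dots> = (\<Sum>a<n. \<Sum>l<n. \<Sum>b<n. ip I (rep (s l a m) (h a)) (rep (s l b m) (h b)))"
      by (rule sum.cong[OF HOL.refl], rule sum.swap)
    also have "\<dots> = (\<Sum>l<n. \<Sum>a<n. \<Sum>b<n. ip I (rep (s l a m) (h a)) (rep (s l b m) (h b)))"
      by (rule sum.swap)
    also have "\<dots> = (\<Sum>l<n. ip I (\<lambda>i. \<Sum>a<n. rep (s l a m) (h a) i) (\<lambda>i. \<Sum>a<n. rep (s l a m) (h a) i))"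
      by (simp only: ip_sum_left ip_sum_right)
    finally show ?thesis by (simp only: ip_self of_real_sum)
  qed
  show ?thesis by (rule nonneg_limit[OF lim[unfolded F]]) (simp add: sum_nonneg)
qed

end

section \<open>Operator systems ordered by coordinates\<close>

lemma psd_add:
  assumes "psd I M" "psd I N"
  shows "psd I (\<lambda>i j. M i j + N i j)"
proof (rule psdI)
  fix c
  obtain r s where r: "0 \<le> r" "(\<Sum>i\<in>I. \<Sum>j\<in>I. cnj (c i) * M i j * c j) = complex_of_real r"
    and s: "0 \<le> s" "(\<Sum>i\<in>I. \<Sum>j\<in>I. cnj (c i) * N i j * c j) = complex_of_real s"
    using psdD[OF assms(1), of c] psdD[OF assms(2), of c] by blast
  have "(\<Sum>i\<in>I. \<Sum>j\<in>I. cnj (c i) * (M i j + N i j) * c j) = complex_of_real (r + s)"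
    by (simp only: distrib_left distrib_right sum.distrib r(2) s(2) of_real_add)
  then show "\<exists>r\<ge>0. (\<Sum>i\<in>I. \<Sum>j\<in>I. cnj (c i) * (M i j + N i j) * c j) = complex_of_real r"
    using r(1) s(1) by (intro exI[of _ "r + s"]) simp
qed

lemma psd_smult:
  assumes "psd I M" "0 \<le> t"
  shows "psd I (\<lambda>i j. complex_of_real t * M i j)"
proof (rule psdI)
  fix c
  obtain r where r: "0 \<le> r" "(\<Sum>i\<in>I. \<Sum>j\<in>I. cnj (c i) * M i j * c j) = complex_of_real r"
    using psdD[OF assms(1), of c] by blast
  have "(\<Sum>i\<in>I. \<Sum>j\<in>I. cnj (c i) * (complex_of_real t * M i j) * c j)
      = complex_of_real t * (\<Sum>i\<in>I. \<Sum>j\<in>I. cnj (c i) * M i j * c j)"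
    by (simp add: sum_distrib_left mult_ac)
  also have "\<dots> = complex_of_real (t * r)" by (simp only: r(2) of_real_mult)
  finally show "\<exists>r\<ge>0. (\<Sum>i\<in>I. \<Sum>j\<in>I. cnj (c i) * (complex_of_real t * M i j) * c j) = complex_of_real r"
    using r(1) assms(2) by (intro exI[of _ "t * r"]) simp
qed

lemma psd_antisym:
  assumes fin: "finite I" and "psd I M" "psd I (\<lambda>i j. - M i j)" "i \<in> I" "j \<in> I"
  shows "M i j = 0"
proof -
  obtain r s where rs: "0 \<le> r" "0 \<le> s" "M i i = complex_of_real r" "- M i i = complex_of_real s"
    using psd_diag[OF assms(2) fin assms(4)] psd_diag[OF assms(3) fin assms(4)] by blast
  then have "complex_of_real (r + s) = 0" by (metis add.right_inverse of_real_add)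
  then have "r = 0" using rs(1,2) by (simp only: of_real_eq_0_iff)
  then show ?thesis using psd_zero_diag[OF assms(2) fin assms(4,5)] rs(3) by simp
qed

lemma psd_compress:
  assumes fin: "finite I" and "psd I M"
  shows "psd J (\<lambda>i j. \<Sum>p\<in>I \<times> I. cnj (A (fst p) i) * A (snd p) j * M (fst p) (snd p))"
proof -
  obtain Y where Y: "\<And>k l. k \<in> I \<Longrightarrow> l \<in> I \<Longrightarrow> M k l = (\<Sum>t\<in>I. cnj (Y t k) * Y t l)"
    using psd_gram_factorization[OF assms] by blast
  show ?thesis
  proof (rule gram_psd)
    fix i j
    have "(\<Sum>p\<in>I \<times> I. cnj (A (fst p) i) * A (snd p) j * M (fst p) (snd p))
        = (\<Sum>k\<in>I. \<Sum>l\<in>I. cnj (A k i) * A l j * M k l)"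
      by (simp add: sum.cartesian_product case_prod_beta)
    also have "\<dots> = (\<Sum>k\<in>I. \<Sum>l\<in>I. \<Sum>t\<in>I. cnj (Y t k * A k i) * (Y t l * A l j))"
      by (simp add: Y sum_distrib_left mult_ac)
    also have "\<dots> = (\<Sum>k\<in>I. \<Sum>t\<in>I. \<Sum>l\<in>I. cnj (Y t k * A k i) * (Y t l * A l j))"
      by (rule sum.cong[OF HOL.refl], rule sum.swap)
    also have "\<dots> = (\<Sum>t\<in>I. \<Sum>k\<in>I. \<Sum>l\<in>I. cnj (Y t k * A k i) * (Y t l * A l j))"
      by (rule sum.swap)
    also have "\<dots> = (\<Sum>t\<in>I. cnj (\<Sum>k\<in>I. Y t k * A k i) * (\<Sum>l\<in>I. Y t l * A l j))"
      by (simp only: cnj_sum sum_product)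
    finally show "(\<Sum>p\<in>I \<times> I. cnj (A (fst p) i) * A (snd p) j * M (fst p) (snd p)) = \<dots>" .
  qed
qed

lemma sum_diagonal:
  assumes "finite I"
  shows "(\<Sum>i\<in>I. \<Sum>j\<in>I. cnj (c i) * (if i = j then z else 0) * c j)
    = z * complex_of_real (\<Sum>i\<in>I. (cmod (c i))\<^sup>2)"
proof -
  have "(\<Sum>i\<in>I. \<Sum>j\<in>I. cnj (c i) * (if i = j then z else 0) * c j)
      = (\<Sum>i\<in>I. \<Sum>j\<in>I. if i = j then cnj (c i) * z * c j else 0)"
    by (intro sum.cong HOL.refl) simp
  also have "\<dots> = (\<Sum>i\<in>I. z * (c i * cnj (c i)))"
    using assms by (simp add: mult_ac)
  also have "\<dots> = z * complex_of_real (\<Sum>i\<in>I. (cmod (c i))\<^sup>2)"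
    by (simp only: of_real_sum complex_norm_square sum_distrib_left)
  finally show ?thesis .
qed

text \<open>
  Each product \<open>\<bar>c i\<bar> \<bar>c j\<bar>\<close> is at most \<open>\<Sum>i. \<bar>c i\<bar>\<^sup>2\<close>, so the form of \<open>N\<close> is at most
  \<open>(\<Sum>i j. \<bar>N i j\<bar>) (\<Sum>i. \<bar>c i\<bar>\<^sup>2)\<close>.  This provides the order unit property.
\<close>

lemma psd_dominated:
  assumes fin: "finite I"
    and herm: "\<And>i j. i \<in> I \<Longrightarrow> j \<in> I \<Longrightarrow> N j i = cnj (N i j)"
    and r: "(\<Sum>i\<in>I. \<Sum>j\<in>I. cmod (N i j)) \<le> r"
  shows "psd I (\<lambda>i j. (if i = j then complex_of_real r else 0) - N i j)"
proof (rule psdI)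
  fix c :: "'a \<Rightarrow> complex"
  define S where "S = (\<Sum>i\<in>I. (cmod (c i))\<^sup>2)"
  define z where "z = (\<Sum>i\<in>I. \<Sum>j\<in>I. cnj (c i) * N i j * c j)"
  have "cnj (cnj (c i) * N i j * c j) = cnj (c j) * N j i * c i" if "i \<in> I" "j \<in> I" for i j
    unfolding herm[OF that] by simp
  then have "cnj z = (\<Sum>i\<in>I. \<Sum>j\<in>I. cnj (c j) * N j i * c i)"
    unfolding z_def cnj_sum by (intro sum.cong HOL.refl)
  also have "\<dots> = z" unfolding z_def by (rule sum.swap)
  finally have "cnj z = z" .
  then have "Im z = 0" by (simp add: complex_eq_iff)
  then have "z = complex_of_real (Re z)" by (simp add: complex_eq_iff)
  then obtain y where z: "z = complex_of_real y" by blast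
  have S0: "0 \<le> S" by (simp add: S_def sum_nonneg)
  have le: "cmod (c i) \<le> sqrt S" if "i \<in> I" for i
  proof (rule real_le_rsqrt)
    show "(cmod (c i))\<^sup>2 \<le> S" unfolding S_def using that fin by (intro member_le_sum) auto
  qed
  have "cmod z \<le> (\<Sum>i\<in>I. \<Sum>j\<in>I. cmod (cnj (c i) * N i j * c j))"
    unfolding z_def by (intro order_trans[OF norm_sum] sum_mono) simp_all
  also have "\<dots> \<le> (\<Sum>i\<in>I. \<Sum>j\<in>I. cmod (N i j) * S)"
  proof (intro sum_mono)
    fix i j assume ij: "i \<in> I" "j \<in> I"
    have "cmod (c i) * cmod (c j) \<le> sqrt S * sqrt S"
      by (intro mult_mono le ij) (simp_all add: S0)
    then have "cmod (c i) * cmod (c j) \<le> S" using S0 by simp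
    then have "cmod (N i j) * (cmod (c i) * cmod (c j)) \<le> cmod (N i j) * S"
      by (intro mult_left_mono) simp_all
    then show "cmod (cnj (c i) * N i j * c j) \<le> cmod (N i j) * S"
      by (simp add: norm_mult mult_ac)
  qed
  also have "\<dots> = (\<Sum>i\<in>I. \<Sum>j\<in>I. cmod (N i j)) * S"
    by (simp only: sum_distrib_right)
  also have "\<dots> \<le> r * S" by (intro mult_right_mono r S0)
  finally have "y \<le> r * S" by (simp add: z)
  moreover have "(\<Sum>i\<in>I. \<Sum>j\<in>I. cnj (c i) * ((if i = j then complex_of_real r else 0) - N i j) * c j)
      = complex_of_real r * complex_of_real S - z"
    unfolding S_def z_def
    by (simp only: right_diff_distrib left_diff_distrib sum_subtractf sum_diagonal[OF fin])
  moreover have "\<dots> = complex_of_real (r * S - y)" by (simp add: z)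
  ultimately show "\<exists>s\<ge>0. (\<Sum>i\<in>I. \<Sum>j\<in>I. cnj (c i) *
      ((if i = j then complex_of_real r else 0) - N i j) * c j) = complex_of_real s"
    by (intro exI[of _ "r * S - y"]) simp
qed

lemma psd_archimedean:
  assumes fin: "finite I"
    and psd: "\<And>\<epsilon>. \<epsilon> > 0 \<Longrightarrow> psd I (\<lambda>i j. (if i = j then complex_of_real (\<epsilon> * e) else 0) + M i j)"
    and e: "e > 0"
  shows "psd I M"
proof (rule psdI)
  fix c :: "'a \<Rightarrow> complex"
  define S where "S = (\<Sum>i\<in>I. (cmod (c i))\<^sup>2)"
  define z where "z = (\<Sum>i\<in>I. \<Sum>j\<in>I. cnj (c i) * M i j * c j)"
  have ex: "\<exists>r\<ge>0. complex_of_real (\<epsilon> * e) * complex_of_real S + z = complex_of_real r" if "\<epsilon> > 0" for \<epsilon>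
    using psdD[OF psd[OF that], of c] unfolding S_def z_def
    by (simp only: distrib_left distrib_right sum.distrib sum_diagonal[OF fin])
  have bound: "Im z = 0 \<and> 0 \<le> \<epsilon> * (e * S) + Re z" if eps: "\<epsilon> > 0" for \<epsilon>
  proof -
    obtain r where r: "0 \<le> r" "complex_of_real (\<epsilon> * e) * complex_of_real S + z = complex_of_real r"
      using ex[OF eps] by blast
    from arg_cong[OF r(2), of Im] arg_cong[OF r(2), of Re] r(1) show ?thesis by simp
  qed
  have Im: "Im z = 0" using bound[of 1] by simp
  have K: "e * S + 1 > 0" using e by (simp add: S_def add_nonneg_pos sum_nonneg)
  have "- Re z \<le> \<epsilon>" if "\<epsilon> > 0" for \<epsilon>
  proof -
    have q: "\<epsilon> / (e * S + 1) > 0" using that K by simp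
    have "\<epsilon> / (e * S + 1) * (e * S) \<le> \<epsilon> / (e * S + 1) * (e * S + 1)"
      using q by (intro mult_left_mono) simp_all
    also have "\<dots> = \<epsilon>" using K by simp
    finally show ?thesis using bound[OF q] by linarith
  qed
  then have "0 \<le> Re z" using field_le_epsilon[of "- Re z" 0] by simp
  then show "\<exists>r\<ge>0. (\<Sum>i\<in>I. \<Sum>j\<in>I. cnj (c i) * M i j * c j) = complex_of_real r"
    unfolding z_def[symmetric] using Im by (intro exI[of _ "Re z"]) (simp add: complex_eq_iff)
qed

lemma mat_space_sel:
  "X \<in> carrier_mat n n \<Longrightarrow> Y \<in> carrier_mat n n \<Longrightarrow> i < n \<Longrightarrow> j < n \<Longrightarrow>
    (X \<oplus>\<^bsub>mat_space n A\<^esub> Y) $$ (i, j) = X $$ (i, j) \<oplus>\<^bsub>A\<^esub> Y $$ (i, j)"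
  "i < n \<Longrightarrow> j < n \<Longrightarrow> \<zero>\<^bsub>mat_space n A\<^esub> $$ (i, j) = \<zero>\<^bsub>A\<^esub>"
  "i < n \<Longrightarrow> j < n \<Longrightarrow> (c \<odot>\<^bsub>mat_space n A\<^esub> X) $$ (i, j) = c \<odot>\<^bsub>A\<^esub> X $$ (i, j)"
  "i < n \<Longrightarrow> j < n \<Longrightarrow> star (mat_space n A) X $$ (i, j) = star A (X $$ (j, i))"
  "X \<oplus>\<^bsub>mat_space n A\<^esub> Y \<in> carrier_mat n n"
  "\<zero>\<^bsub>mat_space n A\<^esub> \<in> carrier_mat n n"
  "c \<odot>\<^bsub>mat_space n A\<^esub> X \<in> carrier_mat n n"
  "star (mat_space n A) X \<in> carrier_mat n n"
  by (auto simp: mat_space_def)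

lemma mat_space_abelian_group:
  assumes "abelian_group A"
  shows "abelian_group (mat_space n A)"
proof -
  interpret A: abelian_group A by fact
  show ?thesis
  proof (rule abelian_groupI)
    fix X assume X: "X \<in> carrier (mat_space n A)"
    let ?Y = "mat n n (\<lambda>ij. \<ominus>\<^bsub>A\<^esub> X $$ ij)"
    have "?Y \<in> carrier (mat_space n A)" using X by (simp add: mat_space_carrier)
    moreover have "?Y \<oplus>\<^bsub>mat_space n A\<^esub> X = \<zero>\<^bsub>mat_space n A\<^esub>"
      using X unfolding mat_space_carrier by (intro eq_matI) (auto simp: mat_space_def A.l_neg)
    ultimately show "\<exists>Y\<in>carrier (mat_space n A). Y \<oplus>\<^bsub>mat_space n A\<^esub> X = \<zero>\<^bsub>mat_space n A\<^esub>" by blast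
  next
    fix X assume "X \<in> carrier (mat_space n A)"
    then show "\<zero>\<^bsub>mat_space n A\<^esub> \<oplus>\<^bsub>mat_space n A\<^esub> X = X"
      unfolding mat_space_carrier by (intro eq_matI) (auto simp: mat_space_def)
  next
    fix X Y assume "X \<in> carrier (mat_space n A)" "Y \<in> carrier (mat_space n A)"
    then show "X \<oplus>\<^bsub>mat_space n A\<^esub> Y = Y \<oplus>\<^bsub>mat_space n A\<^esub> X"
      unfolding mat_space_carrier by (intro eq_matI) (auto simp: mat_space_def A.a_comm)
  next
    fix X Y Z assume "X \<in> carrier (mat_space n A)" "Y \<in> carrier (mat_space n A)"
      "Z \<in> carrier (mat_space n A)"
    then show "X \<oplus>\<^bsub>mat_space n A\<^esub> Y \<oplus>\<^bsub>mat_space n A\<^esub> Z = X \<oplus>\<^bsub>mat_space n A\<^esub> (Y \<oplus>\<^bsub>mat_space n A\<^esub> Z)"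
      unfolding mat_space_carrier by (intro eq_matI) (auto simp: mat_space_def A.a_assoc)
  qed (auto simp: mat_space_carrier mat_space_sel)
qed

lemma mat_space_neg:
  assumes A: "abelian_group A" and X: "X \<in> carrier (mat_space n A)"
  shows "\<ominus>\<^bsub>mat_space n A\<^esub> X = mat n n (\<lambda>ij. \<ominus>\<^bsub>A\<^esub> X $$ ij)"
proof -
  interpret A: abelian_group A by fact
  interpret M: abelian_group "mat_space n A" by (rule mat_space_abelian_group[OF A])
  show ?thesis
  proof (rule M.minus_equality[OF _ X])
    show "mat n n (\<lambda>ij. \<ominus>\<^bsub>A\<^esub> X $$ ij) \<oplus>\<^bsub>mat_space n A\<^esub> X = \<zero>\<^bsub>mat_space n A\<^esub>"
      using X unfolding mat_space_carrier by (intro eq_matI) (auto simp: mat_space_def A.l_neg)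
    show "mat n n (\<lambda>ij. \<ominus>\<^bsub>A\<^esub> X $$ ij) \<in> carrier (mat_space n A)"
      using X by (simp add: mat_space_carrier)
  qed
qed

text \<open>
  The matrix order is the one induced from \<open>\<complex>\<^sup>m\<close> through the coordinates \<open>\<psi>\<close>: a matrix is positive when
  its \<open>m\<close> scalar coordinate matrices are.  An order unit is any element with strictly positive
  coordinates.  Both \<open>S\<^sub>k\<^sub>,\<^sub>2\<close> and the dual of \<open>NCP(k)\<close> turn out to be of this kind.
\<close>

locale coordinate_system = star_vector_space V for V :: "'a opsys" (structure) +
  fixes \<psi> :: "nat \<Rightarrow> 'a \<Rightarrow> complex" and m :: nat
  assumes coord_add: "l < m \<Longrightarrow> x \<in> carrier V \<Longrightarrow> y \<in> carrier V \<Longrightarrow> \<psi> l (x \<oplus> y) = \<psi> l x + \<psi> l y"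
    and coord_smult: "l < m \<Longrightarrow> x \<in> carrier V \<Longrightarrow> \<psi> l (c \<odot>\<^bsub>V\<^esub> x) = c * \<psi> l x"
    and coord_star: "l < m \<Longrightarrow> x \<in> carrier V \<Longrightarrow> \<psi> l (star V x) = cnj (\<psi> l x)"
    and coord_inj: "x \<in> carrier V \<Longrightarrow> y \<in> carrier V \<Longrightarrow> (\<And>l. l < m \<Longrightarrow> \<psi> l x = \<psi> l y) \<Longrightarrow> x = y"
    and cone_iff: "X \<in> mcone V n \<longleftrightarrow>
      X \<in> carrier (mat_space n V) \<and> (\<forall>l<m. psd {..<n} (\<lambda>i j. \<psi> l (X $$ (i, j))))"
    and unit_closed: "order_unit V \<in> carrier V"
    and unit_pos: "l < m \<Longrightarrow> \<exists>r>0. \<psi> l (order_unit V) = complex_of_real r"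
begin

lemma abelian_group_V: "abelian_group V"
  by unfold_locales

lemma coord_zero: "l < m \<Longrightarrow> \<psi> l \<zero> = 0"
  using coord_add[of l \<zero> \<zero>] by simp

lemma coord_neg:
  assumes "l < m" "x \<in> carrier V"
  shows "\<psi> l (\<ominus> x) = - \<psi> l x"
proof -
  have "\<psi> l (\<ominus> x) + \<psi> l x = 0"
    using coord_add[OF assms(1), of "\<ominus> x" x] coord_zero assms by (simp add: l_neg)
  then show ?thesis by (simp add: eq_neg_iff_add_eq_0)
qed

lemma coord_finsum:
  assumes "l < m" "finite J" "\<And>j. j \<in> J \<Longrightarrow> f j \<in> carrier V"
  shows "\<psi> l (finsum V f J) = (\<Sum>j\<in>J. \<psi> l (f j))"
  using assms(2,3)
proof (induction J rule: finite_induct)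
  case empty
  then show ?case by (simp add: coord_zero assms)
next
  case (insert j J)
  then show ?case by (simp add: Pi_def coord_add assms)
qed

lemma coneI:
  assumes "X \<in> carrier (mat_space n V)" "\<And>l. l < m \<Longrightarrow> psd {..<n} (N l)"
    and "\<And>l i j. l < m \<Longrightarrow> i < n \<Longrightarrow> j < n \<Longrightarrow> \<psi> l (X $$ (i, j)) = N l i j"
  shows "X \<in> mcone V n"
proof -
  have "psd {..<n} (\<lambda>i j. \<psi> l (X $$ (i, j)))" if "l < m" for l
    using psd_cong[of "{..<n}" "\<lambda>i j. \<psi> l (X $$ (i, j))" "N l"] assms that by simp
  then show ?thesis using assms(1) by (simp add: cone_iff)
qed

lemma coneD:
  assumes "X \<in> mcone V n"
  shows "X \<in> carrier (mat_space n V)" "X \<in> carrier_mat n n"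
    "\<And>i j. i < n \<Longrightarrow> j < n \<Longrightarrow> X $$ (i, j) \<in> carrier V"
    "\<And>l. l < m \<Longrightarrow> psd {..<n} (\<lambda>i j. \<psi> l (X $$ (i, j)))"
  using assms by (simp_all add: cone_iff mat_space_carrier)

lemma operator_system_V: "operator_system V"
proof (intro operator_system.intro star_vector_space_axioms operator_system_axioms.intro)
  fix n
  show "mcone V n \<subseteq> hermitian_mats n V"
  proof
    fix X assume X: "X \<in> mcone V n"
    note X = coneD[OF X]
    have "star V (X $$ (j, i)) = X $$ (i, j)" if "i < n" "j < n" for i j
    proof (rule coord_inj)
      fix l assume l: "l < m"
      show "\<psi> l (star V (X $$ (j, i))) = \<psi> l (X $$ (i, j))"
        using psd_hermitian[OF X(4)[OF l], of j i] X(3) that l by (simp add: coord_star)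
    qed (use X(3) that star_closed in auto)
    then have "star (mat_space n V) X = X"
      using X(2) by (intro eq_matI) (auto simp: mat_space_def)
    then show "X \<in> hermitian_mats n V" using X(1) by (simp add: hermitian_mats_def)
  qed
next
  fix X Y n assume X: "X \<in> mcone V n" and Y: "Y \<in> mcone V n"
  note X = coneD[OF X] and Y = coneD[OF Y]
  show "X \<oplus>\<^bsub>mat_space n V\<^esub> Y \<in> mcone V n"
    by (rule coneI[OF _ psd_add[OF X(4) Y(4)]])
      (auto simp: mat_space_carrier mat_space_sel coord_add X(2,3) Y(2,3))
next
  fix r :: real and X n assume r: "0 \<le> r" and X: "X \<in> mcone V n"
  note X = coneD[OF X]
  show "complex_of_real r \<odot>\<^bsub>mat_space n V\<^esub> X \<in> mcone V n"
    by (rule coneI[OF _ psd_smult[OF X(4) r]])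
      (auto simp: mat_space_carrier mat_space_sel coord_smult X(2,3))
next
  fix X n assume X: "X \<in> mcone V n" and Y: "\<ominus>\<^bsub>mat_space n V\<^esub> X \<in> mcone V n"
  note X = coneD[OF X]
  have Y: "mat n n (\<lambda>ij. \<ominus> X $$ ij) \<in> mcone V n"
    using Y by (simp add: mat_space_neg[OF abelian_group_V X(1)])
  note Y = coneD(4)[OF Y]
  have "X $$ (i, j) = \<zero>" if ij: "i < n" "j < n" for i j
  proof (rule coord_inj)
    fix l assume l: "l < m"
    have "psd {..<n} (\<lambda>i j. - \<psi> l (X $$ (i, j)))"
      using psd_cong[of "{..<n}" "\<lambda>i j. \<psi> l (mat n n (\<lambda>ij. \<ominus> X $$ ij) $$ (i, j))"
        "\<lambda>i j. - \<psi> l (X $$ (i, j))"] Y[OF l] l X(3) by (simp add: coord_neg)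
    from psd_antisym[OF _ X(4)[OF l] this, of i j] show "\<psi> l (X $$ (i, j)) = \<psi> l \<zero>"
      using ij l by (simp add: coord_zero)
  qed (use X(3) ij in auto)
  then show "X = \<zero>\<^bsub>mat_space n V\<^esub>"
    using X(2) by (intro eq_matI) (auto simp: mat_space_def)
next
  fix X n k and A :: "complex mat"
  assume X: "X \<in> mcone V n" and A: "A \<in> carrier_mat n k"
  note X = coneD[OF X]
  let ?f = "\<lambda>i j p. (cnj (A $$ (fst p, i)) * A $$ (snd p, j)) \<odot>\<^bsub>V\<^esub> X $$ p"
  have cl: "?f i j p \<in> carrier V" if "p \<in> {..<n} \<times> {..<n}" for p i j
    using that X(3)[of "fst p" "snd p"] by auto
  show "compress V n k A X \<in> mcone V k"
  proof (rule coneI[OF _ psd_compress[OF finite_lessThan X(4), of _ _ "\<lambda>p i. A $$ (p, i)"]])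
    show "compress V n k A X \<in> carrier (mat_space k V)"
      unfolding compress_def mat_space_carrier using cl by (auto intro!: finsum_closed simp: Pi_def)
    fix l i j assume l: "l < m" and ij: "i < k" "j < k"
    have "\<psi> l (compress V n k A X $$ (i, j)) = \<psi> l (finsum V (?f i j) ({..<n} \<times> {..<n}))"
      using ij by (simp add: compress_def)
    also have "\<dots> = (\<Sum>p\<in>{..<n} \<times> {..<n}. \<psi> l (?f i j p))"
      by (rule coord_finsum[OF l]) (use cl in auto)
    also have "\<dots> = (\<Sum>p\<in>{..<n} \<times> {..<n}. cnj (A $$ (fst p, i)) * A $$ (snd p, j) *
        \<psi> l (X $$ (fst p, snd p)))"
      using X(3) l by (intro sum.cong HOL.refl) (auto simp: coord_smult)
    finally show "\<psi> l (compress V n k A X $$ (i, j)) = \<dots>" .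
  qed
next
  show "order_unit V \<in> carrier V" by (rule unit_closed)
next
  show "star V (order_unit V) = order_unit V"
  proof (rule coord_inj)
    fix l assume l: "l < m"
    obtain r where "\<psi> l (order_unit V) = complex_of_real r" using unit_pos[OF l] by blast
    then show "\<psi> l (star V (order_unit V)) = \<psi> l (order_unit V)"
      by (simp add: coord_star l unit_closed)
  qed (auto simp: unit_closed star_closed)
next
  fix X n assume "X \<in> hermitian_mats n V"
  then have X: "X \<in> carrier (mat_space n V)" and star: "star (mat_space n V) X = X"
    by (simp_all add: hermitian_mats_def)
  note Xc = X[unfolded mat_space_carrier]
  obtain e where e: "\<And>l. l < m \<Longrightarrow> e l > 0 \<and> \<psi> l (order_unit V) = complex_of_real (e l)"
    using unit_pos by metis
  define b where "b l = (\<Sum>i<n. \<Sum>j<n. cmod (\<psi> l (X $$ (i, j))))" for l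
  have b0: "0 \<le> b l" for l by (simp add: b_def sum_nonneg)
  \<comment> \<open>The summand \<open>1\<close> only makes \<open>r\<close> strictly positive; the rest gives \<open>b l \<le> r * e l\<close>.\<close>
  define r where "r = 1 + (\<Sum>l<m. b l / e l)"
  have q0: "0 \<le> b l / e l" if "l \<in> {..<m}" for l
    using that e[of l] b0[of l] by (simp add: less_imp_le)
  have r: "r > 0" unfolding r_def using sum_nonneg[of "{..<m}" "\<lambda>l. b l / e l"] q0 by force
  have br: "b l \<le> r * e l" if l: "l < m" for l
  proof -
    have "b l / e l \<le> (\<Sum>l<m. b l / e l)"
      by (rule member_le_sum[of l "{..<m}" "\<lambda>l. b l / e l"]) (use l q0 in auto)
    then have "b l / e l \<le> r" by (simp add: r_def)
    then show ?thesis using e[OF l] by (simp only: pos_divide_le_eq)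
  qed
  interpret M: abelian_group "mat_space n V"
    by (rule mat_space_abelian_group[OF abelian_group_V])
  have D: "complex_of_real r \<odot>\<^bsub>mat_space n V\<^esub> unit_mat n V \<ominus>\<^bsub>mat_space n V\<^esub> X
    = mat n n (\<lambda>ij. (complex_of_real r \<odot>\<^bsub>V\<^esub> unit_mat n V $$ ij) \<oplus> (\<ominus> X $$ ij))"
    unfolding M.minus_eq mat_space_neg[OF abelian_group_V X]
    by (intro eq_matI) (auto simp: mat_space_def)
  have "complex_of_real r \<odot>\<^bsub>mat_space n V\<^esub> unit_mat n V \<ominus>\<^bsub>mat_space n V\<^esub> X \<in> mcone V n"
    unfolding D
  proof (rule coneI)
    show "mat n n (\<lambda>ij. (complex_of_real r \<odot>\<^bsub>V\<^esub> unit_mat n V $$ ij) \<oplus> (\<ominus> X $$ ij))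
      \<in> carrier (mat_space n V)"
      using Xc by (auto simp: mat_space_carrier unit_mat_def unit_closed)
    fix l assume l: "l < m"
    show "psd {..<n} (\<lambda>i j. (if i = j then complex_of_real (r * e l) else 0) - \<psi> l (X $$ (i, j)))"
    proof (rule psd_dominated)
      fix i j assume "i \<in> {..<n}" "j \<in> {..<n}"
      then have ij: "i < n" "j < n" by auto
      have "X $$ (j, i) = star V (X $$ (i, j))"
        using mat_space_sel(4)[of j n i V X] star ij by simp
      then show "\<psi> l (X $$ (j, i)) = cnj (\<psi> l (X $$ (i, j)))"
        using Xc ij l by (simp add: coord_star)
    qed (use br[OF l] in \<open>simp_all add: b_def\<close>)
    fix i j assume ij: "i < n" "j < n"
    show "\<psi> l (mat n n (\<lambda>ij. (complex_of_real r \<odot>\<^bsub>V\<^esub> unit_mat n V $$ ij) \<oplus> (\<ominus> X $$ ij)) $$ (i, j))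
      = (if i = j then complex_of_real (r * e l) else 0) - \<psi> l (X $$ (i, j))"
      using Xc ij l e[OF l]
      by (auto simp: unit_mat_def unit_closed coord_add coord_smult coord_neg coord_zero)
  qed
  with r show "\<exists>r>0. complex_of_real r \<odot>\<^bsub>mat_space n V\<^esub> unit_mat n V \<ominus>\<^bsub>mat_space n V\<^esub> X \<in> mcone V n"
    by blast
next
  fix X n assume X: "X \<in> carrier (mat_space n V)"
    and arch: "\<And>\<epsilon>. \<epsilon> > 0 \<Longrightarrow>
      complex_of_real \<epsilon> \<odot>\<^bsub>mat_space n V\<^esub> unit_mat n V \<oplus>\<^bsub>mat_space n V\<^esub> X \<in> mcone V n"
  note Xc = X[unfolded mat_space_carrier]
  show "X \<in> mcone V n"
  proof (rule coneI[OF X])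
    fix l assume l: "l < m"
    obtain e where e: "e > 0" "\<psi> l (order_unit V) = complex_of_real e" using unit_pos[OF l] by blast
    show "psd {..<n} (\<lambda>i j. \<psi> l (X $$ (i, j)))"
    proof (rule psd_archimedean[OF finite_lessThan _ e(1)])
      fix \<epsilon> :: real assume eps: "\<epsilon> > 0"
      have eq: "\<psi> l ((complex_of_real \<epsilon> \<odot>\<^bsub>mat_space n V\<^esub> unit_mat n V \<oplus>\<^bsub>mat_space n V\<^esub> X) $$ (i, j))
        = (if i = j then complex_of_real (\<epsilon> * e) else 0) + \<psi> l (X $$ (i, j))"
        if "i < n" "j < n" for i j
        using Xc that l e
        by (auto simp: mat_space_sel unit_mat_def unit_closed coord_add coord_smult coord_zero)
      show "psd {..<n} (\<lambda>i j. (if i = j then complex_of_real (\<epsilon> * e) else 0) + \<psi> l (X $$ (i, j)))"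
        using coneD(4)[OF arch[OF eps] l] eq
        by (subst psd_cong[symmetric]) auto
    qed
  qed simp
qed

end

subsection \<open>Finite sums in the concrete algebras\<close>

lemma abelian_group_complex_alg: "abelian_group complex_alg"
proof (rule abelian_groupI)
  fix x assume "x \<in> carrier complex_alg"
  show "\<exists>y\<in>carrier complex_alg. y \<oplus>\<^bsub>complex_alg\<^esub> x = \<zero>\<^bsub>complex_alg\<^esub>"
    by (intro bexI[of _ "- x"]) (simp_all add: complex_alg_def)
qed (simp_all add: complex_alg_def add_ac)

lemma finsum_complex_alg: "finsum complex_alg f J = sum f J" if "finite J"
proof -
  interpret abelian_group complex_alg by (rule abelian_group_complex_alg)
  have "carrier complex_alg = UNIV" "add complex_alg = (+)" "zero complex_alg = 0"
    by (simp_all add: complex_alg_def)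
  note c = this
  show ?thesis
    using that by (induction J rule: finite_induct) (simp_all add: c)
qed

lemma mat_alg_simps:
  "carrier (mat_space q complex_alg) = carrier_mat q q"
  "star (mat_space q complex_alg) X = mat q q (\<lambda>(i, j). cnj (X $$ (j, i)))"
  "X \<otimes>\<^bsub>mat_space q complex_alg\<^esub> Y = mat q q (\<lambda>(i, j). \<Sum>l<q. X $$ (i, l) * Y $$ (l, j))"
  by (auto simp: mat_space_def finsum_complex_alg) (auto simp: complex_alg_def)

lemma finsum_mat_space:
  assumes A: "abelian_group A" and "finite J" "\<And>l. l \<in> J \<Longrightarrow> f l \<in> carrier (mat_space q A)"
  shows "finsum (mat_space q A) f J = mat q q (\<lambda>ij. finsum A (\<lambda>l. f l $$ ij) J)"
proof -
  interpret A: abelian_group A by fact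
  interpret M: abelian_group "mat_space q A" by (rule mat_space_abelian_group[OF A])
  show ?thesis
    using assms(2,3)
  proof (induction J rule: finite_induct)
    case empty
    have "\<zero>\<^bsub>mat_space q A\<^esub> = mat q q (\<lambda>_. \<zero>\<^bsub>A\<^esub>)" by (simp add: mat_space_def)
    then show ?case by simp
  next
    case (insert l J)
    then have *: "\<And>l' i j. l' \<in> insert l J \<Longrightarrow> i < q \<Longrightarrow> j < q \<Longrightarrow> f l' $$ (i, j) \<in> carrier A"
      by (auto simp: mat_space_carrier)
    have "finsum (mat_space q A) f (insert l J) = f l \<oplus>\<^bsub>mat_space q A\<^esub> finsum (mat_space q A) f J"
      using insert by (intro M.finsum_insert) auto
    also have "finsum (mat_space q A) f J = mat q q (\<lambda>ij. finsum A (\<lambda>l. f l $$ ij) J)"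
      using insert by auto
    also have "f l \<oplus>\<^bsub>mat_space q A\<^esub> mat q q (\<lambda>ij. finsum A (\<lambda>l. f l $$ ij) J)
        = mat q q (\<lambda>ij. finsum A (\<lambda>l. f l $$ ij) (insert l J))"
      using insert.hyps * by (intro eq_matI) (auto simp: mat_space_def A.finsum_insert Pi_def)
    finally show ?case .
  qed
qed

text \<open>
  Under the identification of \<open>M\<^sub>n(M\<^sub>q)\<close> with matrices indexed by pairs, the elements \<open>Y\<^sup>* Y\<close> are the
  Gram matrices, and these are the positive semidefinite ones.
\<close>

lemma mat_system_cone:
  "X \<in> mcone (mat_system q) n \<longleftrightarrow> X \<in> carrier_mat n n \<and> (\<forall>a<n. \<forall>b<n. X $$ (a, b) \<in> carrier_mat q q) \<and>
    psd ({..<n} \<times> {..<q}) (\<lambda>p p'. X $$ (fst p, fst p') $$ (snd p, snd p'))"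
proof -
  let ?M = "mat_space q complex_alg"
  let ?R = "\<lambda>Y. mat n n (\<lambda>(a, b). finsum ?M (\<lambda>l. star ?M (Y $$ (l, a)) \<otimes>\<^bsub>?M\<^esub> Y $$ (l, b)) {..<n})"
  have R: "?R Y $$ (a, b) = mat q q (\<lambda>(i, j).
      \<Sum>p\<in>{..<n} \<times> {..<q}. cnj (Y $$ (fst p, a) $$ (snd p, i)) * Y $$ (fst p, b) $$ (snd p, j))"
    if ab: "a < n" "b < n" and Y: "Y \<in> carrier (mat_space n ?M)" for Y a b
  proof -
    have "?R Y $$ (a, b) = finsum ?M (\<lambda>l. star ?M (Y $$ (l, a)) \<otimes>\<^bsub>?M\<^esub> Y $$ (l, b)) {..<n}"
      using ab by simp
    also have "\<dots> = mat q q (\<lambda>ij. finsum complex_alg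
        (\<lambda>l. (star ?M (Y $$ (l, a)) \<otimes>\<^bsub>?M\<^esub> Y $$ (l, b)) $$ ij) {..<n})"
      by (rule finsum_mat_space[OF abelian_group_complex_alg]) (simp_all add: mat_alg_simps)
    also have "\<dots> = mat q q (\<lambda>(i, j).
      \<Sum>p\<in>{..<n} \<times> {..<q}. cnj (Y $$ (fst p, a) $$ (snd p, i)) * Y $$ (fst p, b) $$ (snd p, j))"
      by (intro eq_matI)
        (auto simp: finsum_complex_alg mat_alg_simps sum.cartesian_product case_prod_beta)
    finally show ?thesis .
  qed
  have cone: "X \<in> mcone (mat_system q) n \<longleftrightarrow>
    (\<exists>Y\<in>carrier (mat_space n ?M). X = ?R Y) \<and> elements_mat X \<subseteq> carrier_mat q q"
    by (simp add: mat_system_def Let_def subsystem_def positive_elements_mat_space mat_alg_simps)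
  show ?thesis
  proof
    assume X: "X \<in> mcone (mat_system q) n"
    then obtain Y where Y: "Y \<in> carrier (mat_space n ?M)" and XY: "X = ?R Y"
      unfolding cone by blast
    have 1: "X \<in> carrier_mat n n" by (simp add: XY)
    have 2: "X $$ (a, b) \<in> carrier_mat q q" if "a < n" "b < n" for a b
      unfolding XY R[OF that Y] by simp
    have 3: "psd ({..<n} \<times> {..<q}) (\<lambda>p p'. X $$ (fst p, fst p') $$ (snd p, snd p'))"
    proof (rule gram_psd)
      fix p p' assume "p \<in> {..<n} \<times> {..<q}" "p' \<in> {..<n} \<times> {..<q}"
      then have *: "fst p < n" "fst p' < n" "snd p < q" "snd p' < q" by auto
      show "X $$ (fst p, fst p') $$ (snd p, snd p') = (\<Sum>l\<in>{..<n} \<times> {..<q}.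
          cnj (Y $$ (fst l, fst p) $$ (snd l, snd p)) * Y $$ (fst l, fst p') $$ (snd l, snd p'))"
        unfolding XY R[OF *(1,2) Y] using * by simp
    qed
    show "X \<in> carrier_mat n n \<and> (\<forall>a<n. \<forall>b<n. X $$ (a, b) \<in> carrier_mat q q) \<and>
      psd ({..<n} \<times> {..<q}) (\<lambda>p p'. X $$ (fst p, fst p') $$ (snd p, snd p'))"
      using 1 2 3 by blast
  next
    assume "X \<in> carrier_mat n n \<and> (\<forall>a<n. \<forall>b<n. X $$ (a, b) \<in> carrier_mat q q) \<and>
      psd ({..<n} \<times> {..<q}) (\<lambda>p p'. X $$ (fst p, fst p') $$ (snd p, snd p'))"
    then have X: "X \<in> carrier_mat n n" "\<And>a b. a < n \<Longrightarrow> b < n \<Longrightarrow> X $$ (a, b) \<in> carrier_mat q q"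
      and psd: "psd ({..<n} \<times> {..<q}) (\<lambda>p p'. X $$ (fst p, fst p') $$ (snd p, snd p'))" by auto
    obtain Z where Z: "\<And>p p'. p \<in> {..<n} \<times> {..<q} \<Longrightarrow> p' \<in> {..<n} \<times> {..<q} \<Longrightarrow>
        X $$ (fst p, fst p') $$ (snd p, snd p') = (\<Sum>l\<in>{..<n} \<times> {..<q}. cnj (Z l p) * Z l p')"
      using psd_gram_factorization[OF _ psd] by blast
    define Y where "Y = mat n n (\<lambda>(l, a). mat q q (\<lambda>(r, i). Z (l, r) (a, i)))"
    have Y: "Y \<in> carrier (mat_space n ?M)"
      by (simp add: Y_def mat_space_carrier mat_alg_simps)
    have "X = ?R Y"
    proof (rule eq_matI)
      fix a b assume "a < dim_row (?R Y)" "b < dim_col (?R Y)"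
      then have ab: "a < n" "b < n" by auto
      show "X $$ (a, b) = ?R Y $$ (a, b)"
        unfolding R[OF ab Y]
      proof (rule eq_matI)
        fix i j assume "i < dim_row (mat q q (\<lambda>(i, j). \<Sum>p\<in>{..<n} \<times> {..<q}.
            cnj (Y $$ (fst p, a) $$ (snd p, i)) * Y $$ (fst p, b) $$ (snd p, j)))"
          "j < dim_col (mat q q (\<lambda>(i, j). \<Sum>p\<in>{..<n} \<times> {..<q}.
            cnj (Y $$ (fst p, a) $$ (snd p, i)) * Y $$ (fst p, b) $$ (snd p, j)))"
        then have ij: "i < q" "j < q" by auto
        have "X $$ (a, b) $$ (i, j) = (\<Sum>l\<in>{..<n} \<times> {..<q}. cnj (Z l (a, i)) * Z l (b, j))"
          using Z[of "(a, i)" "(b, j)"] ab ij by simp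
        also have "\<dots> = (\<Sum>p\<in>{..<n} \<times> {..<q}.
            cnj (Y $$ (fst p, a) $$ (snd p, i)) * Y $$ (fst p, b) $$ (snd p, j))"
          by (intro sum.cong HOL.refl) (use ab ij in \<open>auto simp: Y_def\<close>)
        finally show "X $$ (a, b) $$ (i, j) = mat q q (\<lambda>(i, j). \<Sum>p\<in>{..<n} \<times> {..<q}.
            cnj (Y $$ (fst p, a) $$ (snd p, i)) * Y $$ (fst p, b) $$ (snd p, j)) $$ (i, j)"
          using ij by simp
      qed (use X(2)[OF ab] in auto)
    qed (use X(1) in auto)
    moreover have "elements_mat X \<subseteq> carrier_mat q q"
      using X unfolding elements_mat_def by fastforce
    ultimately show "X \<in> mcone (mat_system q) n" using Y cone by blast
  qed
qed

subsection \<open>The tuple algebra and \<open>S\<^sub>k\<^sub>,\<^sub>2\<close>\<close>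

lemma abelian_group_tuple_alg: "abelian_group (tuple_alg m)"
proof (rule abelian_groupI)
  fix x assume "x \<in> carrier (tuple_alg m)"
  then show "\<exists>y\<in>carrier (tuple_alg m). y \<oplus>\<^bsub>tuple_alg m\<^esub> x = \<zero>\<^bsub>tuple_alg m\<^esub>"
    by (intro bexI[of _ "- x"]) (auto simp: tuple_alg_def uminus_l_inv_vec)
qed (auto simp: tuple_alg_def comm_add_vec assoc_add_vec)

lemma finsum_tuple_alg:
  assumes "finite J" "\<And>l. l \<in> J \<Longrightarrow> f l \<in> carrier_vec m"
  shows "finsum (tuple_alg m) f J = vec m (\<lambda>c. \<Sum>l\<in>J. f l $ c)"
proof -
  interpret abelian_group "tuple_alg m" by (rule abelian_group_tuple_alg)
  have c: "carrier (tuple_alg m) = carrier_vec m" by (simp add: tuple_alg_def)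
  show ?thesis
    using assms
  proof (induction J rule: finite_induct)
    case empty
    have "\<zero>\<^bsub>tuple_alg m\<^esub> = vec m (\<lambda>_. 0)" by (simp add: tuple_alg_def zero_vec_def)
    then show ?case by simp
  next
    case (insert l J)
    have "finsum (tuple_alg m) f (insert l J) = f l \<oplus>\<^bsub>tuple_alg m\<^esub> finsum (tuple_alg m) f J"
      using insert by (intro finsum_insert) (auto simp: c)
    also have "finsum (tuple_alg m) f J = vec m (\<lambda>c. \<Sum>l\<in>J. f l $ c)" using insert by auto
    also have "f l \<oplus>\<^bsub>tuple_alg m\<^esub> vec m (\<lambda>c. \<Sum>l\<in>J. f l $ c) = vec m (\<lambda>c. \<Sum>l\<in>insert l J. f l $ c)"
      using insert by (intro eq_vecI) (auto simp: tuple_alg_def)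
    finally show ?case .
  qed
qed

text \<open>
  The factorization \<open>X = Y\<^sup>* Y\<close> is a Gram factorization in each coordinate separately.
\<close>

lemma tuple_alg_positive:
  "X \<in> positive_elements (mat_space n (tuple_alg m)) \<longleftrightarrow>
    X \<in> carrier (mat_space n (tuple_alg m)) \<and> (\<forall>c<m. psd {..<n} (\<lambda>i j. X $$ (i, j) $ c))"
proof -
  let ?T = "tuple_alg m"
  let ?R = "\<lambda>Y. mat n n (\<lambda>(i, j). finsum ?T (\<lambda>l. star ?T (Y $$ (l, i)) \<otimes>\<^bsub>?T\<^esub> Y $$ (l, j)) {..<n})"
  have carr: "carrier ?T = carrier_vec m" by (simp add: tuple_alg_def)
  have R: "?R Y $$ (i, j) = vec m (\<lambda>c. \<Sum>l<n. cnj (Y $$ (l, i) $ c) * Y $$ (l, j) $ c)"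
    if "i < n" "j < n" for Y i j
  proof -
    have "?R Y $$ (i, j) = finsum ?T (\<lambda>l. star ?T (Y $$ (l, i)) \<otimes>\<^bsub>?T\<^esub> Y $$ (l, j)) {..<n}"
      using that by simp
    also have "\<dots> = vec m (\<lambda>c. \<Sum>l<n. (star ?T (Y $$ (l, i)) \<otimes>\<^bsub>?T\<^esub> Y $$ (l, j)) $ c)"
      by (rule finsum_tuple_alg) (simp_all add: tuple_alg_def)
    also have "\<dots> = vec m (\<lambda>c. \<Sum>l<n. cnj (Y $$ (l, i) $ c) * Y $$ (l, j) $ c)"
      by (intro eq_vecI) (simp_all add: tuple_alg_def)
    finally show ?thesis .
  qed
  show ?thesis
  proof
    assume "X \<in> positive_elements (mat_space n ?T)"
    then obtain Y where XY: "X = ?R Y" unfolding positive_elements_mat_space by blast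
    have "psd {..<n} (\<lambda>i j. X $$ (i, j) $ c)" if "c < m" for c
      by (rule gram_psd[where L = "{..<n}" and Y = "\<lambda>l i. Y $$ (l, i) $ c"])
        (unfold XY, use R that in simp)
    moreover have "X \<in> carrier (mat_space n ?T)"
      unfolding mat_space_carrier carr using R by (simp add: XY)
    ultimately show "X \<in> carrier (mat_space n ?T) \<and> (\<forall>c<m. psd {..<n} (\<lambda>i j. X $$ (i, j) $ c))"
      by blast
  next
    assume "X \<in> carrier (mat_space n ?T) \<and> (\<forall>c<m. psd {..<n} (\<lambda>i j. X $$ (i, j) $ c))"
    then have X: "X \<in> carrier_mat n n" "\<And>i j. i < n \<Longrightarrow> j < n \<Longrightarrow> X $$ (i, j) \<in> carrier_vec m"
      and psd: "\<And>c. c < m \<Longrightarrow> psd {..<n} (\<lambda>i j. X $$ (i, j) $ c)"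
      by (auto simp: mat_space_carrier carr)
    have "\<forall>c. \<exists>Z. c < m \<longrightarrow> (\<forall>i\<in>{..<n}. \<forall>j\<in>{..<n}. X $$ (i, j) $ c = (\<Sum>l<n. cnj (Z l i) * Z l j))"
      using psd_gram_factorization[OF finite_lessThan psd] by blast
    then obtain Z where Z: "\<And>c i j. c < m \<Longrightarrow> i < n \<Longrightarrow> j < n \<Longrightarrow>
        X $$ (i, j) $ c = (\<Sum>l<n. cnj (Z c l i) * Z c l j)"
      by (metis lessThan_iff)
    define Y where "Y = mat n n (\<lambda>(l, i). vec m (\<lambda>c. Z c l i))"
    have "X = ?R Y"
    proof (rule eq_matI)
      fix i j assume "i < dim_row (?R Y)" "j < dim_col (?R Y)"
      then have ij: "i < n" "j < n" by auto
      show "X $$ (i, j) = ?R Y $$ (i, j)"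
        unfolding R[OF ij] using X(2)[OF ij] Z ij by (intro eq_vecI) (auto simp: Y_def)
    qed (use X(1) in auto)
    moreover have "Y \<in> carrier (mat_space n ?T)"
      by (simp add: mat_space_carrier carr Y_def)
    ultimately show "X \<in> positive_elements (mat_space n ?T)"
      unfolding positive_elements_mat_space by blast
  qed
qed

definition S_carrier :: "nat \<Rightarrow> complex vec set" where
  "S_carrier k = {z \<in> carrier_vec (k + 2). (\<Sum>i<k. z $ i) = z $ k + z $ (k + 1)}"

lemma S_k2_simps:
  "carrier (S_k2 k e) = S_carrier k"
  "add (S_k2 k e) = (+)"
  "zero (S_k2 k e) = 0\<^sub>v (k + 2)"
  "module.smult (S_k2 k e) = (\<cdot>\<^sub>v)"
  "star (S_k2 k e) = (\<lambda>x. vec (k + 2) (\<lambda>i. cnj (x $ i)))"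
  "order_unit (S_k2 k e) = e"
  by (simp_all add: S_k2_def subsystem_def tuple_alg_def S_carrier_def)

lemma S_carrier_closed:
  "x \<in> S_carrier k \<Longrightarrow> y \<in> S_carrier k \<Longrightarrow> x + y \<in> S_carrier k"
  "x \<in> S_carrier k \<Longrightarrow> c \<cdot>\<^sub>v x \<in> S_carrier k"
  "0\<^sub>v (k + 2) \<in> S_carrier k"
  "x \<in> S_carrier k \<Longrightarrow> vec (k + 2) (\<lambda>i. cnj (x $ i)) \<in> S_carrier k"
proof -
  assume x: "x \<in> S_carrier k" and y: "y \<in> S_carrier k"
  then show "x + y \<in> S_carrier k"
    by (auto simp: S_carrier_def sum.distrib)
next
  assume x: "x \<in> S_carrier k"
  then show "c \<cdot>\<^sub>v x \<in> S_carrier k"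
    by (auto simp: S_carrier_def simp flip: sum_distrib_left distrib_left)
  have "cnj (\<Sum>i<k. x $ i) = cnj (x $ k + x $ (k + 1))" using x by (simp add: S_carrier_def)
  then show "vec (k + 2) (\<lambda>i. cnj (x $ i)) \<in> S_carrier k"
    by (simp add: S_carrier_def)
next
  show "0\<^sub>v (k + 2) \<in> S_carrier k" by (simp add: S_carrier_def)
qed

lemma coordinate_system_S_k2:
  assumes e: "e \<in> S_carrier k" and pos: "\<And>l. l < k + 2 \<Longrightarrow> \<exists>r>0. e $ l = complex_of_real r"
  shows "coordinate_system (S_k2 k e) (\<lambda>l z. z $ l) (k + 2)"
proof -
  define m where "m = k + 2"
  note cl = S_carrier_closed[where k = k, folded m_def]
  note S_simps = S_k2_simps[where k = k and e = e, folded m_def]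
  have dim: "x \<in> S_carrier k \<Longrightarrow> x \<in> carrier_vec m" for x by (simp add: S_carrier_def m_def)
  have "Module.module (class_ring :: complex ring) (S_k2 k e)"
  proof (rule module_criteria)
    show "cring (class_ring :: complex ring)" by (rule class_cring.is_cring)
    show "\<forall>v\<in>carrier (S_k2 k e). \<exists>w\<in>carrier (S_k2 k e). v \<oplus>\<^bsub>S_k2 k e\<^esub> w = \<zero>\<^bsub>S_k2 k e\<^esub>"
    proof
      fix v assume "v \<in> carrier (S_k2 k e)"
      then have v: "v \<in> S_carrier k" by (simp add: S_simps)
      have "v + (-1) \<cdot>\<^sub>v v = 0\<^sub>v m" using dim[OF v] by (intro eq_vecI) auto
      then show "\<exists>w\<in>carrier (S_k2 k e). v \<oplus>\<^bsub>S_k2 k e\<^esub> w = \<zero>\<^bsub>S_k2 k e\<^esub>"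
        using cl(2)[OF v, of "-1"] by (auto simp: S_simps)
    qed
  qed (auto simp: S_simps cl smult_smult_assoc add_smult_distrib_vec
      intro!: comm_add_vec[of _ m] assoc_add_vec[of _ m] right_zero_vec[of _ m]
        smult_add_distrib_vec[of _ m] dim)
  then have vs: "vectorspace (class_ring :: complex ring) (S_k2 k e)"
    by (intro vectorspace.intro class_field)
  have "star_vector_space_axioms (S_k2 k e)"
  proof (rule star_vector_space_axioms.intro, unfold S_simps)
    fix x y c assume x: "x \<in> S_carrier k" and y: "y \<in> S_carrier k"
    note d = carrier_vecD[OF dim[OF x]] carrier_vecD[OF dim[OF y]]
    show "vec m (\<lambda>i. cnj ((x + y) $ i)) = vec m (\<lambda>i. cnj (x $ i)) + vec m (\<lambda>i. cnj (y $ i))"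
      using d by (intro eq_vecI) auto
  next
    fix x c assume x: "x \<in> S_carrier k"
    note d = carrier_vecD[OF dim[OF x]]
    show "vec m (\<lambda>i. cnj (x $ i)) \<in> S_carrier k" by (rule cl(4)[OF x])
    show "vec m (\<lambda>i. cnj (vec m (\<lambda>i. cnj (x $ i)) $ i)) = x"
      using d by (intro eq_vecI) auto
    show "vec m (\<lambda>i. cnj ((c \<cdot>\<^sub>v x) $ i)) = cnj c \<cdot>\<^sub>v vec m (\<lambda>i. cnj (x $ i))"
      using d by (intro eq_vecI) auto
  qed
  with vs have star: "star_vector_space (S_k2 k e)"
    by (rule star_vector_space.intro)
  have inter: "X \<in> carrier (mat_space n (tuple_alg m)) \<and> elements_mat X \<subseteq> S_carrier k
      \<longleftrightarrow> X \<in> carrier (mat_space n (S_k2 k e))" for X n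
    using dim by (auto simp: mat_space_def S_simps tuple_alg_def)
  have cone: "X \<in> mcone (S_k2 k e) n \<longleftrightarrow>
      X \<in> positive_elements (mat_space n (tuple_alg m)) \<and> elements_mat X \<subseteq> S_carrier k" for X n
    by (simp only: S_k2_def subsystem_def opsys.select_convs m_def S_carrier_def mem_Collect_eq)
  have "coordinate_system_axioms (S_k2 k e) (\<lambda>l z. z $ l) m"
  proof (intro coordinate_system_axioms.intro)
    fix x y assume "x \<in> carrier (S_k2 k e)" "y \<in> carrier (S_k2 k e)"
      and eq: "\<And>l. l < m \<Longrightarrow> x $ l = y $ l"
    then have "x \<in> carrier_vec m" "y \<in> carrier_vec m" by (simp_all add: S_simps dim)
    then show "x = y" by (intro eq_vecI) (auto simp: eq)
  next
    fix X n
    show "X \<in> mcone (S_k2 k e) n \<longleftrightarrow> X \<in> carrier (mat_space n (S_k2 k e)) \<and>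
      (\<forall>l<m. psd {..<n} (\<lambda>i j. X $$ (i, j) $ l))"
      unfolding cone tuple_alg_positive using inter by blast
  next
    show "\<And>l. l < m \<Longrightarrow> \<exists>r>0. order_unit (S_k2 k e) $ l = complex_of_real r"
      unfolding S_simps m_def by (rule pos)
  next
    fix l x y assume "l < m" "x \<in> carrier (S_k2 k e)" "y \<in> carrier (S_k2 k e)"
    then show "(x \<oplus>\<^bsub>S_k2 k e\<^esub> y) $ l = x $ l + y $ l"
      using dim[of x] dim[of y] by (simp add: S_simps)
  next
    fix l x c assume "l < m" "x \<in> carrier (S_k2 k e)"
    then show "(c \<odot>\<^bsub>S_k2 k e\<^esub> x) $ l = c * x $ l"
      using dim[of x] by (simp add: S_simps)
  qed (simp_all add: S_simps e)
  with star show ?thesis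
    unfolding m_def[symmetric] by (rule coordinate_system.intro)
qed

section \<open>The elements of \<open>NCP(k)\<close>\<close>

definition unity_root :: "nat \<Rightarrow> nat \<Rightarrow> complex" where
  "unity_root k l = cis (2 * pi * real l / real k)"

lemma root_power_k: "0 < k \<Longrightarrow> unity_root k l ^ k = 1"
  unfolding unity_root_def DeMoivre by (simp add: cis_multiple_2pi)

lemma root_cnj: "unity_root k l * cnj (unity_root k l) = 1" "cnj (unity_root k l) * unity_root k l = 1"
  by (simp_all add: unity_root_def cis_cnj cis_mult)

lemma root_swap: "unity_root k a ^ b = unity_root k b ^ a"
  unfolding unity_root_def DeMoivre by (simp add: mult_ac)

lemma cnj_root_swap: "cnj (unity_root k a) ^ b = cnj (unity_root k b) ^ a"
  using root_swap[of k a b] by (simp only: complex_cnj_power[symmetric])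

lemma root_inj: "a < k \<Longrightarrow> b < k \<Longrightarrow> unity_root k a = unity_root k b \<longleftrightarrow> a = b"
  using bij_betw_roots_unity[of k] unfolding bij_betw_def inj_on_def unity_root_def by auto

lemma root_orthogonal:
  assumes "a < k" "b < k"
  shows "(\<Sum>j<k. unity_root k a ^ j * cnj (unity_root k b) ^ j) = (if a = b then of_nat k else 0)"
proof (cases "a = b")
  case True
  then show ?thesis by (simp add: root_cnj flip: power_mult_distrib)
next
  case False
  define z where "z = unity_root k a * cnj (unity_root k b)"
  have "z \<noteq> 1"
  proof
    assume "z = 1"
    then have "z * unity_root k b = unity_root k b" by simp
    then have "unity_root k a = unity_root k b" by (simp add: z_def mult.assoc root_cnj)
    then show False using False root_inj[OF assms] by simp
  qed
  moreover have "z ^ k = 1"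
    using assms by (simp add: z_def power_mult_distrib root_power_k flip: complex_cnj_power)
  ultimately have "(\<Sum>j<k. z ^ j) = 0" by (simp add: geometric_sum)
  then show ?thesis using False by (simp add: z_def power_mult_distrib)
qed

lemma sum_periodic_shift:
  fixes f :: "nat \<Rightarrow> 'a :: ab_group_add"
  assumes "\<And>j. f (j + k) = f j"
  shows "(\<Sum>j<k. f (i + j)) = (\<Sum>j<k. f j)"
proof (induction i)
  case (Suc i)
  have "(\<Sum>j<k. f (Suc i + j)) + f i = (\<Sum>j<Suc k. f (i + j))"
    by (subst sum.lessThan_Suc_shift) (simp add: add.commute)
  also have "\<dots> = (\<Sum>j<k. f (i + j)) + f i"
    using assms[of i] by simp
  finally show ?case using Suc by simp
qed simp

locale ncp =
  fixes k :: nat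
  assumes k2: "2 \<le> k"
begin

abbreviation "Zk \<equiv> integer_mod_group k"
abbreviation "Z2 \<equiv> integer_mod_group 2"
abbreviation "FG \<equiv> free_prod_Zk_Z2 k"

lemma k0: "0 < k" using k2 by simp

sublocale F: free_product_of_groups Zk Z2
  by (simp add: free_product_of_groups_def)

sublocale FG: group FG
  by (rule F.group_free_product)

abbreviation "GA \<equiv> group_algebra FG"
abbreviation "CA \<equiv> cstar_Zk_Z2 k"

definition W :: "nat \<Rightarrow> (int + int) list set" where
  "W j = free_inl Zk Z2 (int (j mod k))"

definition V :: "(int + int) list set" where
  "V = free_inr Zk Z2 1"

lemma mod_closed: "int (j mod k) \<in> carrier Zk"
  using k0 by (simp add: carrier_integer_mod_group)

lemma one_closed: "1 \<in> carrier Z2"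
  by simp

lemma W_closed: "W j \<in> carrier FG"
  unfolding W_def by (rule F.free_inl_closed[OF mod_closed])

lemma V_closed: "V \<in> carrier FG"
  unfolding V_def by (rule F.free_inr_closed[OF one_closed])

lemma W_mult: "W i \<otimes>\<^bsub>FG\<^esub> W j = W (i + j)"
  unfolding W_def by (simp add: F.free_inl_mult mod_closed flip: of_nat_add zmod_int) (simp add: mod_simps)

lemma W_0: "W 0 = \<one>\<^bsub>FG\<^esub>"
  using F.free_inl_one by (simp add: W_def)

lemma W_period: "W (j + k) = W j"
  by (simp add: W_def)

lemma V_mult: "V \<otimes>\<^bsub>FG\<^esub> V = \<one>\<^bsub>FG\<^esub>"
  using F.free_inr_mult[OF one_closed one_closed] F.free_inr_one by (simp add: V_def)

lemma inv_V: "inv\<^bsub>FG\<^esub> V = V"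
  by (rule FG.inv_equality[OF V_mult V_closed V_closed])

lemma inv_W: "j \<le> k \<Longrightarrow> inv\<^bsub>FG\<^esub> (W j) = W (k - j)"
  by (rule FG.inv_equality) (use W_period[of 0] in \<open>simp_all add: W_mult W_0 W_closed\<close>)

text \<open>
  The spectral projection of \<open>w\<close> for the eigenvalue \<open>unity_root k l\<close>.
\<close>

definition P :: "nat \<Rightarrow> (int + int) list set \<Rightarrow> complex" where
  "P l = (\<lambda>x. \<Sum>j<k. 1 / of_nat k * cnj (unity_root k l) ^ j * delta (W j) x)"

lemmas dW = FG.delta_closed[OF W_closed] and dV = FG.delta_closed[OF V_closed]

lemma P_closed: "P l \<in> carrier GA"
  unfolding P_def by (intro FG.ga_sum_closed FG.ga_smult_closed dW)

lemma mult_sum_right: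
  fixes n :: nat
  shows "a \<otimes>\<^bsub>GA\<^esub> (\<lambda>x. \<Sum>j<n. c j * b j x) = (\<lambda>x. \<Sum>j<n. c j * (a \<otimes>\<^bsub>GA\<^esub> b j) x)"
  by (induction n) (simp_all add: FG.ga_mult_zero FG.ga_mult_add_right FG.ga_mult_smult_right)

lemma mult_sum_left:
  fixes n :: nat
  assumes "\<And>j. b j \<in> carrier GA"
  shows "(\<lambda>x. \<Sum>j<n. c j * b j x) \<otimes>\<^bsub>GA\<^esub> a = (\<lambda>x. \<Sum>j<n. c j * (b j \<otimes>\<^bsub>GA\<^esub> a) x)"
  by (induction n)
    (simp_all add: FG.ga_mult_zero FG.ga_mult_add_left FG.ga_mult_smult_left assms
      FG.ga_sum_closed FG.ga_smult_closed)

lemma cnj_root_power_k: "cnj (unity_root k l) ^ k = 1"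
  by (simp add: root_power_k k0 flip: complex_cnj_power)

lemma cnj_root_period: "cnj (unity_root k l) ^ (j + k) = cnj (unity_root k l) ^ j"
  by (simp add: power_add cnj_root_power_k)

text \<open>
  Multiplication by \<open>w\<^sup>i\<close> shifts the summation index, and the summands are periodic in it.
\<close>

lemma delta_mult_P: "delta (W i) \<otimes>\<^bsub>GA\<^esub> P l = (\<lambda>x. unity_root k l ^ i * P l x)"
proof
  fix x
  let ?f = "\<lambda>j. unity_root k l ^ i * (1 / of_nat k * cnj (unity_root k l) ^ j * delta (W j) x)"
  have h: "unity_root k l ^ i * cnj (unity_root k l) ^ (i + j) = cnj (unity_root k l) ^ j" for j
    by (simp only: power_add mult.assoc[symmetric] power_mult_distrib[symmetric] root_cnj
        power_one mult_1_left)
  have h': "1 / of_nat k * cnj (unity_root k l) ^ j * d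
      = unity_root k l ^ i * (1 / of_nat k * cnj (unity_root k l) ^ (i + j) * d)" for j d
    unfolding h[of j, symmetric] by (simp only: mult_ac)
  have "(delta (W i) \<otimes>\<^bsub>GA\<^esub> P l) x
      = (\<Sum>j<k. 1 / of_nat k * cnj (unity_root k l) ^ j * delta (W (i + j)) x)"
    unfolding P_def mult_sum_right by (simp add: FG.delta_mult W_closed W_mult)
  also have "\<dots> = (\<Sum>j<k. ?f (i + j))"
    by (rule sum.cong[OF HOL.refl]) (rule h')
  also have "\<dots> = (\<Sum>j<k. ?f j)"
    by (rule sum_periodic_shift) (simp only: cnj_root_period W_period)
  finally show "(delta (W i) \<otimes>\<^bsub>GA\<^esub> P l) x = unity_root k l ^ i * P l x"
    by (simp only: P_def sum_distrib_left)
qed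

lemma P_idem: "P l \<otimes>\<^bsub>GA\<^esub> P l = P l"
proof
  fix x
  have "(P l \<otimes>\<^bsub>GA\<^esub> P l) x
      = ((\<lambda>x. \<Sum>j<k. 1 / of_nat k * cnj (unity_root k l) ^ j * delta (W j) x) \<otimes>\<^bsub>GA\<^esub> P l) x"
    by (simp only: P_def[of l, symmetric])
  also have "\<dots> = (\<Sum>j<k. 1 / of_nat k * cnj (unity_root k l) ^ j * (unity_root k l ^ j * P l x))"
    by (simp only: mult_sum_left[OF dW] delta_mult_P)
  also have "\<dots> = (\<Sum>j<k. 1 / of_nat k * P l x)"
  proof (intro sum.cong HOL.refl)
    fix j
    have "cnj (unity_root k l) ^ j * (unity_root k l ^ j * P l x) = P l x"
      by (simp only: mult.assoc[symmetric] power_mult_distrib[symmetric] root_cnj power_one mult_1_left)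
    then show "1 / of_nat k * cnj (unity_root k l) ^ j * (unity_root k l ^ j * P l x)
        = 1 / of_nat k * P l x"
      by (simp only: mult.assoc)
  qed
  also have "\<dots> = P l x" using k0 by simp
  finally show "(P l \<otimes>\<^bsub>GA\<^esub> P l) x = P l x" .
qed

lemma P_star: "star GA (P l) = P l"
proof
  fix x
  \<comment> \<open>The adjoint reverses the summation index to \<open>k - j\<close>, which runs through \<open>1, \<dots>, k\<close> and is shifted back by periodicity.\<close>
  let ?f = "\<lambda>j. 1 / of_nat k * cnj (unity_root k l) ^ j * delta (W j) x"
  have root: "cnj (cnj (unity_root k l) ^ j) = cnj (unity_root k l) ^ (k - j)" if "j < k" for j
  proof -
    have "cnj (unity_root k l) ^ (k - j) * cnj (unity_root k l) ^ j = 1"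
      using that cnj_root_power_k[of l] by (simp flip: power_add)
    then have "cnj (unity_root k l) ^ (k - j) * cnj (unity_root k l) ^ j * unity_root k l ^ j = unity_root k l ^ j" by simp
    then show ?thesis by (simp add: mult.assoc root_cnj flip: power_mult_distrib)
  qed
  have "star GA (P l) x = (\<Sum>j<k. ?f (k - j))"
    unfolding P_def FG.ga_star_sum FG.ga_star_smult
    by (intro sum.cong HOL.refl) (simp add: FG.star_delta W_closed inv_W flip: root)
  also have "\<dots> = (\<Sum>j<k. ?f (Suc (k - Suc j)))"
    by (intro sum.cong HOL.refl) (simp add: Suc_diff_Suc)
  also have "\<dots> = (\<Sum>j<k. ?f (Suc j))"
    by (rule sum.nat_diff_reindex)
  also have "\<dots> = (\<Sum>j<k. ?f (1 + j))" by simp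
  also have "\<dots> = (\<Sum>j<k. ?f j)"
    by (rule sum_periodic_shift) (simp only: cnj_root_period W_period)
  finally show "star GA (P l) x = P l x" by (simp only: P_def)
qed

text \<open>
  Fourier inversion on \<open>\<int>\<^sub>k\<close>: the spectral decomposition of \<open>w\<^sup>j\<close>.
\<close>

lemma delta_W_P:
  assumes "j < k"
  shows "delta (W j) x = (\<Sum>l<k. unity_root k l ^ j * P l x)"
proof -
  have "(\<Sum>l<k. unity_root k l ^ j * P l x)
      = (\<Sum>l<k. \<Sum>i<k. 1 / of_nat k * delta (W i) x * (unity_root k j ^ l * cnj (unity_root k i) ^ l))"
  proof (unfold P_def sum_distrib_left, intro sum.cong HOL.refl)
    fix l i
    show "unity_root k l ^ j * (1 / of_nat k * cnj (unity_root k l) ^ i * delta (W i) x)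
      = 1 / of_nat k * delta (W i) x * (unity_root k j ^ l * cnj (unity_root k i) ^ l)"
      unfolding root_swap[of k l j] cnj_root_swap[of k l i] by (simp only: mult_ac)
  qed
  also have "\<dots> = (\<Sum>i<k. \<Sum>l<k. 1 / of_nat k * delta (W i) x * (unity_root k j ^ l * cnj (unity_root k i) ^ l))"
    by (rule sum.swap)
  also have "\<dots> = (\<Sum>i<k. 1 / of_nat k * delta (W i) x * (if j = i then of_nat k else 0))"
    by (intro sum.cong HOL.refl) (simp only: sum_distrib_left[symmetric] root_orthogonal assms lessThan_iff)
  also have "\<dots> = delta (W j) x"
    using assms k0 by (simp add: if_distrib cong: if_cong)
  finally show ?thesis ..
qed

definition elt :: "(nat \<Rightarrow> complex) \<Rightarrow> complex \<Rightarrow> (int + int) list set \<Rightarrow> complex" where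
  "elt a b = (\<lambda>x. (\<Sum>l<k. a l * P l x) + b * delta V x)"

text \<open>
  Parametrizes \<open>NCP(k)\<close> by the coefficients with respect to the spectral projections and \<open>v\<close>.
\<close>

definition E :: "(nat \<Rightarrow> complex) \<Rightarrow> complex \<Rightarrow> (nat \<Rightarrow> (int + int) list set \<Rightarrow> complex) set" where
  "E a b = FG.lim_cls (\<lambda>_. elt a b)"

lemma elt_closed: "elt a b \<in> carrier GA"
  unfolding elt_def by (intro FG.ga_add_closed FG.ga_sum_closed FG.ga_smult_closed P_closed dV)

lemmas elt_cauchy = FG.const_cauchy[OF elt_closed]

lemma E_closed: "E a b \<in> carrier CA"
  unfolding E_def by (rule FG.lim_cls_closed[OF elt_cauchy])

lemma E_cong: "(\<And>l. l < k \<Longrightarrow> a l = a' l) \<Longrightarrow> E a b = E a' b"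
  by (simp add: E_def elt_def)

lemma E_add: "E a b \<oplus>\<^bsub>CA\<^esub> E a' b' = E (\<lambda>l. a l + a' l) (b + b')"
proof -
  have "(\<lambda>x. elt a b x + elt a' b' x) = elt (\<lambda>l. a l + a' l) (b + b')"
    by (simp add: elt_def distrib_right sum.distrib add_ac fun_eq_iff)
  then show ?thesis
    unfolding E_def FG.cstar_add[OF elt_cauchy elt_cauchy] by simp
qed

lemma E_smult: "c \<odot>\<^bsub>CA\<^esub> E a b = E (\<lambda>l. c * a l) (c * b)"
proof -
  have "(\<lambda>x. c * elt a b x) = elt (\<lambda>l. c * a l) (c * b)"
    by (simp add: elt_def distrib_left sum_distrib_left mult.assoc fun_eq_iff)
  then show ?thesis
    unfolding E_def FG.cstar_smult[OF elt_cauchy] by simp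
qed

lemma E_zero: "\<zero>\<^bsub>CA\<^esub> = E (\<lambda>_. 0) 0"
  by (simp add: FG.cstar_zero E_def elt_def)

lemma E_star: "star CA (E a b) = E (\<lambda>l. cnj (a l)) (cnj b)"
proof -
  have "star GA (elt a b) = elt (\<lambda>l. cnj (a l)) (cnj b)"
    unfolding elt_def FG.ga_star_add FG.ga_star_sum FG.ga_star_smult P_star FG.star_delta[OF V_closed] inv_V ..
  then show ?thesis
    unfolding E_def FG.cstar_star[OF elt_cauchy] by simp
qed

lemma E_delta_W: "j < k \<Longrightarrow> FG.lim_cls (\<lambda>_. delta (W j)) = E (\<lambda>l. unity_root k l ^ j) 0"
  unfolding E_def by (rule arg_cong[of _ _ "\<lambda>a. FG.lim_cls (\<lambda>_. a)"]) (auto simp: elt_def delta_W_P)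

lemma E_V: "NCP_v k = E (\<lambda>_. 0) 1"
  by (simp add: NCP_v_def FG.canonical_unitary_delta V_def[symmetric] E_def elt_def)

lemma NCP_w_pow: "NCP_w k [^]\<^bsub>CA\<^esub> (j :: nat) = FG.lim_cls (\<lambda>_. delta (W j))"
proof (induction j)
  case 0
  then show ?case by (simp add: FG.cstar_one W_0)
next
  case (Suc j)
  have "NCP_w k = FG.lim_cls (\<lambda>_. delta (W 1))"
    using k2 by (simp add: NCP_w_def FG.canonical_unitary_delta W_def)
  then show ?case
    using Suc by (simp add: FG.cstar_mult FG.const_cauchy dW FG.delta_mult W_closed W_mult)
qed

lemma NCP_generators:
  "{NCP_w k [^]\<^bsub>CA\<^esub> j | j::nat. j < k} \<union> {NCP_v k}
    = {E (\<lambda>l. unity_root k l ^ j) 0 | j. j < k} \<union> {E (\<lambda>_. 0) 1}"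
proof -
  have "(x = NCP_w k [^]\<^bsub>CA\<^esub> j \<and> j < k) = (x = E (\<lambda>l. unity_root k l ^ j) 0 \<and> j < k)" for x and j :: nat
    by (cases "j < k") (simp_all add: NCP_w_pow E_delta_W)
  then show ?thesis by (simp only: E_V)
qed

text \<open>
  The powers of \<open>w\<close> and the spectral projections are Fourier transforms of each other, so they have the
  same span.
\<close>

lemma NCP_carrier: "carrier (NCP k) = {E a b | a b. True}"
proof -
  interpret M: Module.module "class_ring :: complex ring" CA by (rule FG.cstar_module)
  let ?B = "{E (\<lambda>l. unity_root k l ^ j) 0 | j. j < k} \<union> {E (\<lambda>_. 0) 1}"
  let ?E = "{E a b | a b. True}"
  have carr: "carrier (NCP k) = M.span ?B"
    by (simp only: NCP_def subsystem_def opsys.select_convs partial_object.select_convs NCP_generators)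
  have B: "?B \<subseteq> carrier CA" by (auto intro: E_closed)
  have sub: "submodule class_ring ?E CA"
  proof (rule submodule.intro[OF FG.cstar_module])
    show "?E \<subseteq> carrier CA" by (auto simp: E_closed)
    show "v \<oplus>\<^bsub>CA\<^esub> w \<in> ?E" if "v \<in> ?E" "w \<in> ?E" for v w
      using that E_add by blast
    show "\<zero>\<^bsub>CA\<^esub> \<in> ?E" using E_zero by blast
    show "c \<odot>\<^bsub>CA\<^esub> v \<in> ?E" if "v \<in> ?E" for c v
      using that E_smult by blast
  qed
  have "M.span ?B \<subseteq> ?E" by (rule M.span_is_subset[OF _ sub]) auto
  moreover have "?E \<subseteq> M.span ?B"
  proof -
    interpret S: submodule class_ring "M.span ?B" CA by (rule M.span_is_submodule[OF B])
    have gen: "E (\<lambda>l. unity_root k l ^ j) 0 \<in> M.span ?B" if "j < k" for j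
      using M.in_own_span[OF B] that by blast
    have genV: "E (\<lambda>_. 0) 1 \<in> M.span ?B" using M.in_own_span[OF B] by blast
    have sums: "E (\<lambda>l. \<Sum>j<n. c j * unity_root k l ^ j) 0 \<in> M.span ?B" if "n \<le> k" for n c
      using that
    proof (induction n)
      case 0
      then show ?case using S.zero_closed by (simp add: E_zero)
    next
      case (Suc n)
      have "E (\<lambda>l. \<Sum>j<n. c j * unity_root k l ^ j) 0 \<oplus>\<^bsub>CA\<^esub> c n \<odot>\<^bsub>CA\<^esub> E (\<lambda>l. unity_root k l ^ n) 0 \<in> M.span ?B"
        using Suc by (intro S.m_closed S.smult_closed gen) auto
      then show ?case by (simp add: E_add E_smult)
    qed
    have "E a b \<in> M.span ?B" for a b
    proof -
      \<comment> \<open>The coefficients of \<open>E a 0\<close> with respect to the powers of \<open>w\<close>.\<close>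
      define c where "c j = (\<Sum>m<k. a m * (1 / of_nat k * cnj (unity_root k m) ^ j))" for j
      have "(\<Sum>j<k. c j * unity_root k l ^ j) = a l" if "l < k" for l
      proof -
        have "(\<Sum>j<k. c j * unity_root k l ^ j)
            = (\<Sum>j<k. \<Sum>m<k. a m / of_nat k * (unity_root k l ^ j * cnj (unity_root k m) ^ j))"
          by (simp add: c_def sum_distrib_left sum_distrib_right mult_ac)
        also have "\<dots> = (\<Sum>m<k. \<Sum>j<k. a m / of_nat k * (unity_root k l ^ j * cnj (unity_root k m) ^ j))"
          by (rule sum.swap)
        also have "\<dots> = (\<Sum>m<k. a m / of_nat k * (if l = m then of_nat k else 0))"
          by (intro sum.cong HOL.refl) (simp only: sum_distrib_left[symmetric] root_orthogonal that lessThan_iff)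
        also have "\<dots> = a l" using that k0 by (simp add: if_distrib cong: if_cong)
        finally show ?thesis .
      qed
      then have "E (\<lambda>l. \<Sum>j<k. c j * unity_root k l ^ j) 0 \<oplus>\<^bsub>CA\<^esub> b \<odot>\<^bsub>CA\<^esub> E (\<lambda>_. 0) 1 = E a b"
        unfolding E_add E_smult by (simp, intro E_cong) simp
      moreover have "E (\<lambda>l. \<Sum>j<k. c j * unity_root k l ^ j) 0 \<oplus>\<^bsub>CA\<^esub> b \<odot>\<^bsub>CA\<^esub> E (\<lambda>_. 0) 1 \<in> M.span ?B"
        by (intro S.m_closed S.smult_closed sums genV) auto
      ultimately show ?thesis by simp
    qed
    then show ?thesis by auto
  qed
  ultimately show ?thesis using carr by auto
qed

lemma NCP_simps:
  "add (NCP k) = add CA" "zero (NCP k) = zero CA" "module.smult (NCP k) = module.smult CA"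
  "star (NCP k) = star CA" "order_unit (NCP k) = \<one>\<^bsub>CA\<^esub>"
  by (simp_all add: NCP_def subsystem_def)

lemma NCP_cone: "X \<in> mcone (NCP k) n \<longleftrightarrow>
    X \<in> positive_elements (mat_space n CA) \<and> elements_mat X \<subseteq> carrier (NCP k)"
  by (simp add: NCP_def subsystem_def)

end

section \<open>Representations of \<open>\<int>\<^sub>k * \<int>\<^sub>2\<close>\<close>

text \<open>
  Here \<open>w\<close> acts diagonally, with eigenvalue \<open>unity_root k (\<mu> i)\<close> on the basis vector \<open>i\<close>, and \<open>v\<close> acts
  by a unitary involution \<open>T\<close> that is unrelated to this basis.
\<close>

locale ncp_rep = ncp +
  fixes I :: "'i set" and \<mu> :: "'i \<Rightarrow> nat" and T :: "('i \<Rightarrow> complex) \<Rightarrow> ('i \<Rightarrow> complex)"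
  assumes finI: "finite I"
    and lin_T: "lin_op T" and T_T: "T (T f) = f" and T_ip: "ip I (T f) (T g) = ip I f g"
    and mu: "\<mu> i < k"
begin

definition act_w :: "int \<Rightarrow> ('i \<Rightarrow> complex) \<Rightarrow> ('i \<Rightarrow> complex)" where
  "act_w g f = (\<lambda>i. unity_root k (\<mu> i) ^ nat g * f i)"

definition act_v :: "int \<Rightarrow> ('i \<Rightarrow> complex) \<Rightarrow> ('i \<Rightarrow> complex)" where
  "act_v h f = (if h = 0 then f else T f)"

lemma root_power_mod: "unity_root k l ^ (n mod k) = unity_root k l ^ n"
proof -
  have "unity_root k l ^ n = unity_root k l ^ (n mod k + k * (n div k))" by simp
  also have "\<dots> = unity_root k l ^ (n mod k)"
    by (simp only: power_add power_mult root_power_k[OF k0] power_one mult_1_right)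
  finally show ?thesis ..
qed

sublocale A: free_product_action Zk Z2 act_w act_v
proof unfold_locales
  fix g g' f assume "g \<in> carrier Zk" "g' \<in> carrier Zk"
  then have g: "0 \<le> g" "0 \<le> g'" using k0 by (simp_all add: carrier_integer_mod_group)
  have "nat ((g + g') mod int k) = (nat g + nat g') mod k"
    using g by (simp add: nat_mod_distrib nat_add_distrib)
  then show "act_w (g \<otimes>\<^bsub>Zk\<^esub> g') f = act_w g (act_w g' f)"
    by (simp add: act_w_def root_power_mod power_add mult.assoc)
next
  fix h h' f assume "h \<in> carrier Z2" "h' \<in> carrier Z2"
  then have "h = 0 \<or> h = 1" "h' = 0 \<or> h' = 1" by (auto simp: carrier_integer_mod_group)
  then show "act_v (h \<otimes>\<^bsub>Z2\<^esub> h') f = act_v h (act_v h' f)"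
    by (auto simp: act_v_def T_T)
qed (simp_all add: act_w_def act_v_def)

lemma act_w_ip: "ip I (act_w g f) (act_w g f') = ip I f f'"
  unfolding ip_def act_w_def
proof (intro sum.cong HOL.refl)
  fix i
  have "cnj (unity_root k (\<mu> i) ^ nat g) * unity_root k (\<mu> i) ^ nat g = 1"
    by (simp only: complex_cnj_power power_mult_distrib[symmetric] root_cnj power_one)
  then have "cnj (f i) * f' i * (cnj (unity_root k (\<mu> i) ^ nat g) * unity_root k (\<mu> i) ^ nat g)
      = cnj (f i) * f' i" by (simp only: mult_1_right)
  then show "cnj (unity_root k (\<mu> i) ^ nat g * f i) * (unity_root k (\<mu> i) ^ nat g * f' i) = cnj (f i) * f' i"
    by (simp only: complex_cnj_mult mult_ac)
qed

sublocale U: unitary_rep FG I A.act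
proof unfold_locales
  show "finite I" by (rule finI)
  show "lin_op (A.act g)" if "g \<in> carrier FG" for g
    using that
  proof (rule A.act_induct)
    show "lin_op (\<lambda>f :: 'i \<Rightarrow> complex. f)" by (simp add: lin_op_def)
    show "lin_op (\<lambda>f. act_w h (p f))" if "lin_op p" for h p
      unfolding lin_op_def act_w_def lin_opD[OF that] by (simp add: distrib_left mult_ac)
    show "lin_op (\<lambda>f. act_v h (p f))" if "lin_op p" for h p
      unfolding lin_op_def act_v_def lin_opD[OF that] by (simp add: lin_opD[OF lin_T])
  qed
  show "A.act (g \<otimes>\<^bsub>FG\<^esub> h) f = A.act g (A.act h f)"
    if "g \<in> carrier FG" "h \<in> carrier FG" for g h f
    using that by (rule A.act_mult)
  show "A.act \<one>\<^bsub>FG\<^esub> f = f" for f by (rule A.act_one)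
  show "ip I (A.act g f) (A.act g f') = ip I f f'" if "g \<in> carrier FG" for g f f'
    using A.act_induct[OF that, of "\<lambda>p. \<forall>f f'. ip I (p f) (p f') = ip I f f'"]
    by (auto simp: act_w_ip act_v_def T_ip)
qed

lemma act_W: "A.act (W j) f = (\<lambda>i. unity_root k (\<mu> i) ^ j * f i)"
  unfolding W_def A.act_free_inl[OF mod_closed] act_w_def by (simp add: root_power_mod)

lemma act_V: "A.act V f = T f"
  unfolding V_def A.act_free_inr[OF one_closed] act_v_def by simp

lemma rep_combination:
  assumes "\<And>j. b j \<in> carrier GA"
  shows "U.rep (\<lambda>x. \<Sum>j<n. c j * b j x) f i = (\<Sum>j<n. c j * U.rep (b j) f i)"
  by (simp only: U.rep_sum FG.ga_smult_closed assms U.rep_smult)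

lemma rep_P: "U.rep (P l) f = (\<lambda>i. if \<mu> i = l then f i else 0)" if "l < k"
proof
  fix i
  have "U.rep (P l) f i = (\<Sum>j<k. 1 / of_nat k * cnj (unity_root k l) ^ j * (unity_root k (\<mu> i) ^ j * f i))"
    unfolding P_def rep_combination[OF dW] U.rep_delta act_W ..
  also have "\<dots> = 1 / of_nat k * f i * (\<Sum>j<k. unity_root k (\<mu> i) ^ j * cnj (unity_root k l) ^ j)"
    unfolding sum_distrib_left by (intro sum.cong HOL.refl) (simp only: mult_ac)
  also have "\<dots> = (if \<mu> i = l then f i else 0)"
    unfolding root_orthogonal[OF mu that] using k0 by simp
  finally show "U.rep (P l) f i = (if \<mu> i = l then f i else 0)" .
qed

lemma rep_elt: "U.rep (elt a b) f = (\<lambda>i. a (\<mu> i) * f i + b * T f i)"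
proof
  fix i
  have "U.rep (elt a b) f i = (\<Sum>l<k. a l * U.rep (P l) f i) + b * T f i"
    unfolding elt_def
      U.rep_add[OF FG.ga_sum_closed[OF FG.ga_smult_closed[OF P_closed]] FG.ga_smult_closed[OF dV]]
      rep_combination[OF P_closed] U.rep_smult[OF dV] U.rep_delta act_V ..
  also have "(\<Sum>l<k. a l * U.rep (P l) f i) = (\<Sum>l<k. if \<mu> i = l then a l * f i else 0)"
    by (intro sum.cong HOL.refl) (simp add: rep_P)
  also have "\<dots> = a (\<mu> i) * f i" using mu[of i] by simp
  finally show "U.rep (elt a b) f i = a (\<mu> i) * f i + b * T f i" .
qed

lemma coeff_E: "U.coeff f h (E a b) = (\<Sum>i\<in>I. a (\<mu> i) * (cnj (f i) * h i)) + b * ip I f (T h)"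
  unfolding E_def U.coeff_const[OF elt_closed] rep_elt ip_add_right ip_smult_right
  by (simp add: ip_def mult_ac)

end

context ncp
begin

text \<open>
  The character \<open>w \<mapsto> unity_root k l\<close>, \<open>v \<mapsto> s\<close> with \<open>s = \<plusminus>1\<close> takes the value \<open>a l + s b\<close> at \<open>E a b\<close>.
\<close>

lemma E_eqD:
  assumes "E a b = E a' b'" "l < k"
  shows "a l = a' l" "b = b'"
proof -
  have char: "a l + s * b = a' l + s * b'" if s: "s = 1 \<or> s = (-1 :: complex)" for s
  proof -
    interpret R: ncp_rep k "{()}" "\<lambda>_. l" "\<lambda>f i. s * f i"
      by unfold_locales (use s assms(2) in \<open>auto simp: ip_def lin_op_def distrib_left mult_ac\<close>)
    have "R.U.coeff (\<lambda>_. 1) (\<lambda>_. 1) (E a b) = R.U.coeff (\<lambda>_. 1) (\<lambda>_. 1) (E a' b')"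
      using assms(1) by (simp only:)
    then show ?thesis
      unfolding R.coeff_E by (simp add: ip_def mult.commute)
  qed
  have "a l + b = a' l + b'" "a l - b = a' l - b'" using char[of 1] char[of "-1"] by simp_all
  then show "a l = a' l" "b = b'" by (auto simp: complex_eq_iff)
qed

definition coordA :: "(nat \<Rightarrow> (int + int) list set \<Rightarrow> complex) set \<Rightarrow> nat \<Rightarrow> complex" where
  "coordA x = (SOME a. \<exists>b. x = E a b)"

definition coordB :: "(nat \<Rightarrow> (int + int) list set \<Rightarrow> complex) set \<Rightarrow> complex" where
  "coordB x = (SOME b. \<exists>a. x = E a b)"

lemma coord_E: "l < k \<Longrightarrow> coordA (E a b) l = a l" "coordB (E a b) = b"
proof -
  have "\<exists>b'. E a b = E (coordA (E a b)) b'"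
    unfolding coordA_def by (rule someI[of _ a]) blast
  then show "l < k \<Longrightarrow> coordA (E a b) l = a l" using E_eqD(1) by metis
  have "\<exists>a'. E a b = E a' (coordB (E a b))"
    unfolding coordB_def by (rule someI[of _ b]) blast
  then show "coordB (E a b) = b" using E_eqD(2) k0 by metis
qed

section \<open>The dual of \<open>NCP(k)\<close>\<close>

abbreviation "D \<equiv> LinearCombinations.module_hom (class_ring :: complex ring) (NCP k) complex_alg
  \<inter> extensional (carrier (NCP k))"

text \<open>
  The projections at which functionals are evaluated: the spectral projections of \<open>w\<close>, then
  \<open>(1 + v) / 2\<close> at index \<open>k\<close> and \<open>(1 - v) / 2\<close> at index \<open>k + 1\<close>.  The constant coefficients \<open>1 / 2\<close>
  stand for half the identity.
\<close>

definition proj :: "nat \<Rightarrow> (nat \<Rightarrow> (int + int) list set \<Rightarrow> complex) set" where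
  "proj l = (if l < k then E (\<lambda>i. if i = l then 1 else 0) 0
     else E (\<lambda>_. 1 / 2) (if l = k then 1 / 2 else - 1 / 2))"

text \<open>
  For \<open>z\<close> in \<open>S_carrier k\<close> this is the functional with values \<open>z $ l\<close> at the projections, see
  \<open>functional_proj\<close>; the last term contains its value \<open>z $ k - z $ (k + 1)\<close> at \<open>v\<close>.
\<close>

definition functional :: "complex vec \<Rightarrow> (nat \<Rightarrow> (int + int) list set \<Rightarrow> complex) set \<Rightarrow> complex" where
  "functional z = (\<lambda>x\<in>carrier (NCP k). (\<Sum>l<k. z $ l * coordA x l) + (z $ k - z $ (k + 1)) * coordB x)"

lemma E_in_NCP: "E a b \<in> carrier (NCP k)"
  by (auto simp: NCP_carrier)

lemma NCP_cases:
  assumes "x \<in> carrier (NCP k)"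
  obtains a b where "x = E a b"
  using assms by (auto simp: NCP_carrier)

lemma functional_E: "functional z (E a b) = (\<Sum>l<k. z $ l * a l) + (z $ k - z $ (k + 1)) * b"
  by (simp add: functional_def E_in_NCP coord_E)

lemma complex_alg_simps: "carrier complex_alg = UNIV" "add complex_alg = (+)" "module.smult complex_alg = (*)"
  by (simp_all add: complex_alg_def)

lemma D_iff: "f \<in> D \<longleftrightarrow> f \<in> extensional (carrier (NCP k)) \<and>
    (\<forall>a b a' b'. f (E (\<lambda>l. a l + a' l) (b + b')) = f (E a b) + f (E a' b')) \<and>
    (\<forall>c a b. f (E (\<lambda>l. c * a l) (c * b)) = c * f (E a b))"
proof -
  have "f \<in> LinearCombinations.module_hom (class_ring :: complex ring) (NCP k) complex_alg \<longleftrightarrow>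
    (\<forall>x y. x \<in> carrier (NCP k) \<and> y \<in> carrier (NCP k) \<longrightarrow> f (x \<oplus>\<^bsub>CA\<^esub> y) = f x + f y) \<and>
    (\<forall>c x. x \<in> carrier (NCP k) \<longrightarrow> f (c \<odot>\<^bsub>CA\<^esub> x) = c * f x)"
    by (simp add: LinearCombinations.module_hom_def NCP_simps complex_alg_simps)
  also have "\<dots> \<longleftrightarrow>
    (\<forall>a b a' b'. f (E a b \<oplus>\<^bsub>CA\<^esub> E a' b') = f (E a b) + f (E a' b')) \<and>
    (\<forall>c a b. f (c \<odot>\<^bsub>CA\<^esub> E a b) = c * f (E a b))"
    unfolding NCP_carrier by blast
  finally show ?thesis by (simp only: E_add E_smult Int_iff) blast
qed

lemma functional_D: "functional z \<in> D"
  unfolding D_iff functional_E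
  by (auto simp: functional_def algebra_simps sum.distrib sum_distrib_left)

lemma D_sum:
  assumes f: "f \<in> D"
  shows "f (E a b) = (\<Sum>l<k. a l * f (proj l)) + b * (f (proj k) - f (proj (k + 1)))"
proof -
  have add: "f (E (\<lambda>l. a l + a' l) (b + b')) = f (E a b) + f (E a' b')" for a b a' b'
    using f unfolding D_iff by blast
  have smult: "f (E (\<lambda>l. c * a l) (c * b)) = c * f (E a b)" for c a b
    using f unfolding D_iff by blast
  have zero: "f (E (\<lambda>_. 0) 0) = 0" using smult[of 0 "\<lambda>_. 0" 0] by simp
  have partial: "f (E (\<lambda>l. if l < n then a l else 0) 0) = (\<Sum>l<n. a l * f (proj l))" if "n \<le> k" for n
    using that
  proof (induction n)
    case 0
    then show ?case by (simp add: zero)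
  next
    case (Suc n)
    have "(\<lambda>l. (if l < n then a l else 0) + a n * (if l = n then 1 else 0))
        = (\<lambda>l. if l < Suc n then a l else 0)" by (auto simp: less_Suc_eq)
    then have "f (E (\<lambda>l. if l < Suc n then a l else 0) 0)
        = f (E (\<lambda>l. if l < n then a l else 0) 0) + a n * f (E (\<lambda>l. if l = n then 1 else 0) 0)"
      using add[of "\<lambda>l. if l < n then a l else 0" "\<lambda>l. a n * (if l = n then 1 else 0)" 0 "a n * 0"]
        smult[of "a n" "\<lambda>l. if l = n then 1 else 0" 0] by simp
    then show ?case using Suc by (simp add: proj_def)
  qed
  have "f (proj k) = f (E (\<lambda>_. 0) 1) + f (proj (k + 1))"
    using add[of "\<lambda>_. 0" "\<lambda>_. 1 / 2" 1 "- 1 / 2"] by (simp add: proj_def)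
  then have v: "f (E (\<lambda>_. 0) 1) = f (proj k) - f (proj (k + 1))" by simp
  have "f (E a b) = f (E a 0) + f (E (\<lambda>_. 0) b)"
    using add[of a "\<lambda>_. 0" 0 b] by simp
  also have "E a 0 = E (\<lambda>l. if l < k then a l else 0) 0" by (rule E_cong) simp
  also have "f (E (\<lambda>_. 0) b) = b * f (E (\<lambda>_. 0) 1)" using smult[of b "\<lambda>_. 0" 1] by simp
  finally show ?thesis by (simp only: partial[OF order_refl] v)
qed

text \<open>
  Both sides are the value of \<open>f\<close> at the identity.
\<close>

lemma D_constraint:
  assumes f: "f \<in> D"
  shows "(\<Sum>l<k. f (proj l)) = f (proj k) + f (proj (k + 1))"
proof -
  have "f (E (\<lambda>l. a l + a' l) (b + b')) = f (E a b) + f (E a' b')" for a b a' b'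
    using f unfolding D_iff by blast
  from this[of "\<lambda>_. 1 / 2" "\<lambda>_. 1 / 2" "1 / 2" "- 1 / 2"] have "f (E (\<lambda>_. 1) 0) = f (proj k) + f (proj (k + 1))" by (simp add: proj_def)
  then show ?thesis using D_sum[OF f, of "\<lambda>_. 1" 0] by simp
qed

lemma D_eqI:
  assumes "f \<in> D" "g \<in> D" "\<And>l. l < k + 2 \<Longrightarrow> f (proj l) = g (proj l)"
  shows "f = g"
proof (rule extensionalityI[of _ "carrier (NCP k)"])
  fix x assume "x \<in> carrier (NCP k)"
  then obtain a b where x: "x = E a b" by (rule NCP_cases)
  show "f x = g x" unfolding x D_sum[OF assms(1)] D_sum[OF assms(2)] by (simp add: assms(3))
qed (use assms in auto)

lemma functional_proj:
  assumes "z \<in> S_carrier k" "l < k + 2"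
  shows "functional z (proj l) = z $ l"
proof -
  consider "l < k" | "l = k" | "l = k + 1" using assms(2) by linarith
  then show ?thesis
  proof cases
    case 1
    then show ?thesis by (simp add: proj_def functional_E if_distrib cong: if_cong)
  next
    case 2
    have "(\<Sum>l<k. z $ l * (1 / 2)) = (z $ k + z $ (k + 1)) * (1 / 2)"
      using assms(1) by (simp add: S_carrier_def flip: sum_distrib_right sum_divide_distrib)
    then show ?thesis using 2 unfolding proj_def by (simp add: functional_E field_simps)
  next
    case 3
    have "(\<Sum>l<k. z $ l * (1 / 2)) = (z $ k + z $ (k + 1)) * (1 / 2)"
      using assms(1) by (simp add: S_carrier_def flip: sum_distrib_right sum_divide_distrib)
    then show ?thesis using 3 unfolding proj_def by (simp add: functional_E field_simps)
  qed
qed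

lemma proj_in_NCP: "proj l \<in> carrier (NCP k)"
  by (simp add: proj_def E_in_NCP)

lemma star_proj: "star CA (proj l) = proj l"
  by (auto simp: proj_def E_star intro!: E_cong arg_cong2[of _ _ _ _ E])

lemma proj_idem: "proj l \<otimes>\<^bsub>CA\<^esub> proj l = proj l"
proof (cases "l < k")
  case True
  have "elt (\<lambda>i. if i = l then 1 else 0) 0 = P l"
    using True by (auto simp: elt_def if_distrib[of "\<lambda>c. c * _"] cong: if_cong)
  then have "proj l = FG.lim_cls (\<lambda>_. P l)" using True by (simp add: proj_def E_def)
  then show ?thesis
    by (simp add: FG.cstar_mult FG.const_cauchy P_closed P_idem)
next
  case False
  define s :: complex where "s = (if l = k then 1 else - 1)"
  have s: "s * s = 1" by (simp add: s_def)
  define c where "c = (\<lambda>x. 1 / 2 * delta (W 0) x + s / 2 * delta V x)"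
  note d = FG.ga_smult_closed[OF dW] FG.ga_smult_closed[OF dV]
  have c: "c \<in> carrier GA" unfolding c_def by (intro FG.ga_add_closed d)
  have "elt (\<lambda>_. 1 / 2) (s / 2) = c"
    unfolding elt_def c_def delta_W_P[OF k0] by (simp add: sum_divide_distrib)
  moreover have "proj l = E (\<lambda>_. 1 / 2) (s / 2)" using False by (simp add: proj_def s_def)
  ultimately have p: "proj l = FG.lim_cls (\<lambda>_. c)" by (simp only: E_def)
  have W0: "W 0 \<otimes>\<^bsub>FG\<^esub> W 0 = W 0" "W 0 \<otimes>\<^bsub>FG\<^esub> V = V" "V \<otimes>\<^bsub>FG\<^esub> W 0 = V" "V \<otimes>\<^bsub>FG\<^esub> V = W 0"
    using V_closed W_closed by (simp_all add: W_0 V_mult)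
  have "c \<otimes>\<^bsub>GA\<^esub> c = c"
  proof
    fix x
    have "(c \<otimes>\<^bsub>GA\<^esub> c) x = 1 / 2 * (1 / 2 * delta (W 0) x + s / 2 * delta V x)
        + s / 2 * (1 / 2 * delta V x + s / 2 * delta (W 0) x)"
      unfolding c_def
      by (simp only: FG.ga_mult_add_left[OF d] FG.ga_mult_smult_left[OF dW] FG.ga_mult_smult_left[OF dV]
          FG.ga_mult_add_right FG.ga_mult_smult_right FG.delta_mult W_closed V_closed W0)
    also have "\<dots> = (1 / 4 + s * s / 4) * delta (W 0) x + s / 2 * delta V x"
      by (simp add: algebra_simps)
    finally show "(c \<otimes>\<^bsub>GA\<^esub> c) x = c x" by (simp add: s c_def)
  qed
  then show ?thesis
    unfolding p by (simp add: FG.cstar_mult FG.const_cauchy c)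
qed

lemma proj_positive: "mat 1 1 (\<lambda>_. proj l) \<in> mcone (NCP k) 1"
proof -
  interpret M: Module.module "class_ring :: complex ring" CA by (rule FG.cstar_module)
  let ?X = "mat 1 1 (\<lambda>_. proj l)"
  have p: "proj l \<in> carrier CA" by (simp add: proj_def E_closed)
  have "finsum CA (\<lambda>m. star CA (?X $$ (m, 0)) \<otimes>\<^bsub>CA\<^esub> ?X $$ (m, 0)) {..<1} = proj l"
    using p by (simp add: lessThan_Suc star_proj proj_idem)
  then have "?X = mat 1 1 (\<lambda>(i, j). finsum CA (\<lambda>m. star CA (?X $$ (m, i)) \<otimes>\<^bsub>CA\<^esub> ?X $$ (m, j)) {..<1})"
    by (intro eq_matI) auto
  moreover have "?X \<in> carrier (mat_space 1 CA)" using p by (simp add: mat_space_carrier)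
  ultimately have "?X \<in> positive_elements (mat_space 1 CA)"
    unfolding positive_elements_mat_space by blast
  moreover have "elements_mat ?X \<subseteq> carrier (NCP k)"
    by (auto simp: elements_mat_def proj_in_NCP)
  ultimately show ?thesis by (simp add: NCP_cone)
qed

end

section \<open>Positive matrices of functionals\<close>

lemma module_homI:
  assumes "\<And>x. x \<in> carrier V \<Longrightarrow> f x \<in> carrier W"
    and "\<And>x y. x \<in> carrier V \<Longrightarrow> y \<in> carrier V \<Longrightarrow> f (x \<oplus>\<^bsub>V\<^esub> y) = f x \<oplus>\<^bsub>W\<^esub> f y"
    and "\<And>c x. x \<in> carrier V \<Longrightarrow> f (c \<odot>\<^bsub>V\<^esub> x) = c \<odot>\<^bsub>W\<^esub> f x"
  shows "f \<in> LinearCombinations.module_hom (class_ring :: complex ring) V W"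
  using assms by (auto simp: LinearCombinations.module_hom_def)

lemma psd_pullback:
  assumes "finite I" "psd I M" "\<And>j. j \<in> J \<Longrightarrow> h j \<in> I"
  shows "psd J (\<lambda>i j. M (h i) (h j))"
proof -
  obtain Y where Y: "\<forall>i\<in>I. \<forall>j\<in>I. M i j = (\<Sum>l\<in>I. cnj (Y l i) * Y l j)"
    using psd_gram_factorization[OF assms(1,2)] by blast
  show ?thesis
    by (rule gram_psd[where L = I and Y = "\<lambda>l j. Y l (h j)"]) (use Y assms(3) in blast)
qed

lemma lin_op_sum:
  assumes "lin_op U"
  shows "U (\<lambda>i. \<Sum>j<(n::nat). c j * f j i) = (\<lambda>i. \<Sum>j<n. c j * U (f j) i)"
proof (induction n)
  case 0
  then show ?case using lin_op_smult[OF assms, of 0 "\<lambda>_. 0"] by simp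
next
  case (Suc n)
  then show ?case
    using lin_op_add[OF assms, of "\<lambda>i. \<Sum>j<n. c j * f j i" "\<lambda>i. c n * f n i"]
    by (simp add: lin_op_smult[OF assms])
qed

lemma sum_pairs: "(\<Sum>p\<in>A \<times> B. f p) = (\<Sum>a\<in>A. \<Sum>b\<in>B. f (a, b))"
  by (simp add: sum.cartesian_product)

context ncp_rep
begin

lemma coeff_E_combination:
  "U.coeff (\<lambda>\<iota>. \<Sum>i<q. c i * f i \<iota>) (\<lambda>\<iota>. \<Sum>j<r. d j * h j \<iota>) (E a b)
    = (\<Sum>i<q. \<Sum>j<r. cnj (c i) * U.coeff (f i) (h j) (E a b) * d j)" for q r :: nat
  unfolding E_def U.coeff_const[OF elt_closed] lin_op_sum[OF U.lin_rep[OF elt_closed]]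
    ip_sum_left ip_sum_right ip_smult_left ip_smult_right
  by (intro sum.cong HOL.refl) (simp only: mult_ac)

end

context ncp
begin

lemma D_hom:
  assumes "f \<in> D" "x \<in> carrier (NCP k)" "y \<in> carrier (NCP k)"
  shows "f (x \<oplus>\<^bsub>NCP k\<^esub> y) = f x + f y" "f (c \<odot>\<^bsub>NCP k\<^esub> x) = c * f x"
  using assms by (auto simp: LinearCombinations.module_hom_def complex_alg_simps)

text \<open>
  Simultaneous dilation of two positive-operator-valued measures with the same total mass, given by
  their Gram factors \<open>Y\<close>.  The hypothesis says that the vectors stacked from the \<open>Y l\<close> with \<open>l < k\<close> and
  those stacked from the last two factors have the same Gram matrix.  A unitary \<open>U\<close> between the two
  families conjugates the sign change \<open>S\<close> of the last coordinate into the involution \<open>T\<close>.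
\<close>

lemma dilation:
  fixes Y :: "nat \<Rightarrow> nat \<Rightarrow> nat \<Rightarrow> complex"
  assumes gram: "\<And>i j. i < q \<Longrightarrow> j < q \<Longrightarrow>
    (\<Sum>l<k. \<Sum>t<q. cnj (Y l t i) * Y l t j)
      = (\<Sum>t<q. cnj (Y k t i) * Y k t j) + (\<Sum>t<q. cnj (Y (k + 1) t i) * Y (k + 1) t j)"
  shows "\<exists>T. ncp_rep k ({..<q} \<times> {..<k + 2}) (\<lambda>p. if snd p < k then snd p else 0) T \<and>
    (\<forall>i<q. \<forall>j<q. ip ({..<q} \<times> {..<k + 2}) (\<lambda>(t, l). if l < k then Y l t i else 0)
        (T (\<lambda>(t, l). if l < k then Y l t j else 0))
      = (\<Sum>t<q. cnj (Y k t i) * Y k t j) - (\<Sum>t<q. cnj (Y (k + 1) t i) * Y (k + 1) t j))"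
proof -
  let ?I = "{..<q} \<times> {..<k + 2}"
  define \<xi> :: "nat \<Rightarrow> nat \<times> nat \<Rightarrow> complex" where "\<xi> j = (\<lambda>(t, l). if l < k then Y l t j else 0)" for j
  define \<eta> :: "nat \<Rightarrow> nat \<times> nat \<Rightarrow> complex" where "\<eta> j = (\<lambda>(t, l). if l < k then 0 else Y l t j)" for j
  define S :: "(nat \<times> nat \<Rightarrow> complex) \<Rightarrow> nat \<times> nat \<Rightarrow> complex"
    where "S f = (\<lambda>p. (if snd p = k + 1 then - 1 else 1) * f p)" for f
  have split: "(\<Sum>l<k + 2. g l) = (\<Sum>l<k. g l) + g k + g (k + 1)" for g :: "nat \<Rightarrow> complex"
    by (simp add: lessThan_Suc add_ac)
  have xi: "ip ?I (\<xi> i) (\<xi> j) = (\<Sum>l<k. \<Sum>t<q. cnj (Y l t i) * Y l t j)" for i j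
  proof -
    have "ip ?I (\<xi> i) (\<xi> j) = (\<Sum>t<q. \<Sum>l<k. cnj (Y l t i) * Y l t j)"
      unfolding ip_def sum_pairs split by (simp add: \<xi>_def)
    also have "\<dots> = (\<Sum>l<k. \<Sum>t<q. cnj (Y l t i) * Y l t j)" by (rule sum.swap)
    finally show ?thesis .
  qed
  have eta: "ip ?I (\<eta> i) (\<eta> j)
      = (\<Sum>t<q. cnj (Y k t i) * Y k t j) + (\<Sum>t<q. cnj (Y (k + 1) t i) * Y (k + 1) t j)" for i j
    unfolding ip_def sum_pairs split by (simp add: \<eta>_def sum.distrib)
  have eta_S: "ip ?I (\<eta> i) (S (\<eta> j))
      = (\<Sum>t<q. cnj (Y k t i) * Y k t j) - (\<Sum>t<q. cnj (Y (k + 1) t i) * Y (k + 1) t j)" for i j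
    unfolding ip_def sum_pairs split by (simp add: \<eta>_def S_def sum_subtractf)
  have "ip ?I (\<xi> i) (\<xi> j) = ip ?I (\<eta> i) (\<eta> j)" if "i < q" "j < q" for i j
    unfolding xi eta by (rule gram[OF that])
  from unitary_of_equal_gram[where I = ?I and q = q and x = \<xi> and y = \<eta>, OF _ this] obtain U U'
    where U: "unitary_pair ?I U U'" and U_xi: "\<And>j p. j < q \<Longrightarrow> p \<in> ?I \<Longrightarrow> U (\<xi> j) p = \<eta> j p" by blast
  have lin: "lin_op U" "lin_op U'" and inv: "U (U' f) = f" "U' (U f) = f"
    and adj: "ip ?I (U f) g = ip ?I f (U' g)" for f g
    using U by (simp_all add: unitary_pair_def)
  have adj': "ip ?I (U' f) g = ip ?I f (U g)" for f g
    using adj[of "U' f" "U g"] adj[of g "U' f"] inv by (metis cnj_ip)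
  have S_S: "S (S f) = f" for f by (auto simp: S_def)
  have S_ip: "ip ?I (S f) (S g) = ip ?I f g" for f g
    unfolding ip_def by (intro sum.cong HOL.refl) (simp add: S_def)
  have S_lin: "lin_op S" by (auto simp: lin_op_def S_def distrib_left mult_ac)
  let ?T = "\<lambda>f. U' (S (U f))"
  have "ncp_rep k ?I (\<lambda>p. if snd p < k then snd p else 0) ?T"
  proof unfold_locales
    show "lin_op ?T"
      unfolding lin_op_def lin_opD[OF lin(1)] lin_opD[OF S_lin] lin_opD[OF lin(2)] by blast
    show "?T (?T f) = f" for f by (simp only: inv S_S)
    show "ip ?I (?T f) (?T g) = ip ?I f g" for f g
      by (simp only: adj' inv S_ip) (simp only: adj inv)
  qed (use k0 in auto)
  moreover have "ip ?I (\<xi> i) (?T (\<xi> j))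
      = (\<Sum>t<q. cnj (Y k t i) * Y k t j) - (\<Sum>t<q. cnj (Y (k + 1) t i) * Y (k + 1) t j)"
    if "i < q" "j < q" for i j
  proof -
    have "ip ?I (\<xi> i) (?T (\<xi> j)) = ip ?I (U (\<xi> i)) (S (U (\<xi> j)))" by (simp only: adj)
    also have "\<dots> = ip ?I (\<eta> i) (S (\<eta> j))"
    proof (rule ip_cong)
      fix p assume p: "p \<in> ?I"
      show "U (\<xi> i) p = \<eta> i p" by (rule U_xi[OF that(1) p])
      show "S (U (\<xi> j)) p = S (\<eta> j) p" unfolding S_def by (simp only: U_xi[OF that(2) p])
    qed
    finally show ?thesis by (simp only: eta_S)
  qed
  ultimately show ?thesis unfolding \<xi>_def by blast
qed

text \<open>
  In the representation provided by the dilation, \<open>F $$ (i, j)\<close> is the vector functional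
  \<open>x \<mapsto> \<langle>\<xi>\<^sub>i, x \<xi>\<^sub>j\<rangle>\<close>.  The form of \<open>F(X)\<close> at \<open>c\<close> is then a sum as in \<open>coeff_positive\<close>, for the vectors
  \<open>h a = \<Sum>i. c (a, i) \<xi>\<^sub>i\<close>.
\<close>

lemma psd_of_cone:
  assumes F: "F \<in> carrier_mat q q" "\<And>i j. i < q \<Longrightarrow> j < q \<Longrightarrow> F $$ (i, j) \<in> D"
    and psd: "\<And>l. l < k + 2 \<Longrightarrow> psd {..<q} (\<lambda>i j. (F $$ (i, j)) (proj l))"
    and X: "X \<in> mcone (NCP k) n"
  shows "psd ({..<n} \<times> {..<q}) (\<lambda>p p'. (F $$ (snd p, snd p')) (X $$ (fst p, fst p')))"
proof -
  have "\<forall>l. \<exists>Z. l < k + 2 \<longrightarrow>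
      (\<forall>i\<in>{..<q}. \<forall>j\<in>{..<q}. (F $$ (i, j)) (proj l) = (\<Sum>t<q. cnj (Z t i) * Z t j))"
    using psd_gram_factorization[OF finite_lessThan psd] by blast
  then obtain Y where Y': "\<And>l. l < k + 2 \<Longrightarrow>
      (\<forall>i\<in>{..<q}. \<forall>j\<in>{..<q}. (F $$ (i, j)) (proj l) = (\<Sum>t<q. cnj (Y l t i) * Y l t j))"
    by metis
  have Y: "(\<Sum>t<q. cnj (Y l t i) * Y l t j) = (F $$ (i, j)) (proj l)" if "l < k + 2" "i < q" "j < q" for l i j
    using Y'[OF that(1)] that(2,3) by simp
  let ?I = "{..<q} \<times> {..<k + 2}"
  define \<xi> :: "nat \<Rightarrow> nat \<times> nat \<Rightarrow> complex" where "\<xi> j = (\<lambda>(t, l). if l < k then Y l t j else 0)" for j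
  \<comment> \<open>On the last two coordinates the vectors \<open>\<xi> j\<close> vanish, so any eigenvalue of \<open>w\<close> will do there.\<close>
  define \<mu> :: "nat \<times> nat \<Rightarrow> nat" where "\<mu> p = (if snd p < k then snd p else 0)" for p
  have "(\<Sum>l<k. \<Sum>t<q. cnj (Y l t i) * Y l t j)
      = (\<Sum>t<q. cnj (Y k t i) * Y k t j) + (\<Sum>t<q. cnj (Y (k + 1) t i) * Y (k + 1) t j)"
    if "i < q" "j < q" for i j
    using D_constraint[OF F(2)[OF that]] that by (simp add: Y)
  from dilation[where q = q and Y = Y, OF this] obtain T where rep: "ncp_rep k ?I \<mu> T"
    and T: "\<And>i j. i < q \<Longrightarrow> j < q \<Longrightarrow> ip ?I (\<xi> i) (T (\<xi> j)) =
      (F $$ (i, j)) (proj k) - (F $$ (i, j)) (proj (k + 1))"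
    unfolding \<xi>_def[symmetric] \<mu>_def[symmetric] using Y by auto
  interpret R: ncp_rep k ?I \<mu> T by (rule rep)
  have coeff: "R.U.coeff (\<xi> i) (\<xi> j) x = (F $$ (i, j)) x" if ij: "i < q" "j < q" and x_in: "x \<in> carrier (NCP k)" for i j x
  proof -
    obtain a b where x: "x = E a b" using x_in by (rule NCP_cases)
    have "(\<Sum>p\<in>?I. a (\<mu> p) * (cnj (\<xi> i p) * \<xi> j p)) = (\<Sum>t<q. \<Sum>l<k. a l * (cnj (Y l t i) * Y l t j))"
      unfolding sum_pairs by (simp add: \<xi>_def \<mu>_def lessThan_Suc)
    also have "\<dots> = (\<Sum>l<k. \<Sum>t<q. a l * (cnj (Y l t i) * Y l t j))"
      by (rule sum.swap)
    also have "\<dots> = (\<Sum>l<k. a l * (F $$ (i, j)) (proj l))"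
      by (simp add: Y ij flip: sum_distrib_left)
    finally show ?thesis
      unfolding x R.coeff_E T[OF ij] D_sum[OF F(2)[OF ij]] by (simp only:)
  qed
  have Xpos: "X \<in> positive_elements (mat_space n CA)" and Xel: "elements_mat X \<subseteq> carrier (NCP k)"
    using X by (simp_all add: NCP_cone)
  have "X \<in> carrier_mat n n" using Xpos unfolding positive_elements_mat_space by auto
  then have Xab: "X $$ (a, b) \<in> carrier (NCP k)" if "a < n" "b < n" for a b
    using Xel that elements_mat_subset_iff by blast
  show ?thesis
  proof (rule psdI)
    fix c :: "nat \<times> nat \<Rightarrow> complex"
    define h where "h a = (\<lambda>\<iota>. \<Sum>i<q. c (a, i) * \<xi> i \<iota>)" for a
    have h: "R.U.coeff (h a) (h b) (X $$ (a, b))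
        = (\<Sum>i<q. \<Sum>j<q. cnj (c (a, i)) * (F $$ (i, j)) (X $$ (a, b)) * c (b, j))"
      if ab: "a < n" "b < n" for a b
    proof -
      obtain \<alpha> \<beta> where x: "X $$ (a, b) = E \<alpha> \<beta>" using Xab[OF ab] by (rule NCP_cases)
      have "R.U.coeff (h a) (h b) (X $$ (a, b))
          = (\<Sum>i<q. \<Sum>j<q. cnj (c (a, i)) * R.U.coeff (\<xi> i) (\<xi> j) (X $$ (a, b)) * c (b, j))"
        unfolding h_def x by (rule R.coeff_E_combination)
      also have "\<dots> = (\<Sum>i<q. \<Sum>j<q. cnj (c (a, i)) * (F $$ (i, j)) (X $$ (a, b)) * c (b, j))"
        by (intro sum.cong HOL.refl) (simp only: coeff Xab ab lessThan_iff)
      finally show ?thesis .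
    qed
    let ?G = "\<lambda>a i b j. cnj (c (a, i)) * (F $$ (i, j)) (X $$ (a, b)) * c (b, j)"
    have "(\<Sum>p\<in>{..<n} \<times> {..<q}. \<Sum>p'\<in>{..<n} \<times> {..<q}.
        cnj (c p) * (F $$ (snd p, snd p')) (X $$ (fst p, fst p')) * c p')
      = (\<Sum>a<n. \<Sum>i<q. \<Sum>b<n. \<Sum>j<q. ?G a i b j)"
      by (simp only: sum_pairs fst_conv snd_conv)
    also have "\<dots> = (\<Sum>a<n. \<Sum>b<n. \<Sum>i<q. \<Sum>j<q. ?G a i b j)"
      by (rule sum.cong[OF HOL.refl], rule sum.swap)
    also have "\<dots> = (\<Sum>a<n. \<Sum>b<n. R.U.coeff (h a) (h b) (X $$ (a, b)))"
      by (intro sum.cong HOL.refl) (simp only: h lessThan_iff)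
    finally show "\<exists>r\<ge>0. (\<Sum>p\<in>{..<n} \<times> {..<q}. \<Sum>p'\<in>{..<n} \<times> {..<q}.
        cnj (c p) * (F $$ (snd p, snd p')) (X $$ (fst p, fst p')) * c p') = complex_of_real r"
      using R.U.coeff_positive[OF Xpos, of h] by (simp only:)
  qed
qed

lemma mat_system_simps:
  "carrier (mat_system q) = carrier_mat q q"
  "add (mat_system q) = add (mat_space q complex_alg)"
  "module.smult (mat_system q) = module.smult (mat_space q complex_alg)"
  by (simp_all add: mat_system_def Let_def subsystem_def mat_alg_simps)

text \<open>
  Necessity tests the map on the projections, which are positive in \<open>NCP(k)\<close>; sufficiency is the
  dilation argument.
\<close>

lemma completely_positive_iff:
  assumes F: "F \<in> carrier_mat q q" "\<And>i j. i < q \<Longrightarrow> j < q \<Longrightarrow> F $$ (i, j) \<in> D"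
  shows "completely_positive (NCP k) (mat_system q) (\<lambda>x. map_mat (\<lambda>f. f x) F) \<longleftrightarrow>
    (\<forall>l<k + 2. psd {..<q} (\<lambda>i j. (F $$ (i, j)) (proj l)))"
proof
  assume cp: "completely_positive (NCP k) (mat_system q) (\<lambda>x. map_mat (\<lambda>f. f x) F)"
  show "\<forall>l<k + 2. psd {..<q} (\<lambda>i j. (F $$ (i, j)) (proj l))"
  proof (intro allI impI)
    fix l
    let ?Z = "map_mat (\<lambda>x. map_mat (\<lambda>f. f x) F) (mat 1 1 (\<lambda>_. proj l))"
    have "?Z \<in> mcone (mat_system q) 1"
      using cp proj_positive unfolding completely_positive_def by blast
    then have "psd ({..<1} \<times> {..<q}) (\<lambda>p p'. ?Z $$ (fst p, fst p') $$ (snd p, snd p'))"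
      by (simp only: mat_system_cone)
    from psd_pullback[OF _ this, of "{..<q}" "\<lambda>i. (0, i)"]
    have "psd {..<q} (\<lambda>i j. ?Z $$ (0, 0) $$ (i, j))" by simp
    then show "psd {..<q} (\<lambda>i j. (F $$ (i, j)) (proj l))"
      using F(1) psd_cong[of "{..<q}" "\<lambda>i j. ?Z $$ (0, 0) $$ (i, j)" "\<lambda>i j. (F $$ (i, j)) (proj l)"]
      by simp
  qed
next
  assume psd: "\<forall>l<k + 2. psd {..<q} (\<lambda>i j. (F $$ (i, j)) (proj l))"
  show "completely_positive (NCP k) (mat_system q) (\<lambda>x. map_mat (\<lambda>f. f x) F)"
    unfolding completely_positive_def
  proof (intro conjI allI ballI)
    show "(\<lambda>x. map_mat (\<lambda>f. f x) F) \<in>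
      LinearCombinations.module_hom (class_ring :: complex ring) (NCP k) (mat_system q)"
      unfolding LinearCombinations.module_hom_def mat_system_simps
    proof (intro CollectI conjI allI impI)
      show "(\<lambda>x. map_mat (\<lambda>f. f x) F) \<in> carrier (NCP k) \<rightarrow> carrier_mat q q" using F(1) by simp
    next
      fix x y assume xy: "x \<in> carrier (NCP k) \<and> y \<in> carrier (NCP k)"
      show "map_mat (\<lambda>f. f (x \<oplus>\<^bsub>NCP k\<^esub> y)) F
          = map_mat (\<lambda>f. f x) F \<oplus>\<^bsub>mat_space q complex_alg\<^esub> map_mat (\<lambda>f. f y) F"
        using F(1) D_hom(1)[OF F(2)] xy
        by (intro eq_matI) (auto simp: mat_space_def complex_alg_simps)
    next
      fix c x assume x: "c \<in> carrier (class_ring :: complex ring) \<and> x \<in> carrier (NCP k)"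
      show "map_mat (\<lambda>f. f (c \<odot>\<^bsub>NCP k\<^esub> x)) F
          = c \<odot>\<^bsub>mat_space q complex_alg\<^esub> map_mat (\<lambda>f. f x) F"
        using F(1) D_hom(2)[OF F(2)] x
        by (intro eq_matI) (auto simp: mat_space_def complex_alg_simps)
    qed
  next
    fix n X assume X: "X \<in> mcone (NCP k) n"
    let ?Z = "map_mat (\<lambda>x. map_mat (\<lambda>f. f x) F) X"
    have Xc: "X \<in> carrier_mat n n"
      using X unfolding NCP_cone positive_elements_mat_space by auto
    have "psd ({..<n} \<times> {..<q}) (\<lambda>p p'. (F $$ (snd p, snd p')) (X $$ (fst p, fst p')))"
      by (rule psd_of_cone[OF F _ X]) (use psd in auto)
    then have "psd ({..<n} \<times> {..<q}) (\<lambda>p p'. ?Z $$ (fst p, fst p') $$ (snd p, snd p'))"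
      using Xc F(1) by (subst psd_cong) auto
    then show "?Z \<in> mcone (mat_system q) n"
      unfolding mat_system_cone using Xc F(1) by auto
  qed
qed

section \<open>The isomorphism\<close>

lemma dual_simps:
  "carrier (dual_system (NCP k) \<delta>) = D"
  "zero (dual_system (NCP k) \<delta>) = (\<lambda>x\<in>carrier (NCP k). 0)"
  "add (dual_system (NCP k) \<delta>) = (\<lambda>f g. \<lambda>x\<in>carrier (NCP k). f x + g x)"
  "module.smult (dual_system (NCP k) \<delta>) = (\<lambda>c f. \<lambda>x\<in>carrier (NCP k). c * f x)"
  "star (dual_system (NCP k) \<delta>) = (\<lambda>f. \<lambda>x\<in>carrier (NCP k). cnj (f (star CA x)))"
  "order_unit (dual_system (NCP k) \<delta>) = \<delta>"
  by (simp_all add: dual_system_def Let_def NCP_simps)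

lemma D_closed:
  assumes f: "f \<in> D"
  shows "g \<in> D \<Longrightarrow> (\<lambda>x\<in>carrier (NCP k). f x + g x) \<in> D"
    and "(\<lambda>x\<in>carrier (NCP k). c * f x) \<in> D"
    and "(\<lambda>x\<in>carrier (NCP k). cnj (f (star CA x))) \<in> D"
    and "(\<lambda>x\<in>carrier (NCP k). 0) \<in> D"
proof -
  have add: "f (E (\<lambda>l. a l + a' l) (b + b')) = f (E a b) + f (E a' b')"
    and smult: "f (E (\<lambda>l. c * a l) (c * b)) = c * f (E a b)" if "f \<in> D" for f a b a' b' c
    using that unfolding D_iff by blast+
  show "(\<lambda>x\<in>carrier (NCP k). f x + g x) \<in> D" if g: "g \<in> D"
    unfolding D_iff by (simp add: E_in_NCP add[OF f] add[OF g] smult[OF f] smult[OF g] algebra_simps)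
  show "(\<lambda>x\<in>carrier (NCP k). c * f x) \<in> D"
    unfolding D_iff by (simp add: E_in_NCP add[OF f] smult[OF f] algebra_simps)
  show "(\<lambda>x\<in>carrier (NCP k). cnj (f (star CA x))) \<in> D"
    unfolding D_iff by (simp add: E_in_NCP E_star add[OF f] smult[OF f])
  show "(\<lambda>x\<in>carrier (NCP k). 0) \<in> D"
    unfolding D_iff by (simp add: E_in_NCP)
qed

lemma coordinate_system_dual:
  assumes \<delta>: "\<delta> \<in> D" and pos: "\<And>l. l < k + 2 \<Longrightarrow> \<exists>r>0. \<delta> (proj l) = complex_of_real r"
  shows "coordinate_system (dual_system (NCP k) \<delta>) (\<lambda>l f. f (proj l)) (k + 2)"
proof -
  let ?V = "dual_system (NCP k) \<delta>"
  have eqI: "f = g" if "f \<in> D" "g \<in> D" "\<And>a b. f (E a b) = g (E a b)" for f g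
    by (rule extensionalityI[of _ "carrier (NCP k)"]) (use that in \<open>auto elim: NCP_cases\<close>)
  have "Module.module (class_ring :: complex ring) ?V"
  proof (rule module_criteria, unfold dual_simps)
    show "cring (class_ring :: complex ring)" by (rule class_cring.is_cring)
    show "(\<lambda>x\<in>carrier (NCP k). 0) \<in> D" by (rule D_closed(4)[OF \<delta>])
    show "\<forall>f\<in>D. \<exists>g\<in>D. (\<lambda>x\<in>carrier (NCP k). f x + g x) = (\<lambda>x\<in>carrier (NCP k). 0)"
    proof
      fix f assume f: "f \<in> D"
      show "\<exists>g\<in>D. (\<lambda>x\<in>carrier (NCP k). f x + g x) = (\<lambda>x\<in>carrier (NCP k). 0)"
        by (rule bexI[OF _ D_closed(2)[OF f, of "-1"]]) (auto simp: restrict_def)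
    qed
    show "\<forall>f g. f \<in> D \<and> g \<in> D \<longrightarrow> (\<lambda>x\<in>carrier (NCP k). f x + g x) \<in> D"
      by (intro allI impI D_closed(1)) (erule conjunct1, erule conjunct2)
    show "\<forall>c f. c \<in> carrier (class_ring :: complex ring) \<and> f \<in> D \<longrightarrow> (\<lambda>x\<in>carrier (NCP k). c * f x) \<in> D"
      by (intro allI impI D_closed(2)) (erule conjunct2)
    show "\<forall>f\<in>D. (\<lambda>x\<in>carrier (NCP k). f x + (\<lambda>x\<in>carrier (NCP k). 0) x) = f"
    proof
      fix f assume f: "f \<in> D"
      show "(\<lambda>x\<in>carrier (NCP k). f x + (\<lambda>x\<in>carrier (NCP k). 0) x) = f"
        by (rule eqI[OF D_closed(1)[OF f D_closed(4)[OF f]] f]) (simp add: E_in_NCP)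
    qed
    show "\<forall>f\<in>D. (\<lambda>x\<in>carrier (NCP k). \<one>\<^bsub>class_ring\<^esub> * f x) = f"
    proof
      fix f assume f: "f \<in> D"
      show "(\<lambda>x\<in>carrier (NCP k). \<one>\<^bsub>class_ring\<^esub> * f x) = f"
        by (rule eqI[OF D_closed(2)[OF f] f]) (simp add: E_in_NCP)
    qed
  qed (auto simp: restrict_def fun_eq_iff algebra_simps)
  then have vs: "vectorspace (class_ring :: complex ring) ?V"
    by (intro vectorspace.intro class_field)
  have "star_vector_space_axioms ?V"
  proof (rule star_vector_space_axioms.intro, unfold dual_simps)
    fix f g c assume f: "f \<in> D" and g: "g \<in> D"
    show "(\<lambda>x\<in>carrier (NCP k). cnj ((\<lambda>x\<in>carrier (NCP k). f x + g x) (star CA x)))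
      = (\<lambda>x\<in>carrier (NCP k). (\<lambda>x\<in>carrier (NCP k). cnj (f (star CA x))) x
          + (\<lambda>x\<in>carrier (NCP k). cnj (g (star CA x))) x)"
      by (rule eqI[OF D_closed(3)[OF D_closed(1)[OF f g]]
            D_closed(1)[OF D_closed(3)[OF f] D_closed(3)[OF g]]])
        (simp add: E_in_NCP E_star)
  next
    fix f c assume f: "f \<in> D"
    show "(\<lambda>x\<in>carrier (NCP k). cnj (f (star CA x))) \<in> D" by (rule D_closed(3)[OF f])
    show "(\<lambda>x\<in>carrier (NCP k). cnj ((\<lambda>x\<in>carrier (NCP k). cnj (f (star CA x))) (star CA x))) = f"
      by (rule eqI[OF D_closed(3)[OF D_closed(3)[OF f]] f]) (simp add: E_in_NCP E_star)
    show "(\<lambda>x\<in>carrier (NCP k). cnj ((\<lambda>x\<in>carrier (NCP k). c * f x) (star CA x)))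
      = (\<lambda>x\<in>carrier (NCP k). cnj c * (\<lambda>x\<in>carrier (NCP k). cnj (f (star CA x))) x)"
      by (rule eqI[OF D_closed(3)[OF D_closed(2)[OF f]] D_closed(2)[OF D_closed(3)[OF f]]])
        (simp add: E_in_NCP E_star)
  qed
  with vs have star: "star_vector_space ?V" by (rule star_vector_space.intro)
  have "coordinate_system_axioms ?V (\<lambda>l f. f (proj l)) (k + 2)"
  proof (rule coordinate_system_axioms.intro, unfold dual_simps)
    show "(\<lambda>x\<in>carrier (NCP k). f x + g x) (proj l) = f (proj l) + g (proj l)" for f g l
      by (simp add: proj_in_NCP)
    show "(\<lambda>x\<in>carrier (NCP k). c * f x) (proj l) = c * f (proj l)" for f c l
      by (simp add: proj_in_NCP)
    show "(\<lambda>x\<in>carrier (NCP k). cnj (f (star CA x))) (proj l) = cnj (f (proj l))" for f l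
      by (simp add: proj_in_NCP star_proj)
    show "f = g" if "f \<in> D" "g \<in> D" "\<And>l. l < k + 2 \<Longrightarrow> f (proj l) = g (proj l)" for f g
      using that by (rule D_eqI)
    show "\<delta> \<in> D" by (rule \<delta>)
    show "\<exists>r>0. \<delta> (proj l) = complex_of_real r" if "l < k + 2" for l using that by (rule pos)
    fix F n
    have carr: "F \<in> carrier (mat_space n ?V) \<longleftrightarrow> F \<in> carrier_mat n n \<and> elements_mat F \<subseteq> D"
      by (simp add: mat_space_def dual_simps)
    have "F \<in> mcone ?V n \<longleftrightarrow> F \<in> carrier (mat_space n ?V) \<and>
        completely_positive (NCP k) (mat_system n) (\<lambda>x. map_mat (\<lambda>f. f x) F)"
      unfolding carr by (simp add: dual_system_def Let_def)
    then show "F \<in> mcone ?V n \<longleftrightarrow> F \<in> carrier (mat_space n ?V) \<and>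
        (\<forall>l<k + 2. psd {..<n} (\<lambda>i j. (F $$ (i, j)) (proj l)))"
      using completely_positive_iff[of F n] by (auto simp: mat_space_carrier dual_simps)
  qed
  with star show ?thesis by (rule coordinate_system.intro)
qed

text \<open>
  The case \<open>q = 1\<close>, \<open>n = 1\<close> of the dilation argument.
\<close>

lemma positive_functional:
  assumes f: "f \<in> D" and pos: "\<And>l. l < k + 2 \<Longrightarrow> \<exists>r\<ge>0. f (proj l) = complex_of_real r"
    and x: "mat 1 1 (\<lambda>_. x) \<in> mcone (NCP k) 1"
  shows "\<exists>r\<ge>0. f x = complex_of_real r"
proof -
  have "psd {..<1::nat} (\<lambda>i j. (mat 1 1 (\<lambda>_. f) $$ (i, j)) (proj l))" if l: "l < k + 2" for l
  proof -
    obtain r where r: "0 \<le> r" "f (proj l) = complex_of_real r" using pos[OF l] by blast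
    show ?thesis
      by (rule gram_psd[where L = "{0::nat}" and Y = "\<lambda>_ _. complex_of_real (sqrt r)"])
        (use r in \<open>simp flip: of_real_mult\<close>)
  qed
  from psd_of_cone[OF _ _ this x]
  have "psd ({..<1::nat} \<times> {..<1}) (\<lambda>p p'. (mat 1 1 (\<lambda>_. f) $$ (snd p, snd p')) (mat 1 1 (\<lambda>_. x) $$ (fst p, fst p')))"
    using f by simp
  from psd_diag[OF this, of "(0, 0)"] show ?thesis by simp
qed

text \<open>
  The corresponding functional sends \<open>1\<close> to \<open>k\<close> and \<open>w, \<dots>, w\<^sup>k\<^sup>-\<^sup>1, v\<close> to \<open>0\<close>: it is \<open>k\<close> times the canonical
  trace.
\<close>

definition trace_vec :: "complex vec" where
  "trace_vec = vec (k + 2) (\<lambda>l. if l < k then 1 else of_nat k / 2)"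

lemma trace_vec_S: "trace_vec \<in> S_carrier k"
  by (simp add: trace_vec_def S_carrier_def)

lemma trace_vec_pos: "l < k + 2 \<Longrightarrow> \<exists>r>0. trace_vec $ l = complex_of_real r"
  using k0 by (intro exI[of _ "if l < k then 1 else real k / 2"]) (simp add: trace_vec_def)

text \<open>
  Every character \<open>w \<mapsto> unity_root k l\<close>, \<open>v \<mapsto> \<plusminus>1\<close> is dominated by this functional, because \<open>k / 2 \<ge> 1\<close>.
  If the functional vanishes at a positive \<open>x\<close>, so do all these characters, and they separate the
  points of \<open>NCP(k)\<close>.
\<close>

lemma faithful_trace: "faithful_positive_functional (NCP k) (functional trace_vec)"
  unfolding faithful_positive_functional_def
proof (intro conjI ballI impI)
  show "functional trace_vec \<in> D" by (rule functional_D)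
  fix x assume x: "x \<in> carrier (NCP k)" and pos: "mat 1 1 (\<lambda>_. x) \<in> mcone (NCP k) 1"
  have fpos: "\<exists>r\<ge>0. functional z x = complex_of_real r"
    if "z \<in> S_carrier k" "\<And>l. l < k + 2 \<Longrightarrow> \<exists>r\<ge>0. z $ l = complex_of_real r" for z
    by (rule positive_functional[OF functional_D _ pos]) (simp add: functional_proj that)
  show "\<exists>r\<ge>0. functional trace_vec x = complex_of_real r"
    by (rule fpos[OF trace_vec_S]) (use trace_vec_pos less_imp_le in blast)
  assume zero: "functional trace_vec x = 0"
  obtain a b where xE: "x = E a b" using x by (rule NCP_cases)
  have char: "a l + s * b = 0" if l: "l < k" and s: "s = 1 \<or> s = - 1" for l s
  proof -
    \<comment> \<open>The tuple of the character given by \<open>l\<close> and \<open>s\<close>; \<open>y\<close> below is its difference to \<open>trace_vec\<close>.\<close>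
    define z where "z = vec (k + 2) (\<lambda>i. if i = l \<or> i = (if s = 1 then k else k + 1) then 1 else 0 :: complex)"
    have zl: "(\<Sum>i<k. z $ i * c i) = c l" for c :: "nat \<Rightarrow> complex"
    proof -
      have "(\<Sum>i<k. z $ i * c i) = (\<Sum>i<k. if i = l then c i else 0)"
        by (intro sum.cong HOL.refl) (auto simp: z_def)
      then show ?thesis using l by simp
    qed
    have zk: "z $ k = (if s = 1 then 1 else 0)" "z $ Suc k = (if s = 1 then 0 else 1)"
      using l by (auto simp: z_def)
    have z: "z \<in> S_carrier k"
      using zl[of "\<lambda>_. 1"] zk by (auto simp: S_carrier_def z_def)
    have Fz: "functional z x = a l + s * b"
      using s by (auto simp: xE functional_E zl zk)
    have zpos: "\<exists>r\<ge>0. z $ i = complex_of_real r" if "i < k + 2" for i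
      by (rule exI[of _ "if i = l \<or> i = (if s = 1 then k else k + 1) then 1 else 0"])
        (use that in \<open>simp add: z_def\<close>)
    obtain r where r: "0 \<le> r" "functional z x = complex_of_real r"
      using fpos[OF z zpos] by blast
    define y where "y = trace_vec + (-1) \<cdot>\<^sub>v z"
    have y: "y \<in> S_carrier k"
      unfolding y_def by (intro S_carrier_closed trace_vec_S z)
    have dims: "trace_vec \<in> carrier_vec (k + 2)" "z \<in> carrier_vec (k + 2)"
      by (simp_all add: trace_vec_def z_def)
    have yi: "y $ i = trace_vec $ i - z $ i" if "i < k + 2" for i
      using that dims by (simp add: y_def)
    have "\<exists>r\<ge>0. y $ i = complex_of_real r" if i: "i < k + 2" for i
    proof -
      let ?t = "if i < k then 1 else real k / 2"
      let ?s = "if i = l \<or> i = (if s = 1 then k else k + 1) then 1 else 0 :: real"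
      have "y $ i = complex_of_real (?t - ?s)"
        using i yi[OF i] by (simp add: trace_vec_def z_def)
      moreover have "0 \<le> ?t - ?s" using k2 l by auto
      ultimately show ?thesis by blast
    qed
    from fpos[OF y this] obtain r' where r': "0 \<le> r'" "functional y x = complex_of_real r'" by blast
    have "functional y x = functional trace_vec x - functional z x"
      by (simp add: xE functional_E yi sum_subtractf left_diff_distrib)
    then have "complex_of_real (r' + r) = 0" using zero r(2) r'(2) by simp
    then have "r' + r = 0" by (simp only: of_real_eq_0_iff)
    then have "r = 0" using r(1) r'(1) by linarith
    then show ?thesis using r(2) Fz by simp
  qed
  have "a l = 0 \<and> b = 0" if "l < k" for l
  proof -
    have "a l + b = 0" "a l - b = 0" using char[OF that, of 1] char[OF that, of "-1"] by simp_all
    then show ?thesis by (auto simp: complex_eq_iff)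
  qed
  then have "E a b = E (\<lambda>_. 0) 0" using k0 E_cong[of a "\<lambda>_. 0" 0] by simp
  then show "x = \<zero>\<^bsub>NCP k\<^esub>" by (simp add: xE NCP_simps E_zero)
qed

definition evaluation :: "((nat \<Rightarrow> (int + int) list set \<Rightarrow> complex) set \<Rightarrow> complex) \<Rightarrow> complex vec" where
  "evaluation f = vec (k + 2) (\<lambda>l. f (proj l))"

lemma evaluation_S: "f \<in> D \<Longrightarrow> evaluation f \<in> S_carrier k"
  using D_constraint[of f] by (simp add: evaluation_def S_carrier_def)

lemma functional_evaluation:
  assumes "f \<in> D"
  shows "functional (evaluation f) = f"
proof (rule D_eqI[OF functional_D assms])
  fix l assume "l < k + 2"
  then show "functional (evaluation f) (proj l) = f (proj l)"
    by (simp only: functional_proj evaluation_S[OF assms]) (simp add: evaluation_def)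
qed

lemma evaluation_functional:
  assumes "z \<in> S_carrier k"
  shows "evaluation (functional z) = z"
  using assms by (intro eq_vecI) (auto simp: evaluation_def functional_proj S_carrier_def simp del: add_2_eq_Suc')

lemma evaluation_bij: "bij_betw evaluation D (S_carrier k)"
proof (rule bij_betw_byWitness[where f' = functional])
  show "\<forall>f\<in>D. functional (evaluation f) = f" by (intro ballI functional_evaluation)
  show "\<forall>z\<in>S_carrier k. evaluation (functional z) = z" by (intro ballI evaluation_functional)
  show "evaluation ` D \<subseteq> S_carrier k" by (intro image_subsetI evaluation_S)
  show "functional ` S_carrier k \<subseteq> D" by (intro image_subsetI functional_D)
qed

theorem dual_iso:
  defines "\<delta> \<equiv> functional trace_vec"
  shows "operator_system (dual_system (NCP k) \<delta>)" (is "operator_system ?V")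
    and "operator_system (S_k2 k trace_vec)" (is "operator_system ?W")
    and "unital_complete_order_iso (dual_system (NCP k) \<delta>) (S_k2 k trace_vec) evaluation"
proof -
  interpret V: coordinate_system ?V "\<lambda>l f. f (proj l)" "k + 2"
    unfolding \<delta>_def using trace_vec_pos
    by (intro coordinate_system_dual functional_D) (simp add: functional_proj trace_vec_S)
  interpret W: coordinate_system ?W "\<lambda>l z. z $ l" "k + 2"
    by (rule coordinate_system_S_k2[OF trace_vec_S trace_vec_pos])
  show "operator_system ?V" by (rule V.operator_system_V)
  show "operator_system ?W" by (rule W.operator_system_V)
  have inv: "inv_into D evaluation z = functional z" if "z \<in> S_carrier k" for z
  proof (rule inv_into_f_eq)
    show "inj_on evaluation D" by (rule bij_betw_imp_inj_on[OF evaluation_bij])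
    show "functional z \<in> D" by (rule functional_D)
    show "evaluation (functional z) = z" by (rule evaluation_functional[OF that])
  qed
  have cp: "completely_positive ?V ?W evaluation"
    unfolding completely_positive_def
  proof (intro conjI allI ballI)
    show "evaluation \<in> LinearCombinations.module_hom (class_ring :: complex ring) ?V ?W"
    proof (rule module_homI, unfold dual_simps S_k2_simps)
      show "evaluation f \<in> S_carrier k" if "f \<in> D" for f using that by (rule evaluation_S)
      show "evaluation (\<lambda>x\<in>carrier (NCP k). f x + g x) = evaluation f + evaluation g" for f g
        by (intro eq_vecI) (auto simp: evaluation_def proj_in_NCP)
      show "evaluation (\<lambda>x\<in>carrier (NCP k). c * f x) = c \<cdot>\<^sub>v evaluation f" for c f
        by (intro eq_vecI) (auto simp: evaluation_def proj_in_NCP)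
    qed
    fix n F assume "F \<in> mcone ?V n"
    note F = V.coneD[OF this, unfolded dual_simps]
    show "map_mat evaluation F \<in> mcone ?W n"
    proof (rule W.coneI[OF _ F(4)])
      have "evaluation (F $$ (i, j)) \<in> S_carrier k" if "i < n" "j < n" for i j
        by (rule evaluation_S[OF F(3)[OF that]])
      then show "map_mat evaluation F \<in> carrier (mat_space n ?W)"
        unfolding mat_space_carrier S_k2_simps using F(2) by simp
      show "map_mat evaluation F $$ (i, j) $ l = (F $$ (i, j)) (proj l)"
        if "l < k + 2" "i < n" "j < n" for l i j
        using that F(2) by (simp add: evaluation_def)
    qed
  qed
  have cp': "completely_positive ?W ?V (inv_into D evaluation)"
    unfolding completely_positive_def
  proof (intro conjI allI ballI)
    show "inv_into D evaluation \<in> LinearCombinations.module_hom (class_ring :: complex ring) ?W ?V"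
    proof (rule module_homI, unfold S_k2_simps)
      fix z c assume z: "z \<in> S_carrier k"
      show "inv_into D evaluation z \<in> carrier ?V"
        unfolding inv[OF z] dual_simps(1) by (rule functional_D)
      have dim: "z \<in> carrier_vec (k + 2)" using z by (simp add: S_carrier_def)
      have "functional (c \<cdot>\<^sub>v z) = (\<lambda>x\<in>carrier (NCP k). c * functional z x)"
      proof (rule D_eqI[OF functional_D D_closed(2)[OF functional_D]])
        fix l assume l: "l < k + 2"
        show "functional (c \<cdot>\<^sub>v z) (proj l) = (\<lambda>x\<in>carrier (NCP k). c * functional z x) (proj l)"
          using l dim by (simp only: functional_proj z S_carrier_closed proj_in_NCP restrict_apply' index_smult_vec carrier_vecD)
      qed
      then show "inv_into D evaluation (c \<cdot>\<^sub>v z) =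
          c \<odot>\<^bsub>?V\<^esub> inv_into D evaluation z"
        by (simp only: inv z S_carrier_closed dual_simps(4))
    next
      fix y z assume y: "y \<in> S_carrier k" and z: "z \<in> S_carrier k"
      have dim: "y \<in> carrier_vec (k + 2)" "z \<in> carrier_vec (k + 2)"
        using y z by (simp_all add: S_carrier_def)
      have "functional (y + z) = (\<lambda>x\<in>carrier (NCP k). functional y x + functional z x)"
      proof (rule D_eqI[OF functional_D D_closed(1)[OF functional_D functional_D]])
        fix l assume l: "l < k + 2"
        show "functional (y + z) (proj l) = (\<lambda>x\<in>carrier (NCP k). functional y x + functional z x) (proj l)"
          using l dim by (simp only: functional_proj y z S_carrier_closed proj_in_NCP restrict_apply' index_add_vec carrier_vecD)
      qed
      then show "inv_into D evaluation (y + z) =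
          inv_into D evaluation y \<oplus>\<^bsub>?V\<^esub> inv_into D evaluation z"
        by (simp only: inv y z S_carrier_closed dual_simps(3))
    qed
    fix n Z assume "Z \<in> mcone ?W n"
    note Z = W.coneD[OF this, unfolded S_k2_simps]
    show "map_mat (inv_into D evaluation) Z \<in> mcone ?V n"
    proof (rule V.coneI[OF _ Z(4)])
      show "map_mat (inv_into D evaluation) Z \<in> carrier (mat_space n ?V)"
      proof -
        have "inv_into D evaluation (Z $$ (i, j)) \<in> carrier ?V" if "i < n" "j < n" for i j
          unfolding inv[OF Z(3)[OF that]] dual_simps(1) by (rule functional_D)
        then show ?thesis unfolding mat_space_carrier using Z(2) by simp
      qed
      fix l i j assume l: "l < k + 2" and ij: "i < n" "j < n"
      have "map_mat (inv_into D evaluation) Z $$ (i, j) = functional (Z $$ (i, j))"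
        using Z(2) ij by (simp only: inv[OF Z(3)[OF ij]] index_map_mat carrier_matD)
      then show "(map_mat (inv_into D evaluation) Z $$ (i, j)) (proj l) = Z $$ (i, j) $ l"
        by (simp only: functional_proj[OF Z(3)[OF ij] l])
    qed
  qed
  show "unital_complete_order_iso ?V ?W evaluation"
    unfolding unital_complete_order_iso_def
    using evaluation_bij evaluation_functional[OF trace_vec_S] cp cp'
    by (simp add: dual_simps(1,6) S_k2_simps \<delta>_def)
qed

end

theorem theorem5p3:
  fixes k :: nat
  assumes "3 \<le> k"
  shows "\<exists>\<delta> e \<phi>.
    faithful_positive_functional (NCP k) \<delta> \<and>
    operator_system (dual_system (NCP k) \<delta>) \<and>
    operator_system (S_k2 k e) \<and>
    unital_complete_order_iso (dual_system (NCP k) \<delta>) (S_k2 k e) \<phi>"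
proof -
  interpret ncp k by unfold_locales (use assms in simp)
  from faithful_trace dual_iso show ?thesis by blast
qed

end
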